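(* Let $\mathcal C$ be a monoidal category, $\mathcal A$ an abelian monoidal category, and $\Sigma$ a class of weak equivalences of $\mathbf{Mon}(\mathcal C^o,\mathbf C^*(\mathcal A))$ which contains the homotopy equivalences and is compatible with the Alexander–Whitney simple functor $s_{AW}$. Let $K^*,L^*$ be objects of $\mathbf{Mon}(\mathcal C^o,\mathbf C^*(\mathcal A))$ concentrated in non-negative degrees, and let $\mathbf T$ be the triple in $\mathbf{Mon}(\mathcal C^o,\mathbf C^*(\mathcal A))$ induced by a monoidal cotriple $\mathbf G$ on $\mathcal C$; $\mathbf T$ is compatible with $\Sigma$, i.e. $T(\Sigma)\subseteq\Sigma$. Suppose that $K^*,L^*$ are $\mathbf T$-acyclic and $\mathbf T$-presentable. Then any monoidal transformation $H^0(K^* )\to H^0(L^* )$ lifts to a unique morphism $K^*\to L^*$ in $\mathbf{Mon}(\mathcal C^o,\mathbf C^*(\mathcal A))[\Sigma^{-1}]$. In particular, if $H^0(K^* )$ and $H^0(L^* )$ are isomorphic (as monoidal functors), then $K^*$ and $L^*$ are weakly equivalent (with respect to $\Sigma$).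
   Context: Monoidal functors are lax: $(F,\kappa,\eta)$ with natural $\kappa_{X,Y}:FX\otimes FY\to F(X\otimes Y)$ and $\eta:\mathbf 1\to F\mathbf 1$ satisfying associativity and unit constraints; monoidal natural transformations are compatible with $\kappa,\eta$. An abelian monoidal category is an abelian category with biadditive monoidal product. $\mathbf C^*(\mathcal A)$ is the monoidal category of uniformly bounded below cochain complexes in $\mathcal A$ (vanishing in degrees below some $n$; for functors, $n$ independent of the object) with the usual tensor product. $\mathcal C^o$ is the dual (opposite) monoidal category, and $\mathbf{Mon}(\mathcal C^o,\mathbf C^*(\mathcal A))$ is the category of contravariant monoidal functors $\mathcal C\to\mathbf C^*(\mathcal A)$ and monoidal natural transformations. Weak equivalences: an acyclic class $\Gamma$ of cochain complexes in $\mathbf C^*(\mathcal B)$, with $\mathcal B=\mathbf{Fun}(\mathcal C^o,\mathcal A)$, is a class such that: $0\in\Gamma$; $\Gamma$ is stable under degree shift in the sense that a complex is in $\Gamma$ iff its shift by one is; if two complexes are homotopy equivalent, one is in $\Gamma$ iff the other is; every complex in $\Gamma$ is acyclic; the total complex of a bounded below double complex all of whose rows are in $\Gamma$ is in $\Gamma$. $\Sigma$ is the class of morphisms of $\mathbf{Mon}(\mathcal C^o,\mathbf C^*(\mathcal A))$ whose mapping cone is in $\Gamma$. Two objects are weakly equivalent if connected by a finite zigzag of morphisms of $\mathbf{Mon}(\mathcal C^o,\mathbf C^*(\mathcal A))$ in $\Sigma$. $[\Sigma^{-1}]$ denotes localization. Alexander–Whitney simple functor $s_{AW}:\Delta\mathbf{Mon}(\mathcal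 C^o,\mathbf C^*(\mathcal A))\to\mathbf{Mon}(\mathcal C^o,\mathbf C^*(\mathcal A))$: a cosimplicial object $K^\bullet$ goes to the functor taking $X$ to the total complex of the double complex $K^p(X)^q$ with cosimplicial differential $\sum_i(-1)^i\partial^i$ and internal differential, with Künneth morphism obtained by composing (with usual Koszul signs) the Künneth morphisms of the $K^n$ with the dual Alexander–Whitney map (on cosimplicial degrees $p,q$: last cofaces $\partial^{p+q}\cdots\partial^{p+1}$ on the first factor tensor the iterated zeroth coface $(\partial^0)^p$ on the second). Compatibility of $\Sigma$: if $f^\bullet$ is a cosimplicial morphism with each $f^n\in\Sigma$, then $s_{AW}(f^\bullet)\in\Sigma$. A monoidal cotriple $\mathbf G=(G,\varepsilon,\delta)$ on $\mathcal C$ is a comonad with $G$ a monoidal functor and $\varepsilon:G\Rightarrow\mathrm{id}$, $\delta:G\Rightarrow G^2$ monoidal natural transformations. It induces the triple (monad) $\mathbf T=(T,\eta,\mu)$ with $T(K^* )=K^*G$ and $\eta,\mu$ induced by $\varepsilon,\delta$. The standard construction is the coaugmented cosimplicial object $B^n(K)=T^{n+1}(K)$ with cofaces from $\eta$ and codegeneracies from $\mu$; $B^*=s_{AW}B^\bullet$, with natural transformation $\mathrm{id}\Rightarrow B^*$ induced by $\eta$. $K^*$ is $\mathbf T$-presentable if $K^*\to B^*(K^* )$ is in $\Sigma$. $H^0(K^* )$ is viewed as a monoidal functor concentrated in degree $0$; $K^*$ (in non-negative degrees) is $\mathbf T$-acyclic if $T$ applied to the inclusion $H^0(K^* )\to K^*$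 is in $\Sigma$. A morphism $f:K^*\to L^*$ lifts $\alpha:H^0(K^* )\to H^0(L^* )$ if the composite $H^0(K^* )\to K^*\xrightarrow{f}L^*$ equals $H^0(K^* )\xrightarrow{\alpha}H^0(L^* )\to L^*$ in the localized category.
   Formalization: The monoidal cotriple G is taken with structure maps G(X⊗Y)→GX⊗GY and G1→1 (monoidal on the dual category), since for G lax on C the functor T(K)=KG on contravariant monoidal functors has no Künneth morphism; strong monoidal G is covered by inverting its structure maps. *)

theory Defs
  imports "HOL-Algebra.FiniteProduct" "HOL-Library.FuncSet"
begin

section \<open>Categories, functors, monoidal categories\<close>

record ('o, 'm) cat =
  Obj :: "'o set"
  Arr :: "'m set"
  Dom :: "'m \<Rightarrow> 'o"
  Cod :: "'m \<Rightarrow> 'o"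
  Id :: "'o \<Rightarrow> 'm"
  Comp :: "'m \<Rightarrow> 'm \<Rightarrow> 'm" (infixr "\<cdot>\<index>" 70)

definition Hom :: "('o, 'm, 'z) cat_scheme \<Rightarrow> 'o \<Rightarrow> 'o \<Rightarrow> 'm set" where
  "Hom C X Y = {f \<in> Arr C. Dom C f = X \<and> Cod C f = Y}"

locale category =
  fixes C :: "('o, 'm, 'z) cat_scheme"
  assumes dom_obj: "f \<in> Arr C \<Longrightarrow> Dom C f \<in> Obj C"
    and cod_obj: "f \<in> Arr C \<Longrightarrow> Cod C f \<in> Obj C"
    and id_hom: "X \<in> Obj C \<Longrightarrow> Id C X \<in> Hom C X X"
    and comp_hom: "\<lbrakk>f \<in> Hom C X Y; g \<in> Hom C Y Z\<rbrakk> \<Longrightarrow> g \<cdot>\<^bsub>C\<^esub> f \<in> Hom C X Z"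
    and id_left: "f \<in> Hom C X Y \<Longrightarrow> Id C Y \<cdot>\<^bsub>C\<^esub> f = f"
    and id_right: "f \<in> Hom C X Y \<Longrightarrow> f \<cdot>\<^bsub>C\<^esub> Id C X = f"
    and comp_assoc: "\<lbrakk>f \<in> Hom C X Y; g \<in> Hom C Y Z; h \<in> Hom C Z V\<rbrakk>
      \<Longrightarrow> (h \<cdot>\<^bsub>C\<^esub> g) \<cdot>\<^bsub>C\<^esub> f = h \<cdot>\<^bsub>C\<^esub> (g \<cdot>\<^bsub>C\<^esub> f)"

definition inverse_arrows :: "('o, 'm, 'z) cat_scheme \<Rightarrow> 'm \<Rightarrow> 'm \<Rightarrow> bool" where
  "inverse_arrows C f g \<longleftrightarrow> f \<in> Arr C \<and> g \<in> Hom C (Cod C f) (Dom C f) \<and>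
     g \<cdot>\<^bsub>C\<^esub> f = Id C (Dom C f) \<and> f \<cdot>\<^bsub>C\<^esub> g = Id C (Cod C f)"

definition is_iso :: "('o, 'm, 'z) cat_scheme \<Rightarrow> 'm \<Rightarrow> bool" where
  "is_iso C f \<longleftrightarrow> (\<exists>g. inverse_arrows C f g)"

definition inv_arr :: "('o, 'm, 'z) cat_scheme \<Rightarrow> 'm \<Rightarrow> 'm" where
  "inv_arr C f = (THE g. inverse_arrows C f g)"

definition isomorphic :: "('o, 'm, 'z) cat_scheme \<Rightarrow> 'o \<Rightarrow> 'o \<Rightarrow> bool" where
  "isomorphic C X Y \<longleftrightarrow> (\<exists>f \<in> Hom C X Y. is_iso C f)"

definition is_mono :: "('o, 'm, 'z) cat_scheme \<Rightarrow> 'm \<Rightarrow> bool" where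
  "is_mono C f \<longleftrightarrow> f \<in> Arr C \<and>
     (\<forall>Z \<in> Obj C. \<forall>g \<in> Hom C Z (Dom C f). \<forall>h \<in> Hom C Z (Dom C f).
        f \<cdot>\<^bsub>C\<^esub> g = f \<cdot>\<^bsub>C\<^esub> h \<longrightarrow> g = h)"

definition is_epi :: "('o, 'm, 'z) cat_scheme \<Rightarrow> 'm \<Rightarrow> bool" where
  "is_epi C f \<longleftrightarrow> f \<in> Arr C \<and>
     (\<forall>Z \<in> Obj C. \<forall>g \<in> Hom C (Cod C f) Z. \<forall>h \<in> Hom C (Cod C f) Z.
        g \<cdot>\<^bsub>C\<^esub> f = h \<cdot>\<^bsub>C\<^esub> f \<longrightarrow> g = h)"

definition full_sub :: "('o, 'm) cat \<Rightarrow> 'o set \<Rightarrow> ('o, 'm) cat" where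
  "full_sub C S = C\<lparr>Obj := Obj C \<inter> S, Arr := {f \<in> Arr C. Dom C f \<in> S \<and> Cod C f \<in> S}\<rparr>"

definition op_cat :: "('o, 'm, 'z) cat_scheme \<Rightarrow> ('o, 'm) cat" where
  "op_cat C = \<lparr>Obj = Obj C, Arr = Arr C, Dom = Cod C, Cod = Dom C, Id = Id C,
     Comp = (\<lambda>g f. f \<cdot>\<^bsub>C\<^esub> g)\<rparr>"

text \<open>The data of a monoidal structure: product of objects and of arrows, unit object,
  associator \<open>(X \<otimes> Y) \<otimes> Z \<rightarrow> X \<otimes> (Y \<otimes> Z)\<close>, left unitor \<open>1 \<otimes> X \<rightarrow> X\<close> and
  right unitor \<open>X \<otimes> 1 \<rightarrow> X\<close>.\<close>

record ('o, 'm) tensor =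
  TO :: "'o \<Rightarrow> 'o \<Rightarrow> 'o"
  TA :: "'m \<Rightarrow> 'm \<Rightarrow> 'm"
  TU :: "'o"
  Asc :: "'o \<Rightarrow> 'o \<Rightarrow> 'o \<Rightarrow> 'm"
  LUn :: "'o \<Rightarrow> 'm"
  RUn :: "'o \<Rightarrow> 'm"

locale monoidal_category = category C
  for C :: "('o, 'm, 'z) cat_scheme" +
  fixes M :: "('o, 'm) tensor"
  assumes tensor_obj: "\<lbrakk>X \<in> Obj C; Y \<in> Obj C\<rbrakk> \<Longrightarrow> TO M X Y \<in> Obj C"
    and tensor_hom: "\<lbrakk>f \<in> Hom C X X'; g \<in> Hom C Y Y'\<rbrakk> \<Longrightarrow> TA M f g \<in> Hom C (TO M X Y) (TO M X' Y')"
    and tensor_id: "\<lbrakk>X \<in> Obj C; Y \<in> Obj C\<rbrakk> \<Longrightarrow> TA M (Id C X) (Id C Y) = Id C (TO M X Y)"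
    and tensor_comp: "\<lbrakk>f \<in> Hom C X X'; f' \<in> Hom C X' X''; g \<in> Hom C Y Y'; g' \<in> Hom C Y' Y''\<rbrakk>
      \<Longrightarrow> TA M (f' \<cdot>\<^bsub>C\<^esub> f) (g' \<cdot>\<^bsub>C\<^esub> g) = TA M f' g' \<cdot>\<^bsub>C\<^esub> TA M f g"
    and unit_obj: "TU M \<in> Obj C"
    and assoc_hom: "\<lbrakk>X \<in> Obj C; Y \<in> Obj C; Z \<in> Obj C\<rbrakk>
      \<Longrightarrow> Asc M X Y Z \<in> Hom C (TO M (TO M X Y) Z) (TO M X (TO M Y Z))"
    and assoc_iso: "\<lbrakk>X \<in> Obj C; Y \<in> Obj C; Z \<in> Obj C\<rbrakk> \<Longrightarrow> is_iso C (Asc M X Y Z)"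
    and assoc_nat: "\<lbrakk>f \<in> Hom C X X'; g \<in> Hom C Y Y'; h \<in> Hom C Z Z'\<rbrakk>
      \<Longrightarrow> Asc M X' Y' Z' \<cdot>\<^bsub>C\<^esub> TA M (TA M f g) h = TA M f (TA M g h) \<cdot>\<^bsub>C\<^esub> Asc M X Y Z"
    and lunit_hom: "X \<in> Obj C \<Longrightarrow> LUn M X \<in> Hom C (TO M (TU M) X) X"
    and lunit_iso: "X \<in> Obj C \<Longrightarrow> is_iso C (LUn M X)"
    and lunit_nat: "f \<in> Hom C X Y \<Longrightarrow> LUn M Y \<cdot>\<^bsub>C\<^esub> TA M (Id C (TU M)) f = f \<cdot>\<^bsub>C\<^esub> LUn M X"
    and runit_hom: "X \<in> Obj C \<Longrightarrow> RUn M X \<in> Hom C (TO M X (TU M)) X"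
    and runit_iso: "X \<in> Obj C \<Longrightarrow> is_iso C (RUn M X)"
    and runit_nat: "f \<in> Hom C X Y \<Longrightarrow> RUn M Y \<cdot>\<^bsub>C\<^esub> TA M f (Id C (TU M)) = f \<cdot>\<^bsub>C\<^esub> RUn M X"
    and triangle: "\<lbrakk>X \<in> Obj C; Y \<in> Obj C\<rbrakk>
      \<Longrightarrow> TA M (Id C X) (LUn M Y) \<cdot>\<^bsub>C\<^esub> Asc M X (TU M) Y = TA M (RUn M X) (Id C Y)"
    and pentagon: "\<lbrakk>X \<in> Obj C; Y \<in> Obj C; Z \<in> Obj C; V \<in> Obj C\<rbrakk>
      \<Longrightarrow> Asc M X Y (TO M Z V) \<cdot>\<^bsub>C\<^esub> Asc M (TO M X Y) Z V
        = TA M (Id C X) (Asc M Y Z V) \<cdot>\<^bsub>C\<^esub> Asc M X (TO M Y Z) V \<cdot>\<^bsub>C\<^esub> TA M (Asc M X Y Z) (Id C V)"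

definition op_tensor :: "('o, 'm, 'z) cat_scheme \<Rightarrow> ('o, 'm) tensor \<Rightarrow> ('o, 'm) tensor" where
  "op_tensor C M = \<lparr>TO = TO M, TA = TA M, TU = TU M,
     Asc = (\<lambda>X Y Z. inv_arr C (Asc M X Y Z)),
     LUn = (\<lambda>X. inv_arr C (LUn M X)), RUn = (\<lambda>X. inv_arr C (RUn M X))\<rparr>"

text \<open>Functors and families of components are extensional outside the carriers, so that
  equality of functors and of transformations is HOL equality.\<close>

record ('o, 'm, 'p, 'n) fctr =
  FO :: "'o \<Rightarrow> 'p"
  FM :: "'m \<Rightarrow> 'n"

definition is_functor ::
  "('o, 'm, 'y) cat_scheme \<Rightarrow> ('p, 'n, 'z) cat_scheme \<Rightarrow> ('o, 'm, 'p, 'n, 'w) fctr_scheme \<Rightarrow> bool" where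
  "is_functor C D F \<longleftrightarrow>
     FO F \<in> extensional (Obj C) \<and> FM F \<in> extensional (Arr C) \<and>
     (\<forall>X \<in> Obj C. FO F X \<in> Obj D) \<and>
     (\<forall>f \<in> Arr C. FM F f \<in> Hom D (FO F (Dom C f)) (FO F (Cod C f))) \<and>
     (\<forall>X \<in> Obj C. FM F (Id C X) = Id D (FO F X)) \<and>
     (\<forall>f \<in> Arr C. \<forall>g \<in> Arr C. Cod C f = Dom C g \<longrightarrow> FM F (g \<cdot>\<^bsub>C\<^esub> f) = FM F g \<cdot>\<^bsub>D\<^esub> FM F f)"

definition is_nat ::
  "('o, 'm, 'y) cat_scheme \<Rightarrow> ('p, 'n, 'z) cat_scheme \<Rightarrow> ('o, 'm, 'p, 'n, 'w) fctr_scheme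
     \<Rightarrow> ('o, 'm, 'p, 'n, 'w) fctr_scheme \<Rightarrow> ('o \<Rightarrow> 'n) \<Rightarrow> bool" where
  "is_nat C D F G t \<longleftrightarrow>
     t \<in> extensional (Obj C) \<and>
     (\<forall>X \<in> Obj C. t X \<in> Hom D (FO F X) (FO G X)) \<and>
     (\<forall>f \<in> Arr C. t (Cod C f) \<cdot>\<^bsub>D\<^esub> FM F f = FM G f \<cdot>\<^bsub>D\<^esub> t (Dom C f))"

text \<open>A lax monoidal functor: \<open>FK F X Y : F X \<otimes> F Y \<rightarrow> F (X \<otimes> Y)\<close> is the Kuenneth morphism,
  \<open>FU F : 1 \<rightarrow> F 1\<close> the unit morphism.\<close>

record ('o, 'm, 'p, 'n) mfctr = "('o, 'm, 'p, 'n) fctr" +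
  FK :: "'o \<Rightarrow> 'o \<Rightarrow> 'n"
  FU :: "'n"

definition is_mfunctor ::
  "('o, 'm, 'y) cat_scheme \<Rightarrow> ('o, 'm) tensor \<Rightarrow> ('p, 'n, 'z) cat_scheme \<Rightarrow> ('p, 'n) tensor
     \<Rightarrow> ('o, 'm, 'p, 'n) mfctr \<Rightarrow> bool" where
  "is_mfunctor C M D N F \<longleftrightarrow>
     is_functor C D F \<and>
     FK F \<in> extensional (Obj C) \<and> (\<forall>X \<in> Obj C. FK F X \<in> extensional (Obj C)) \<and>
     (\<forall>X \<in> Obj C. \<forall>Y \<in> Obj C. FK F X Y \<in> Hom D (TO N (FO F X) (FO F Y)) (FO F (TO M X Y))) \<and>
     FU F \<in> Hom D (TU N) (FO F (TU M)) \<and>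
     (\<forall>f \<in> Arr C. \<forall>g \<in> Arr C.
        FK F (Cod C f) (Cod C g) \<cdot>\<^bsub>D\<^esub> TA N (FM F f) (FM F g)
        = FM F (TA M f g) \<cdot>\<^bsub>D\<^esub> FK F (Dom C f) (Dom C g)) \<and>
     (\<forall>X \<in> Obj C. \<forall>Y \<in> Obj C. \<forall>Z \<in> Obj C.
        FM F (Asc M X Y Z) \<cdot>\<^bsub>D\<^esub> FK F (TO M X Y) Z \<cdot>\<^bsub>D\<^esub> TA N (FK F X Y) (Id D (FO F Z))
        = FK F X (TO M Y Z) \<cdot>\<^bsub>D\<^esub> TA N (Id D (FO F X)) (FK F Y Z)
            \<cdot>\<^bsub>D\<^esub> Asc N (FO F X) (FO F Y) (FO F Z)) \<and>
     (\<forall>X \<in> Obj C.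
        FM F (LUn M X) \<cdot>\<^bsub>D\<^esub> FK F (TU M) X \<cdot>\<^bsub>D\<^esub> TA N (FU F) (Id D (FO F X)) = LUn N (FO F X)) \<and>
     (\<forall>X \<in> Obj C.
        FM F (RUn M X) \<cdot>\<^bsub>D\<^esub> FK F X (TU M) \<cdot>\<^bsub>D\<^esub> TA N (Id D (FO F X)) (FU F) = RUn N (FO F X))"

definition is_mnat ::
  "('o, 'm, 'y) cat_scheme \<Rightarrow> ('o, 'm) tensor \<Rightarrow> ('p, 'n, 'z) cat_scheme \<Rightarrow> ('p, 'n) tensor
     \<Rightarrow> ('o, 'm, 'p, 'n) mfctr \<Rightarrow> ('o, 'm, 'p, 'n) mfctr \<Rightarrow> ('o \<Rightarrow> 'n) \<Rightarrow> bool" where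
  "is_mnat C M D N F G t \<longleftrightarrow>
     is_nat C D F G t \<and>
     (\<forall>X \<in> Obj C. \<forall>Y \<in> Obj C.
        t (TO M X Y) \<cdot>\<^bsub>D\<^esub> FK F X Y = FK G X Y \<cdot>\<^bsub>D\<^esub> TA N (t X) (t Y)) \<and>
     t (TU M) \<cdot>\<^bsub>D\<^esub> FU F = FU G"

definition id_mf :: "('o, 'm, 'z) cat_scheme \<Rightarrow> ('o, 'm) tensor \<Rightarrow> ('o, 'm, 'o, 'm) mfctr" where
  "id_mf C M = \<lparr>FO = (\<lambda>X \<in> Obj C. X), FM = (\<lambda>f \<in> Arr C. f),
     FK = (\<lambda>X \<in> Obj C. \<lambda>Y \<in> Obj C. Id C (TO M X Y)), FU = Id C (TU M)\<rparr>"

definition comp_mf ::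
  "('o, 'm, 'y) cat_scheme \<Rightarrow> ('p, 'n, 'z) cat_scheme \<Rightarrow> ('o, 'm, 'p, 'n) mfctr
     \<Rightarrow> ('o, 'm, 'o, 'm) mfctr \<Rightarrow> ('o, 'm, 'p, 'n) mfctr" where
  "comp_mf C D K G = \<lparr>FO = (\<lambda>X \<in> Obj C. FO K (FO G X)), FM = (\<lambda>f \<in> Arr C. FM K (FM G f)),
     FK = (\<lambda>X \<in> Obj C. \<lambda>Y \<in> Obj C. FM K (FK G X Y) \<cdot>\<^bsub>D\<^esub> FK K (FO G X) (FO G Y)),
     FU = FM K (FU G) \<cdot>\<^bsub>D\<^esub> FU K\<rparr>"

text \<open>In the categories constructed below an arrow is a triple: source, target, data.\<close>

type_synonym ('x, 'y) tarr = "'x \<times> 'x \<times> 'y"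

abbreviation src :: "('x, 'y) tarr \<Rightarrow> 'x" where "src a \<equiv> fst a"
abbreviation tgt :: "('x, 'y) tarr \<Rightarrow> 'x" where "tgt a \<equiv> fst (snd a)"
abbreviation dat :: "('x, 'y) tarr \<Rightarrow> 'y" where "dat a \<equiv> snd (snd a)"

definition mon_cat ::
  "('o, 'm, 'y) cat_scheme \<Rightarrow> ('o, 'm) tensor \<Rightarrow> ('p, 'n, 'z) cat_scheme \<Rightarrow> ('p, 'n) tensor
     \<Rightarrow> (('o, 'm, 'p, 'n) mfctr, (('o, 'm, 'p, 'n) mfctr, 'o \<Rightarrow> 'n) tarr) cat" where
  "mon_cat C M D N = \<lparr>Obj = {F. is_mfunctor C M D N F},
     Arr = {(F, G, t). is_mfunctor C M D N F \<and> is_mfunctor C M D N G \<and> is_mnat C M D N F G t},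
     Dom = (\<lambda>a. src a), Cod = (\<lambda>a. tgt a),
     Id = (\<lambda>F. (F, F, \<lambda>X \<in> Obj C. Id D (FO F X))),
     Comp = (\<lambda>b a. (src a, tgt b, \<lambda>X \<in> Obj C. dat b X \<cdot>\<^bsub>D\<^esub> dat a X))\<rparr>"


section \<open>Abelian categories\<close>

record ('o, 'm) acat = "('o, 'm) cat" +
  Zer :: "'o \<Rightarrow> 'o \<Rightarrow> 'm"
  Add :: "'m \<Rightarrow> 'm \<Rightarrow> 'm"

definition hom_group :: "('o, 'm, 'z) acat_scheme \<Rightarrow> 'o \<Rightarrow> 'o \<Rightarrow> 'm monoid" where
  "hom_group A X Y = \<lparr>carrier = Hom A X Y, mult = Add A, one = Zer A X Y\<rparr>"

definition neg :: "('o, 'm, 'z) acat_scheme \<Rightarrow> 'm \<Rightarrow> 'm" where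
  "neg A f = inv\<^bsub>hom_group A (Dom A f) (Cod A f)\<^esub> f"

text \<open>\<open>sgn_arr A k f\<close> is \<open>(-1)^k f\<close>.\<close>

definition sgn_arr :: "('o, 'm, 'z) acat_scheme \<Rightarrow> int \<Rightarrow> 'm \<Rightarrow> 'm" where
  "sgn_arr A k f = (if even k then f else neg A f)"

text \<open>The sum of a family of arrows \<open>X \<rightarrow> Y\<close>, almost all of which vanish.\<close>

definition hsum :: "('o, 'm, 'z) acat_scheme \<Rightarrow> 'o \<Rightarrow> 'o \<Rightarrow> ('i \<Rightarrow> 'm) \<Rightarrow> 'm" where
  "hsum A X Y f = finprod (hom_group A X Y) f {i. f i \<noteq> Zer A X Y}"

definition is_zero_obj :: "('o, 'm, 'z) cat_scheme \<Rightarrow> 'o \<Rightarrow> bool" where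
  "is_zero_obj A Z \<longleftrightarrow> Z \<in> Obj A \<and>
     (\<forall>X \<in> Obj A. (\<exists>!f. f \<in> Hom A X Z) \<and> (\<exists>!f. f \<in> Hom A Z X))"

definition zero_obj :: "('o, 'm, 'z) cat_scheme \<Rightarrow> 'o" where
  "zero_obj A = (SOME Z. is_zero_obj A Z)"

text \<open>Biproducts are indexed by a whole type; infinite index types are used for families
  almost all of whose members are zero objects.\<close>

record ('o, 'm, 'i) biprod =
  bob :: "'o"
  bin :: "'i \<Rightarrow> 'm"
  bpr :: "'i \<Rightarrow> 'm"

definition is_biproduct ::
  "('o, 'm, 'z) acat_scheme \<Rightarrow> ('i \<Rightarrow> 'o) \<Rightarrow> ('o, 'm, 'i) biprod \<Rightarrow> bool" where
  "is_biproduct A V S \<longleftrightarrow> bob S \<in> Obj A \<and>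
     (\<forall>i. bin S i \<in> Hom A (V i) (bob S) \<and> bpr S i \<in> Hom A (bob S) (V i)) \<and>
     (\<forall>i j. bpr S j \<cdot>\<^bsub>A\<^esub> bin S i = (if i = j then Id A (V i) else Zer A (V i) (V j))) \<and>
     finite {i. bin S i \<cdot>\<^bsub>A\<^esub> bpr S i \<noteq> Zer A (bob S) (bob S)} \<and>
     hsum A (bob S) (bob S) (\<lambda>i. bin S i \<cdot>\<^bsub>A\<^esub> bpr S i) = Id A (bob S)"

definition dsum :: "('o, 'm, 'z) acat_scheme \<Rightarrow> ('i \<Rightarrow> 'o) \<Rightarrow> ('o, 'm, 'i) biprod" where
  "dsum A V = (SOME S. is_biproduct A V S)"

definition is_kernel :: "('o, 'm, 'z) acat_scheme \<Rightarrow> 'm \<Rightarrow> 'm \<Rightarrow> bool" where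
  "is_kernel A f k \<longleftrightarrow> f \<in> Arr A \<and> k \<in> Arr A \<and> Cod A k = Dom A f \<and>
     f \<cdot>\<^bsub>A\<^esub> k = Zer A (Dom A k) (Cod A f) \<and>
     (\<forall>h \<in> Arr A. Cod A h = Dom A f \<and> f \<cdot>\<^bsub>A\<^esub> h = Zer A (Dom A h) (Cod A f)
        \<longrightarrow> (\<exists>!u. u \<in> Hom A (Dom A h) (Dom A k) \<and> k \<cdot>\<^bsub>A\<^esub> u = h))"

definition is_cokernel :: "('o, 'm, 'z) acat_scheme \<Rightarrow> 'm \<Rightarrow> 'm \<Rightarrow> bool" where
  "is_cokernel A f c \<longleftrightarrow> f \<in> Arr A \<and> c \<in> Arr A \<and> Dom A c = Cod A f \<and>
     c \<cdot>\<^bsub>A\<^esub> f = Zer A (Dom A f) (Cod A c) \<and>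
     (\<forall>h \<in> Arr A. Dom A h = Cod A f \<and> h \<cdot>\<^bsub>A\<^esub> f = Zer A (Dom A f) (Cod A h)
        \<longrightarrow> (\<exists>!u. u \<in> Hom A (Cod A c) (Cod A h) \<and> u \<cdot>\<^bsub>A\<^esub> c = h))"

locale abelian_category = category A
  for A :: "('o, 'm, 'z) acat_scheme" +
  assumes hom_comm_group: "\<lbrakk>X \<in> Obj A; Y \<in> Obj A\<rbrakk> \<Longrightarrow> comm_group (hom_group A X Y)"
    and comp_add_left: "\<lbrakk>f \<in> Hom A X Y; g \<in> Hom A Y Z; g' \<in> Hom A Y Z\<rbrakk>
      \<Longrightarrow> Add A g g' \<cdot>\<^bsub>A\<^esub> f = Add A (g \<cdot>\<^bsub>A\<^esub> f) (g' \<cdot>\<^bsub>A\<^esub> f)"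
    and comp_add_right: "\<lbrakk>f \<in> Hom A X Y; f' \<in> Hom A X Y; g \<in> Hom A Y Z\<rbrakk>
      \<Longrightarrow> g \<cdot>\<^bsub>A\<^esub> Add A f f' = Add A (g \<cdot>\<^bsub>A\<^esub> f) (g \<cdot>\<^bsub>A\<^esub> f')"
    and ex_zero: "\<exists>Z. is_zero_obj A Z"
    and ex_biproduct: "\<lbrakk>X \<in> Obj A; Y \<in> Obj A\<rbrakk>
      \<Longrightarrow> \<exists>S. is_biproduct A (\<lambda>b::bool. if b then X else Y) S"
    and ex_kernel: "f \<in> Arr A \<Longrightarrow> \<exists>k. is_kernel A f k"
    and ex_cokernel: "f \<in> Arr A \<Longrightarrow> \<exists>c. is_cokernel A f c"
    and mono_normal: "is_mono A f \<Longrightarrow> \<exists>g. is_kernel A g f"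
    and epi_normal: "is_epi A f \<Longrightarrow> \<exists>g. is_cokernel A g f"

locale abelian_monoidal_category = abelian_category A + monoidal_category A M
  for A :: "('o, 'm, 'z) acat_scheme" and M :: "('o, 'm) tensor" +
  assumes tensor_add_left: "\<lbrakk>f \<in> Hom A X Y; f' \<in> Hom A X Y; g \<in> Arr A\<rbrakk>
      \<Longrightarrow> TA M (Add A f f') g = Add A (TA M f g) (TA M f' g)"
    and tensor_add_right: "\<lbrakk>f \<in> Arr A; g \<in> Hom A X Y; g' \<in> Hom A X Y\<rbrakk>
      \<Longrightarrow> TA M f (Add A g g') = Add A (TA M f g) (TA M f g')"

definition fun_cat ::
  "('o, 'm, 'y) cat_scheme \<Rightarrow> ('p, 'n, 'z) acat_scheme
     \<Rightarrow> (('o, 'm, 'p, 'n) fctr, (('o, 'm, 'p, 'n) fctr, 'o \<Rightarrow> 'n) tarr) acat" where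
  "fun_cat C A = \<lparr>Obj = {F. is_functor C A F},
     Arr = {(F, G, t). is_functor C A F \<and> is_functor C A G \<and> is_nat C A F G t},
     Dom = (\<lambda>a. src a), Cod = (\<lambda>a. tgt a),
     Id = (\<lambda>F. (F, F, \<lambda>X \<in> Obj C. Id A (FO F X))),
     Comp = (\<lambda>b a. (src a, tgt b, \<lambda>X \<in> Obj C. dat b X \<cdot>\<^bsub>A\<^esub> dat a X)),
     Zer = (\<lambda>F G. (F, G, \<lambda>X \<in> Obj C. Zer A (FO F X) (FO G X))),
     Add = (\<lambda>a b. (src a, tgt a, \<lambda>X \<in> Obj C. Add A (dat a X) (dat b X)))\<rparr>"


section \<open>Cochain complexes\<close>

record ('o, 'm) cochain =
  cob :: "int \<Rightarrow> 'o"
  cdf :: "int \<Rightarrow> 'm"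

definition is_complex :: "('o, 'm, 'z) acat_scheme \<Rightarrow> ('o, 'm) cochain \<Rightarrow> bool" where
  "is_complex A X \<longleftrightarrow> (\<forall>n. cob X n \<in> Obj A \<and> cdf X n \<in> Hom A (cob X n) (cob X (n + 1)) \<and>
     cdf X (n + 1) \<cdot>\<^bsub>A\<^esub> cdf X n = Zer A (cob X n) (cob X (n + 1 + 1)))"

definition vanishes_below :: "('o, 'm, 'z) acat_scheme \<Rightarrow> int \<Rightarrow> ('o, 'm) cochain \<Rightarrow> bool" where
  "vanishes_below A N X \<longleftrightarrow> (\<forall>n < N. is_zero_obj A (cob X n))"

definition is_chain_map ::
  "('o, 'm, 'z) acat_scheme \<Rightarrow> ('o, 'm) cochain \<Rightarrow> ('o, 'm) cochain \<Rightarrow> (int \<Rightarrow> 'm) \<Rightarrow> bool" where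
  "is_chain_map A X Y f \<longleftrightarrow> (\<forall>n. f n \<in> Hom A (cob X n) (cob Y n) \<and>
     cdf Y n \<cdot>\<^bsub>A\<^esub> f n = f (n + 1) \<cdot>\<^bsub>A\<^esub> cdf X n)"

definition ch_cat ::
  "('o, 'm, 'z) acat_scheme \<Rightarrow> (('o, 'm) cochain, (('o, 'm) cochain, int \<Rightarrow> 'm) tarr) cat" where
  "ch_cat A = (let bcx = {X. is_complex A X \<and> (\<exists>N. vanishes_below A N X)} in
     \<lparr>Obj = bcx,
      Arr = {(X, Y, f). X \<in> bcx \<and> Y \<in> bcx \<and> is_chain_map A X Y f},
      Dom = (\<lambda>a. src a), Cod = (\<lambda>a. tgt a),
      Id = (\<lambda>X. (X, X, \<lambda>n. Id A (cob X n))),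
      Comp = (\<lambda>b a. (src a, tgt b, \<lambda>n. dat b n \<cdot>\<^bsub>A\<^esub> dat a n))\<rparr>)"

definition conc :: "('o, 'm, 'z) acat_scheme \<Rightarrow> 'o \<Rightarrow> ('o, 'm) cochain" where
  "conc A Z = (let ob = (\<lambda>n. if n = 0 then Z else zero_obj A)
     in \<lparr>cob = ob, cdf = (\<lambda>n. Zer A (ob n) (ob (n + 1)))\<rparr>)"

definition shift :: "('o, 'm, 'z) acat_scheme \<Rightarrow> ('o, 'm) cochain \<Rightarrow> ('o, 'm) cochain" where
  "shift A X = \<lparr>cob = (\<lambda>n. cob X (n + 1)), cdf = (\<lambda>n. neg A (cdf X (n + 1)))\<rparr>"

text \<open>The mapping cone of \<open>f : X \<rightarrow> Y\<close> is \<open>X\<^sup>n\<^sup>+\<^sup>1 \<oplus> Y\<^sup>n\<close> in degree \<open>n\<close>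
  (index \<open>True\<close> is the first summand), with differential \<open>(x, y) \<mapsto> (-d x, f x + d y)\<close>.\<close>

definition cone :: "('o, 'm, 'z) acat_scheme \<Rightarrow> (('o, 'm) cochain, int \<Rightarrow> 'm) tarr \<Rightarrow> ('o, 'm) cochain" where
  "cone A f = (let S = (\<lambda>n. dsum A (\<lambda>b. if b then cob (src f) (n + 1) else cob (tgt f) n)) in
     \<lparr>cob = (\<lambda>n. bob (S n)),
      cdf = (\<lambda>n.
        Add A (bin (S (n + 1)) True \<cdot>\<^bsub>A\<^esub> neg A (cdf (src f) (n + 1)) \<cdot>\<^bsub>A\<^esub> bpr (S n) True)
          (Add A (bin (S (n + 1)) False \<cdot>\<^bsub>A\<^esub> dat f (n + 1) \<cdot>\<^bsub>A\<^esub> bpr (S n) True)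
             (bin (S (n + 1)) False \<cdot>\<^bsub>A\<^esub> cdf (tgt f) n \<cdot>\<^bsub>A\<^esub> bpr (S n) False)))\<rparr>)"

definition homotopic ::
  "('o, 'm, 'z) acat_scheme \<Rightarrow> (('o, 'm) cochain, int \<Rightarrow> 'm) tarr
     \<Rightarrow> (('o, 'm) cochain, int \<Rightarrow> 'm) tarr \<Rightarrow> bool" where
  "homotopic A f g \<longleftrightarrow> src f = src g \<and> tgt f = tgt g \<and>
     (\<exists>h. \<forall>n. h n \<in> Hom A (cob (src f) n) (cob (tgt f) (n - 1)) \<and>
        dat f n = Add A (dat g n)
          (Add A (cdf (tgt f) (n - 1) \<cdot>\<^bsub>A\<^esub> h n) (h (n + 1) \<cdot>\<^bsub>A\<^esub> cdf (src f) n)))"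

definition is_homotopy_equiv ::
  "('o, 'm, 'z) acat_scheme \<Rightarrow> (('o, 'm) cochain, int \<Rightarrow> 'm) tarr \<Rightarrow> bool" where
  "is_homotopy_equiv A f \<longleftrightarrow> f \<in> Arr (ch_cat A) \<and>
     (\<exists>g \<in> Hom (ch_cat A) (tgt f) (src f).
        homotopic A (g \<cdot>\<^bsub>ch_cat A\<^esub> f) (Id (ch_cat A) (src f)) \<and>
        homotopic A (f \<cdot>\<^bsub>ch_cat A\<^esub> g) (Id (ch_cat A) (tgt f)))"

text \<open>Cohomology in degree \<open>n\<close>: a pair \<open>(z, q)\<close> where \<open>z\<close> is a kernel of \<open>d\<^sup>n\<close> (the cocycles)
  and \<open>q\<close> is a cokernel of the morphism from \<open>X\<^sup>n\<^sup>-\<^sup>1\<close> to the cocycles induced by \<open>d\<^sup>n\<^sup>-\<^sup>1\<close>;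
  the cohomology object is the target of \<open>q\<close>.\<close>

definition is_cohomology ::
  "('o, 'm, 'z) acat_scheme \<Rightarrow> ('o, 'm) cochain \<Rightarrow> int \<Rightarrow> 'm \<times> 'm \<Rightarrow> bool" where
  "is_cohomology A X n zq \<longleftrightarrow> is_kernel A (cdf X n) (fst zq) \<and>
     (\<exists>b \<in> Hom A (cob X (n - 1)) (Dom A (fst zq)).
        fst zq \<cdot>\<^bsub>A\<^esub> b = cdf X (n - 1) \<and> is_cokernel A b (snd zq))"

definition cohomology :: "('o, 'm, 'z) acat_scheme \<Rightarrow> ('o, 'm) cochain \<Rightarrow> int \<Rightarrow> 'm \<times> 'm" where
  "cohomology A X n = (SOME zq. is_cohomology A X n zq)"

definition coh_obj :: "('o, 'm, 'z) acat_scheme \<Rightarrow> ('o, 'm) cochain \<Rightarrow> int \<Rightarrow> 'o" where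
  "coh_obj A X n = Cod A (snd (cohomology A X n))"

definition acyclic_complex :: "('o, 'm, 'z) acat_scheme \<Rightarrow> ('o, 'm) cochain \<Rightarrow> bool" where
  "acyclic_complex A X \<longleftrightarrow> (\<forall>n. is_zero_obj A (coh_obj A X n))"


subsection \<open>Double complexes and total complexes\<close>

text \<open>Double complexes have commuting differentials \<open>X\<^sup>p\<^sup>,\<^sup>q \<rightarrow> X\<^sup>p\<^sup>+\<^sup>1\<^sup>,\<^sup>q\<close> (horizontal) and
  \<open>X\<^sup>p\<^sup>,\<^sup>q \<rightarrow> X\<^sup>p\<^sup>,\<^sup>q\<^sup>+\<^sup>1\<close> (vertical); the total differential is \<open>dhor + (-1)\<^sup>p dver\<close>.\<close>

record ('o, 'm) dcx =
  dob :: "int \<Rightarrow> int \<Rightarrow> 'o"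
  dhor :: "int \<Rightarrow> int \<Rightarrow> 'm"
  dver :: "int \<Rightarrow> int \<Rightarrow> 'm"

definition row :: "('o, 'm) dcx \<Rightarrow> int \<Rightarrow> ('o, 'm) cochain" where
  "row X q = \<lparr>cob = (\<lambda>p. dob X p q), cdf = (\<lambda>p. dhor X p q)\<rparr>"

definition column :: "('o, 'm) dcx \<Rightarrow> int \<Rightarrow> ('o, 'm) cochain" where
  "column X p = \<lparr>cob = (\<lambda>q. dob X p q), cdf = (\<lambda>q. dver X p q)\<rparr>"

definition is_double_complex :: "('o, 'm, 'z) acat_scheme \<Rightarrow> ('o, 'm) dcx \<Rightarrow> bool" where
  "is_double_complex A X \<longleftrightarrow> (\<forall>q. is_complex A (row X q)) \<and> (\<forall>p. is_complex A (column X p)) \<and>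
     (\<forall>p q. dver X (p + 1) q \<cdot>\<^bsub>A\<^esub> dhor X p q = dhor X p (q + 1) \<cdot>\<^bsub>A\<^esub> dver X p q)"

definition dcx_bounded_below :: "('o, 'm, 'z) acat_scheme \<Rightarrow> ('o, 'm) dcx \<Rightarrow> bool" where
  "dcx_bounded_below A X \<longleftrightarrow> (\<exists>N. \<forall>p q. p < N \<or> q < N \<longrightarrow> is_zero_obj A (dob X p q))"

definition tsum :: "('o, 'm, 'z) acat_scheme \<Rightarrow> ('o, 'm) dcx \<Rightarrow> int \<Rightarrow> ('o, 'm, int) biprod" where
  "tsum A X n = dsum A (\<lambda>p. dob X p (n - p))"

definition tot :: "('o, 'm, 'z) acat_scheme \<Rightarrow> ('o, 'm) dcx \<Rightarrow> ('o, 'm) cochain" where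
  "tot A X = \<lparr>cob = (\<lambda>n. bob (tsum A X n)),
     cdf = (\<lambda>n. hsum A (bob (tsum A X n)) (bob (tsum A X (n + 1))) (\<lambda>p.
       Add A (bin (tsum A X (n + 1)) (p + 1) \<cdot>\<^bsub>A\<^esub> dhor X p (n - p) \<cdot>\<^bsub>A\<^esub> bpr (tsum A X n) p)
         (sgn_arr A p (bin (tsum A X (n + 1)) p \<cdot>\<^bsub>A\<^esub> dver X p (n - p) \<cdot>\<^bsub>A\<^esub> bpr (tsum A X n) p))))\<rparr>"

definition tot_map ::
  "('o, 'm, 'z) acat_scheme \<Rightarrow> ('o, 'm) dcx \<Rightarrow> ('o, 'm) dcx \<Rightarrow> (int \<Rightarrow> int \<Rightarrow> 'm)
     \<Rightarrow> (('o, 'm) cochain, int \<Rightarrow> 'm) tarr" where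
  "tot_map A X Y f = (tot A X, tot A Y, \<lambda>n. hsum A (bob (tsum A X n)) (bob (tsum A Y n)) (\<lambda>p.
     bin (tsum A Y n) p \<cdot>\<^bsub>A\<^esub> f p (n - p) \<cdot>\<^bsub>A\<^esub> bpr (tsum A X n) p))"


subsection \<open>The tensor product of complexes\<close>

definition tens_dcx ::
  "('o, 'm, 'z) acat_scheme \<Rightarrow> ('o, 'm) tensor \<Rightarrow> ('o, 'm) cochain \<Rightarrow> ('o, 'm) cochain
     \<Rightarrow> ('o, 'm) dcx" where
  "tens_dcx A M X Y = \<lparr>dob = (\<lambda>p q. TO M (cob X p) (cob Y q)),
     dhor = (\<lambda>p q. TA M (cdf X p) (Id A (cob Y q))),
     dver = (\<lambda>p q. TA M (Id A (cob X p)) (cdf Y q))\<rparr>"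

definition tens ::
  "('o, 'm, 'z) acat_scheme \<Rightarrow> ('o, 'm) tensor \<Rightarrow> ('o, 'm) cochain \<Rightarrow> ('o, 'm) cochain
     \<Rightarrow> ('o, 'm) cochain" where
  "tens A M X Y = tot A (tens_dcx A M X Y)"

text \<open>\<open>tens_in A M X Y n p\<close> and \<open>tens_pr A M X Y n p\<close> are the inclusion and the projection
  of the summand \<open>X\<^sup>p \<otimes> Y\<^sup>n\<^sup>-\<^sup>p\<close> of \<open>(X \<otimes> Y)\<^sup>n\<close>.\<close>

definition tens_in where "tens_in A M X Y n = bin (tsum A (tens_dcx A M X Y) n)"
definition tens_pr where "tens_pr A M X Y n = bpr (tsum A (tens_dcx A M X Y) n)"

definition ch_assoc ::
  "('o, 'm, 'z) acat_scheme \<Rightarrow> ('o, 'm) tensor \<Rightarrow> ('o, 'm) cochain \<Rightarrow> ('o, 'm) cochain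
     \<Rightarrow> ('o, 'm) cochain \<Rightarrow> (('o, 'm) cochain, int \<Rightarrow> 'm) tarr" where
  "ch_assoc A M X Y Z = (let S = tens A M (tens A M X Y) Z; T = tens A M X (tens A M Y Z) in
     (S, T, \<lambda>n. hsum A (cob S n) (cob T n) (\<lambda>(p, q).
        tens_in A M X (tens A M Y Z) n p
        \<cdot>\<^bsub>A\<^esub> TA M (Id A (cob X p)) (tens_in A M Y Z (n - p) q)
        \<cdot>\<^bsub>A\<^esub> Asc M (cob X p) (cob Y q) (cob Z (n - p - q))
        \<cdot>\<^bsub>A\<^esub> TA M (tens_pr A M X Y (p + q) p) (Id A (cob Z (n - p - q)))
        \<cdot>\<^bsub>A\<^esub> tens_pr A M (tens A M X Y) Z n (p + q))))"

definition ch_tensor ::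
  "('o, 'm, 'z) acat_scheme \<Rightarrow> ('o, 'm) tensor
     \<Rightarrow> (('o, 'm) cochain, (('o, 'm) cochain, int \<Rightarrow> 'm) tarr) tensor" where
  "ch_tensor A M = (let U = conc A (TU M) in
     \<lparr>TO = tens A M,
      TA = (\<lambda>f g. tot_map A (tens_dcx A M (src f) (src g)) (tens_dcx A M (tgt f) (tgt g))
              (\<lambda>p q. TA M (dat f p) (dat g q))),
      TU = U,
      Asc = ch_assoc A M,
      LUn = (\<lambda>X. (tens A M U X, X, \<lambda>n. LUn M (cob X n) \<cdot>\<^bsub>A\<^esub> tens_pr A M U X n 0)),
      RUn = (\<lambda>X. (tens A M X U, X, \<lambda>n. RUn M (cob X n) \<cdot>\<^bsub>A\<^esub> tens_pr A M X U n n))\<rparr>)"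


section \<open>Contravariant monoidal functors with values in complexes\<close>

type_synonym ('o, 'm, 'p, 'n) chm =
  "('o, 'm, ('p, 'n) cochain, (('p, 'n) cochain, int \<Rightarrow> 'n) tarr) mfctr"

type_synonym ('o, 'm, 'p, 'n) chm_arr =
  "(('o, 'm, 'p, 'n) chm, 'o \<Rightarrow> (('p, 'n) cochain, int \<Rightarrow> 'n) tarr) tarr"

definition vanishes_below_on ::
  "('o, 'm, 'y) cat_scheme \<Rightarrow> ('p, 'n, 'z) acat_scheme \<Rightarrow> int \<Rightarrow> ('o, 'm, 'p, 'n) chm \<Rightarrow> bool" where
  "vanishes_below_on C A N K \<longleftrightarrow> (\<forall>X \<in> Obj C. vanishes_below A N (FO K X))"

definition mon_ch ::
  "('o, 'm, 'y) cat_scheme \<Rightarrow> ('o, 'm) tensor \<Rightarrow> ('p, 'n, 'z) acat_scheme \<Rightarrow> ('p, 'n) tensor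
     \<Rightarrow> (('o, 'm, 'p, 'n) chm, ('o, 'm, 'p, 'n) chm_arr) cat" where
  "mon_ch C MC A MA =
     full_sub (mon_cat (op_cat C) (op_tensor C MC) (ch_cat A) (ch_tensor A MA))
       {K. \<exists>N. vanishes_below_on C A N K}"

text \<open>The complex in \<open>Fun(C\<^sup>o, A)\<close> underlying a functor with values in complexes in \<open>A\<close>.\<close>

definition und_cpx ::
  "('o, 'm, 'y) cat_scheme \<Rightarrow> ('o, 'm, 'p, 'n) chm
     \<Rightarrow> (('o, 'm, 'p, 'n) fctr, (('o, 'm, 'p, 'n) fctr, 'o \<Rightarrow> 'n) tarr) cochain" where
  "und_cpx C K = (let F = (\<lambda>n. \<lparr>FO = (\<lambda>X \<in> Obj C. cob (FO K X) n), FM = (\<lambda>f \<in> Arr C. dat (FM K f) n)\<rparr>)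
     in \<lparr>cob = F, cdf = (\<lambda>n. (F n, F (n + 1), \<lambda>X \<in> Obj C. cdf (FO K X) n))\<rparr>)"

definition und_map ::
  "('o, 'm, 'y) cat_scheme \<Rightarrow> ('o, 'm, 'p, 'n) chm_arr
     \<Rightarrow> ((('o, 'm, 'p, 'n) fctr, (('o, 'm, 'p, 'n) fctr, 'o \<Rightarrow> 'n) tarr) cochain,
          int \<Rightarrow> (('o, 'm, 'p, 'n) fctr, 'o \<Rightarrow> 'n) tarr) tarr" where
  "und_map C a = (und_cpx C (src a), und_cpx C (tgt a),
     \<lambda>n. (cob (und_cpx C (src a)) n, cob (und_cpx C (tgt a)) n, \<lambda>X \<in> Obj C. dat (dat a X) n))"


subsection \<open>Weak equivalences\<close>

definition is_acyclic_class :: "('o, 'm, 'z) acat_scheme \<Rightarrow> ('o, 'm) cochain set \<Rightarrow> bool" where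
  "is_acyclic_class B \<Gamma> \<longleftrightarrow>
     \<Gamma> \<subseteq> Obj (ch_cat B) \<and>
     (\<forall>X \<in> Obj (ch_cat B). (\<forall>n. is_zero_obj B (cob X n)) \<longrightarrow> X \<in> \<Gamma>) \<and>
     (\<forall>X \<in> Obj (ch_cat B). X \<in> \<Gamma> \<longleftrightarrow> shift B X \<in> \<Gamma>) \<and>
     (\<forall>f. is_homotopy_equiv B f \<longrightarrow> (src f \<in> \<Gamma> \<longleftrightarrow> tgt f \<in> \<Gamma>)) \<and>
     (\<forall>X \<in> \<Gamma>. acyclic_complex B X) \<and>
     (\<forall>X. is_double_complex B X \<and> dcx_bounded_below B X \<and> (\<forall>q. row X q \<in> \<Gamma>) \<longrightarrow> tot B X \<in> \<Gamma>)"

definition weak_equivalences where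
  "weak_equivalences C MC A MA \<Gamma> =
     {a \<in> Arr (mon_ch C MC A MA). cone (fun_cat (op_cat C) A) (und_map C a) \<in> \<Gamma>}"

definition homotopy_equivalences where
  "homotopy_equivalences C MC A MA =
     {a \<in> Arr (mon_ch C MC A MA). is_homotopy_equiv (fun_cat (op_cat C) A) (und_map C a)}"

definition weakly_equivalent :: "('o, 'm, 'z) cat_scheme \<Rightarrow> 'm set \<Rightarrow> 'o \<Rightarrow> 'o \<Rightarrow> bool" where
  "weakly_equivalent D W X Y \<longleftrightarrow> X \<in> Obj D \<and> Y \<in> Obj D \<and>
     equivclp (\<lambda>U V. \<exists>s \<in> W. s \<in> Hom D U V) X Y"


subsection \<open>Localization\<close>

text \<open>The category of fractions of Gabriel and Zisman: arrows are equivalence classes of words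
  in the arrows of \<open>D\<close> (\<open>Fw f\<close>) and formal inverses of the arrows in \<open>W\<close> (\<open>Bw s\<close>),
  written in the order in which the path is traversed.\<close>

datatype 'm zz = Fw 'm | Bw 'm

primrec is_word :: "('o, 'm, 'z) cat_scheme \<Rightarrow> 'm set \<Rightarrow> 'o \<Rightarrow> 'm zz list \<Rightarrow> 'o \<Rightarrow> bool" where
  "is_word D W X [] Y \<longleftrightarrow> X \<in> Obj D \<and> X = Y"
| "is_word D W X (a # w) Y \<longleftrightarrow> (case a of
     Fw f \<Rightarrow> f \<in> Arr D \<and> Dom D f = X \<and> is_word D W (Cod D f) w Y
   | Bw s \<Rightarrow> s \<in> W \<and> s \<in> Arr D \<and> Cod D s = X \<and> is_word D W (Dom D s) w Y)"

inductive word_step :: "('o, 'm, 'z) cat_scheme \<Rightarrow> 'm set \<Rightarrow> 'm zz list \<Rightarrow> 'm zz list \<Rightarrow> bool"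
  for D W where
  ws_id: "X \<in> Obj D \<Longrightarrow> word_step D W (u @ [Fw (Id D X)] @ v) (u @ v)"
| ws_comp: "\<lbrakk>f \<in> Arr D; g \<in> Arr D; Cod D f = Dom D g\<rbrakk>
    \<Longrightarrow> word_step D W (u @ [Fw f, Fw g] @ v) (u @ [Fw (g \<cdot>\<^bsub>D\<^esub> f)] @ v)"
| ws_inv1: "s \<in> W \<Longrightarrow> word_step D W (u @ [Fw s, Bw s] @ v) (u @ v)"
| ws_inv2: "s \<in> W \<Longrightarrow> word_step D W (u @ [Bw s, Fw s] @ v) (u @ v)"

definition word_class :: "('o, 'm, 'z) cat_scheme \<Rightarrow> 'm set \<Rightarrow> 'o \<Rightarrow> 'o \<Rightarrow> 'm zz list \<Rightarrow> 'm zz list set" where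
  "word_class D W X Y w =
     {w'. equivclp (\<lambda>u v. is_word D W X u Y \<and> is_word D W X v Y \<and> word_step D W u v) w w'}"

definition localization ::
  "('o, 'm, 'z) cat_scheme \<Rightarrow> 'm set \<Rightarrow> ('o, ('o, 'm zz list set) tarr) cat" where
  "localization D W = \<lparr>Obj = Obj D,
     Arr = {(X, Y, word_class D W X Y w) | X Y w. is_word D W X w Y},
     Dom = (\<lambda>a. src a), Cod = (\<lambda>a. tgt a),
     Id = (\<lambda>X. (X, X, word_class D W X X [])),
     Comp = (\<lambda>b a. (src a, tgt b,
       \<Union>u \<in> dat a. \<Union>v \<in> dat b. word_class D W (src a) (tgt b) (u @ v)))\<rparr>"

definition loc_arr :: "('o, 'm, 'z) cat_scheme \<Rightarrow> 'm set \<Rightarrow> 'm \<Rightarrow> ('o, 'm zz list set) tarr" where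
  "loc_arr D W f = (Dom D f, Cod D f, word_class D W (Dom D f) (Cod D f) [Fw f])"


subsection \<open>The Alexander--Whitney simple functor\<close>

record ('x, 'y) cosimp =
  cso :: "nat \<Rightarrow> 'x"
  cface :: "nat \<Rightarrow> nat \<Rightarrow> 'y"
  cdeg :: "nat \<Rightarrow> nat \<Rightarrow> 'y"

text \<open>\<open>cface K n i\<close> is \<open>\<partial>\<^sup>i : K\<^sup>n \<rightarrow> K\<^sup>n\<^sup>+\<^sup>1\<close> for \<open>i \<le> n + 1\<close>,
  and \<open>cdeg K n i\<close> is \<open>\<sigma>\<^sup>i : K\<^sup>n\<^sup>+\<^sup>1 \<rightarrow> K\<^sup>n\<close> for \<open>i \<le> n\<close>.\<close>

definition is_cosimplicial :: "('x, 'y, 'z) cat_scheme \<Rightarrow> ('x, 'y) cosimp \<Rightarrow> bool" where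
  "is_cosimplicial D K \<longleftrightarrow>
     (\<forall>n. cso K n \<in> Obj D) \<and>
     (\<forall>n i. i \<le> n + 1 \<longrightarrow> cface K n i \<in> Hom D (cso K n) (cso K (n + 1))) \<and>
     (\<forall>n i. i \<le> n \<longrightarrow> cdeg K n i \<in> Hom D (cso K (n + 1)) (cso K n)) \<and>
     (\<forall>n i j. i < j \<and> j \<le> n + 2 \<longrightarrow>
        cface K (n + 1) j \<cdot>\<^bsub>D\<^esub> cface K n i = cface K (n + 1) i \<cdot>\<^bsub>D\<^esub> cface K n (j - 1)) \<and>
     (\<forall>n i j. i \<le> j \<and> j \<le> n \<longrightarrow>
        cdeg K n j \<cdot>\<^bsub>D\<^esub> cdeg K (n + 1) i = cdeg K n i \<cdot>\<^bsub>D\<^esub> cdeg K (n + 1) (j + 1)) \<and>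
     (\<forall>n i j. i < j \<and> j \<le> n + 1 \<longrightarrow>
        cdeg K (n + 1) j \<cdot>\<^bsub>D\<^esub> cface K (n + 1) i = cface K n i \<cdot>\<^bsub>D\<^esub> cdeg K n (j - 1)) \<and>
     (\<forall>n i. i \<le> n \<longrightarrow>
        cdeg K n i \<cdot>\<^bsub>D\<^esub> cface K n i = Id D (cso K n) \<and>
        cdeg K n i \<cdot>\<^bsub>D\<^esub> cface K n (i + 1) = Id D (cso K n)) \<and>
     (\<forall>n i j. j + 1 < i \<and> i \<le> n + 2 \<longrightarrow>
        cdeg K (n + 1) j \<cdot>\<^bsub>D\<^esub> cface K (n + 1) i = cface K n (i - 1) \<cdot>\<^bsub>D\<^esub> cdeg K n j)"

definition is_cosimp_map ::
  "('x, 'y, 'z) cat_scheme \<Rightarrow> ('x, 'y) cosimp \<Rightarrow> ('x, 'y) cosimp \<Rightarrow> (nat \<Rightarrow> 'y) \<Rightarrow> bool" where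
  "is_cosimp_map D K L f \<longleftrightarrow> is_cosimplicial D K \<and> is_cosimplicial D L \<and>
     (\<forall>n. f n \<in> Hom D (cso K n) (cso L n)) \<and>
     (\<forall>n i. i \<le> n + 1 \<longrightarrow> f (n + 1) \<cdot>\<^bsub>D\<^esub> cface K n i = cface L n i \<cdot>\<^bsub>D\<^esub> f n) \<and>
     (\<forall>n i. i \<le> n \<longrightarrow> f n \<cdot>\<^bsub>D\<^esub> cdeg K n i = cdeg L n i \<cdot>\<^bsub>D\<^esub> f (n + 1))"

text \<open>\<open>last_cofaces D K p q\<close> is \<open>\<partial>\<^sup>p\<^sup>+\<^sup>q \<cdots> \<partial>\<^sup>p\<^sup>+\<^sup>1 : K\<^sup>p \<rightarrow> K\<^sup>p\<^sup>+\<^sup>q\<close>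
  and \<open>zeroth_cofaces D K q p\<close> is \<open>(\<partial>\<^sup>0)\<^sup>p : K\<^sup>q \<rightarrow> K\<^sup>q\<^sup>+\<^sup>p\<close>.\<close>

primrec last_cofaces :: "('x, 'y, 'z) cat_scheme \<Rightarrow> ('x, 'y) cosimp \<Rightarrow> nat \<Rightarrow> nat \<Rightarrow> 'y" where
  "last_cofaces D K p 0 = Id D (cso K p)"
| "last_cofaces D K p (Suc q) = cface K (p + q) (p + q + 1) \<cdot>\<^bsub>D\<^esub> last_cofaces D K p q"

primrec zeroth_cofaces :: "('x, 'y, 'z) cat_scheme \<Rightarrow> ('x, 'y) cosimp \<Rightarrow> nat \<Rightarrow> nat \<Rightarrow> 'y" where
  "zeroth_cofaces D K q 0 = Id D (cso K q)"
| "zeroth_cofaces D K q (Suc p) = cface K (q + p) 0 \<cdot>\<^bsub>D\<^esub> zeroth_cofaces D K q p"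

text \<open>The total complex of a cosimplicial object exists only if its terms are bounded below
  by a common degree, so the cosimplicial objects considered are uniformly bounded below.\<close>

definition cosimp_bounded_below ::
  "('o, 'm, 'y) cat_scheme \<Rightarrow> ('p, 'n, 'z) acat_scheme
     \<Rightarrow> (('o, 'm, 'p, 'n) chm, ('o, 'm, 'p, 'n) chm_arr) cosimp \<Rightarrow> bool" where
  "cosimp_bounded_below C A K \<longleftrightarrow> (\<exists>N. \<forall>p. vanishes_below_on C A N (cso K p))"

text \<open>The double complex \<open>K\<^sup>p(X)\<^sup>q\<close>, with zero objects for \<open>p < 0\<close>.\<close>

definition saw_dcx ::
  "('p, 'n, 'z) acat_scheme \<Rightarrow> (('o, 'm, 'p, 'n) chm, ('o, 'm, 'p, 'n) chm_arr) cosimp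
     \<Rightarrow> 'o \<Rightarrow> ('p, 'n) dcx" where
  "saw_dcx A K X = (let ob = (\<lambda>p q. if p < 0 then zero_obj A else cob (FO (cso K (nat p)) X) q) in
     \<lparr>dob = ob,
      dhor = (\<lambda>p q. if p < 0 then Zer A (ob p q) (ob (p + 1) q)
        else finprod (hom_group A (ob p q) (ob (p + 1) q))
          (\<lambda>i. sgn_arr A (int i) (dat (dat (cface K (nat p) i) X) q)) {..nat p + 1}),
      dver = (\<lambda>p q. if p < 0 then Zer A (ob p q) (ob p (q + 1))
        else cdf (FO (cso K (nat p)) X) q)\<rparr>)"

text \<open>The inclusion and the projection of the summand \<open>K\<^sup>p(X)\<^sup>n\<^sup>-\<^sup>p\<close> of the total complex in degree \<open>n\<close>.\<close>

definition saw_in where "saw_in A K X n p = bin (tsum A (saw_dcx A K X) n) (int p)"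
definition saw_pr where "saw_pr A K X n p = bpr (tsum A (saw_dcx A K X) n) (int p)"

text \<open>The Kuenneth morphism of the simple object: on the summand
  \<open>K\<^sup>p(X)\<^sup>m\<^sup>-\<^sup>p \<otimes> K\<^sup>r(Y)\<^sup>n\<^sup>-\<^sup>m\<^sup>-\<^sup>r\<close> it is \<open>(-1)\<^bsup>(m-p)r\<^esup>\<close> times
  the Alexander--Whitney map \<open>\<partial>\<^sup>p\<^sup>+\<^sup>r\<cdots>\<partial>\<^sup>p\<^sup>+\<^sup>1 \<otimes> (\<partial>\<^sup>0)\<^sup>p\<close>
  followed by the Kuenneth morphism of \<open>K\<^sup>p\<^sup>+\<^sup>r\<close>.\<close>

definition saw_kunneth ::
  "('o, 'm, 'y) cat_scheme \<Rightarrow> ('o, 'm) tensor \<Rightarrow> ('p, 'n, 'z) acat_scheme \<Rightarrow> ('p, 'n) tensor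
     \<Rightarrow> (('o, 'm, 'p, 'n) chm, ('o, 'm, 'p, 'n) chm_arr) cosimp
     \<Rightarrow> 'o \<Rightarrow> 'o \<Rightarrow> (('p, 'n) cochain, int \<Rightarrow> 'n) tarr" where
  "saw_kunneth C MC A MA K X Y = (let
     D = mon_ch C MC A MA;
     sX = tot A (saw_dcx A K X);
     sY = tot A (saw_dcx A K Y);
     sXY = tot A (saw_dcx A K (TO MC X Y)) in
     (tens A MA sX sY, sXY,
      \<lambda>n. hsum A (cob (tens A MA sX sY) n) (cob sXY n) (\<lambda>(m, p, r).
        sgn_arr A ((m - int p) * int r)
         (saw_in A K (TO MC X Y) n (p + r)
          \<cdot>\<^bsub>A\<^esub> dat (FK (cso K (p + r)) X Y) (n - int p - int r)
          \<cdot>\<^bsub>A\<^esub> tens_in A MA (FO (cso K (p + r)) X) (FO (cso K (p + r)) Y) (n - int p - int r) (m - int p)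
          \<cdot>\<^bsub>A\<^esub> TA MA (dat (dat (last_cofaces D K p r) X) (m - int p))
                     (dat (dat (zeroth_cofaces D K r p) Y) (n - m - int r))
          \<cdot>\<^bsub>A\<^esub> TA MA (saw_pr A K X m p) (saw_pr A K Y (n - m) r)
          \<cdot>\<^bsub>A\<^esub> tens_pr A MA sX sY n m))))"

text \<open>The morphism to the total complex induced by a coaugmentation \<open>a : Z \<rightarrow> K\<^sup>0(X)\<close>.\<close>

definition saw_coaug ::
  "('p, 'n, 'z) acat_scheme \<Rightarrow> (('o, 'm, 'p, 'n) chm, ('o, 'm, 'p, 'n) chm_arr) cosimp \<Rightarrow> 'o
     \<Rightarrow> (('p, 'n) cochain, int \<Rightarrow> 'n) tarr \<Rightarrow> (('p, 'n) cochain, int \<Rightarrow> 'n) tarr" where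
  "saw_coaug A K X a = (src a, tot A (saw_dcx A K X), \<lambda>n. saw_in A K X n 0 \<cdot>\<^bsub>A\<^esub> dat a n)"

definition saw_obj ::
  "('o, 'm, 'y) cat_scheme \<Rightarrow> ('o, 'm) tensor \<Rightarrow> ('p, 'n, 'z) acat_scheme \<Rightarrow> ('p, 'n) tensor
     \<Rightarrow> (('o, 'm, 'p, 'n) chm, ('o, 'm, 'p, 'n) chm_arr) cosimp \<Rightarrow> ('o, 'm, 'p, 'n) chm" where
  "saw_obj C MC A MA K = \<lparr>
     FO = (\<lambda>X \<in> Obj C. tot A (saw_dcx A K X)),
     FM = (\<lambda>f \<in> Arr C. tot_map A (saw_dcx A K (Cod C f)) (saw_dcx A K (Dom C f))
             (\<lambda>p q. if p < 0 then Zer A (zero_obj A) (zero_obj A)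
                    else dat (FM (cso K (nat p)) f) q)),
     FK = (\<lambda>X \<in> Obj C. \<lambda>Y \<in> Obj C. saw_kunneth C MC A MA K X Y),
     FU = saw_coaug A K (TU MC) (FU (cso K 0))\<rparr>"

definition saw_map ::
  "('o, 'm, 'y) cat_scheme \<Rightarrow> ('o, 'm) tensor \<Rightarrow> ('p, 'n, 'z) acat_scheme \<Rightarrow> ('p, 'n) tensor
     \<Rightarrow> (('o, 'm, 'p, 'n) chm, ('o, 'm, 'p, 'n) chm_arr) cosimp
     \<Rightarrow> (('o, 'm, 'p, 'n) chm, ('o, 'm, 'p, 'n) chm_arr) cosimp
     \<Rightarrow> (nat \<Rightarrow> ('o, 'm, 'p, 'n) chm_arr) \<Rightarrow> ('o, 'm, 'p, 'n) chm_arr" where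
  "saw_map C MC A MA K L f = (saw_obj C MC A MA K, saw_obj C MC A MA L,
     \<lambda>X \<in> Obj C. tot_map A (saw_dcx A K X) (saw_dcx A L X)
       (\<lambda>p q. if p < 0 then Zer A (zero_obj A) (zero_obj A) else dat (dat (f (nat p)) X) q))"

definition saw_compatible where
  "saw_compatible C MC A MA W \<longleftrightarrow>
     (\<forall>K L f. is_cosimp_map (mon_ch C MC A MA) K L f \<and>
        cosimp_bounded_below C A K \<and> cosimp_bounded_below C A L \<and> (\<forall>n. f n \<in> W)
        \<longrightarrow> saw_map C MC A MA K L f \<in> W)"


subsection \<open>Cotriples and the standard construction\<close>

text \<open>\<open>G\<close> acts on contravariant monoidal functors by \<open>K \<mapsto> K \<circ> G\<close>. The Kuenneth
  morphism \<open>K (G X) \<otimes> K (G Y) \<rightarrow> K (G X \<otimes> G Y) \<rightarrow> K (G (X \<otimes> Y))\<close> of \<open>K \<circ> G\<close> needs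
  structure morphisms \<open>G (X \<otimes> Y) \<rightarrow> G X \<otimes> G Y\<close> and \<open>G 1 \<rightarrow> 1\<close> in \<open>C\<close>, that is, a
  monoidal structure on \<open>G\<close> as an endofunctor of the dual monoidal category \<open>C\<^sup>o\<close>.
  A counit \<open>G X \<rightarrow> X\<close> in \<open>C\<close> is an arrow \<open>X \<rightarrow> G X\<close> of \<open>C\<^sup>o\<close>, and similarly for \<open>\<delta>\<close>.\<close>

definition monoidal_cotriple ::
  "('o, 'm, 'z) cat_scheme \<Rightarrow> ('o, 'm) tensor \<Rightarrow> ('o, 'm, 'o, 'm) mfctr
     \<Rightarrow> ('o \<Rightarrow> 'm) \<Rightarrow> ('o \<Rightarrow> 'm) \<Rightarrow> bool" where
  "monoidal_cotriple C M G \<epsilon> \<delta> \<longleftrightarrow> (let Co = op_cat C; Mo = op_tensor C M in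
     is_mfunctor Co Mo Co Mo G \<and>
     is_mnat Co Mo Co Mo (id_mf Co Mo) G \<epsilon> \<and>
     is_mnat Co Mo Co Mo (comp_mf Co Co G G) G \<delta> \<and>
     (\<forall>X \<in> Obj C. \<epsilon> (FO G X) \<cdot>\<^bsub>C\<^esub> \<delta> X = Id C (FO G X) \<and>
        FM G (\<epsilon> X) \<cdot>\<^bsub>C\<^esub> \<delta> X = Id C (FO G X) \<and>
        \<delta> (FO G X) \<cdot>\<^bsub>C\<^esub> \<delta> X = FM G (\<delta> X) \<cdot>\<^bsub>C\<^esub> \<delta> X))"

definition T_obj ::
  "('o, 'm, 'y) cat_scheme \<Rightarrow> ('p, 'n, 'z) acat_scheme \<Rightarrow> ('o, 'm, 'o, 'm) mfctr
     \<Rightarrow> ('o, 'm, 'p, 'n) chm \<Rightarrow> ('o, 'm, 'p, 'n) chm" where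
  "T_obj C A G K = comp_mf (op_cat C) (ch_cat A) K G"

definition T_map ::
  "('o, 'm, 'y) cat_scheme \<Rightarrow> ('p, 'n, 'z) acat_scheme \<Rightarrow> ('o, 'm, 'o, 'm) mfctr
     \<Rightarrow> ('o, 'm, 'p, 'n) chm_arr \<Rightarrow> ('o, 'm, 'p, 'n) chm_arr" where
  "T_map C A G a = (T_obj C A G (src a), T_obj C A G (tgt a), \<lambda>X \<in> Obj C. dat a (FO G X))"

definition T_unit ::
  "('o, 'm, 'y) cat_scheme \<Rightarrow> ('p, 'n, 'z) acat_scheme \<Rightarrow> ('o, 'm, 'o, 'm) mfctr \<Rightarrow> ('o \<Rightarrow> 'm)
     \<Rightarrow> ('o, 'm, 'p, 'n) chm \<Rightarrow> ('o, 'm, 'p, 'n) chm_arr" where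
  "T_unit C A G \<epsilon> K = (K, T_obj C A G K, \<lambda>X \<in> Obj C. FM K (\<epsilon> X))"

definition T_mult ::
  "('o, 'm, 'y) cat_scheme \<Rightarrow> ('p, 'n, 'z) acat_scheme \<Rightarrow> ('o, 'm, 'o, 'm) mfctr \<Rightarrow> ('o \<Rightarrow> 'm)
     \<Rightarrow> ('o, 'm, 'p, 'n) chm \<Rightarrow> ('o, 'm, 'p, 'n) chm_arr" where
  "T_mult C A G \<delta> K = (T_obj C A G (T_obj C A G K), T_obj C A G K, \<lambda>X \<in> Obj C. FM K (\<delta> X))"

text \<open>The standard construction: \<open>B\<^sup>n = T\<^sup>n\<^sup>+\<^sup>1\<close>, with cofaces \<open>T\<^sup>i \<eta> T\<^sup>n\<^sup>+\<^sup>1\<^sup>-\<^sup>i\<close> and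
  codegeneracies \<open>T\<^sup>i \<mu> T\<^sup>n\<^sup>-\<^sup>i\<close>.\<close>

definition std_constr ::
  "('o, 'm, 'y) cat_scheme \<Rightarrow> ('p, 'n, 'z) acat_scheme \<Rightarrow> ('o, 'm, 'o, 'm) mfctr
     \<Rightarrow> ('o \<Rightarrow> 'm) \<Rightarrow> ('o \<Rightarrow> 'm) \<Rightarrow> ('o, 'm, 'p, 'n) chm
     \<Rightarrow> (('o, 'm, 'p, 'n) chm, ('o, 'm, 'p, 'n) chm_arr) cosimp" where
  "std_constr C A G \<epsilon> \<delta> K = \<lparr>
     cso = (\<lambda>n. (T_obj C A G ^^ (n + 1)) K),
     cface = (\<lambda>n i. (T_map C A G ^^ i) (T_unit C A G \<epsilon> ((T_obj C A G ^^ (n + 1 - i)) K))),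
     cdeg = (\<lambda>n i. (T_map C A G ^^ i) (T_mult C A G \<delta> ((T_obj C A G ^^ (n - i)) K)))\<rparr>"

text \<open>The morphism \<open>K \<rightarrow> B\<^sup>*(K) = s\<^sub>A\<^sub>W(B\<^sup>\<bullet>(K))\<close> induced by \<open>\<eta> : K \<rightarrow> T K = B\<^sup>0(K)\<close>.\<close>

definition std_coaug where
  "std_coaug C MC A MA G \<epsilon> \<delta> K = (let B = std_constr C A G \<epsilon> \<delta> K in
     (K, saw_obj C MC A MA B, \<lambda>X \<in> Obj C. saw_coaug A B X (dat (T_unit C A G \<epsilon> K) X)))"

definition T_presentable where
  "T_presentable C MC A MA G \<epsilon> \<delta> W K \<longleftrightarrow> std_coaug C MC A MA G \<epsilon> \<delta> K \<in> W"


subsection \<open>The functor of zeroth cohomology\<close>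

text \<open>For a complex \<open>X\<close> in non-negative degrees, the cocycles in degree 0 map isomorphically to
  \<open>H\<^sup>0(X)\<close>, whence an inclusion of \<open>H\<^sup>0(X)\<close> into \<open>X\<^sup>0\<close>, compatible with the canonical maps from
  the cocycles. It defines a monomorphism \<open>h0_incl A X\<close> from the complex \<open>h0 A X\<close>,
  which is \<open>H\<^sup>0(X)\<close> in degree 0, to \<open>X\<close>.\<close>

definition h0 :: "('o, 'm, 'z) acat_scheme \<Rightarrow> ('o, 'm) cochain \<Rightarrow> ('o, 'm) cochain" where
  "h0 A X = conc A (coh_obj A X 0)"

definition h0_incl :: "('o, 'm, 'z) acat_scheme \<Rightarrow> ('o, 'm) cochain \<Rightarrow> (('o, 'm) cochain, int \<Rightarrow> 'm) tarr" where
  "h0_incl A X = (h0 A X, X, \<lambda>n.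
     if n = 0 then (THE j. j \<in> Hom A (coh_obj A X 0) (cob X 0) \<and>
        j \<cdot>\<^bsub>A\<^esub> snd (cohomology A X 0) = fst (cohomology A X 0))
     else Zer A (cob (h0 A X) n) (cob X n))"

text \<open>The induced arrows, Kuenneth morphisms and unit morphism on zeroth cohomology are the
  unique chain maps through which the corresponding chain maps of \<open>K\<close>, precomposed with the
  inclusions, factor.\<close>

definition H0 ::
  "('o, 'm, 'y) cat_scheme \<Rightarrow> ('o, 'm) tensor \<Rightarrow> ('p, 'n, 'z) acat_scheme \<Rightarrow> ('p, 'n) tensor
     \<Rightarrow> ('o, 'm, 'p, 'n) chm \<Rightarrow> ('o, 'm, 'p, 'n) chm" where
  "H0 C MC A MA K = (let Ch = ch_cat A; N = ch_tensor A MA;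
       h = (\<lambda>X. h0 A (FO K X)); i = (\<lambda>X. h0_incl A (FO K X)) in \<lparr>
     FO = (\<lambda>X \<in> Obj C. h X),
     FM = (\<lambda>f \<in> Arr C. THE g. g \<in> Hom Ch (h (Cod C f)) (h (Dom C f)) \<and>
             i (Dom C f) \<cdot>\<^bsub>Ch\<^esub> g = FM K f \<cdot>\<^bsub>Ch\<^esub> i (Cod C f)),
     FK = (\<lambda>X \<in> Obj C. \<lambda>Y \<in> Obj C. THE g. g \<in> Hom Ch (TO N (h X) (h Y)) (h (TO MC X Y)) \<and>
             i (TO MC X Y) \<cdot>\<^bsub>Ch\<^esub> g = FK K X Y \<cdot>\<^bsub>Ch\<^esub> TA N (i X) (i Y)),
     FU = (THE g. g \<in> Hom Ch (TU N) (h (TU MC)) \<and> i (TU MC) \<cdot>\<^bsub>Ch\<^esub> g = FU K)\<rparr>)"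

definition H0_incl ::
  "('o, 'm, 'y) cat_scheme \<Rightarrow> ('o, 'm) tensor \<Rightarrow> ('p, 'n, 'z) acat_scheme \<Rightarrow> ('p, 'n) tensor
     \<Rightarrow> ('o, 'm, 'p, 'n) chm \<Rightarrow> ('o, 'm, 'p, 'n) chm_arr" where
  "H0_incl C MC A MA K = (H0 C MC A MA K, K, \<lambda>X \<in> Obj C. h0_incl A (FO K X))"

definition T_acyclic where
  "T_acyclic C MC A MA G W K \<longleftrightarrow> T_map C A G (H0_incl C MC A MA K) \<in> W"

definition lifts where
  "lifts C MC A MA W \<phi> K L \<alpha> \<longleftrightarrow> (let D = mon_ch C MC A MA; E = localization D W in
     \<phi> \<cdot>\<^bsub>E\<^esub> loc_arr D W (H0_incl C MC A MA K) = loc_arr D W (H0_incl C MC A MA L) \<cdot>\<^bsub>E\<^esub> loc_arr D W \<alpha>)"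

end

theory Submission
  imports Defs
begin

text \<open>The standard construction \<open>B\<close> is an endofunctor with a natural transformation \<open>j : id \<rightarrow> B\<close>. It
  preserves weak equivalences, since \<open>T\<close> does and the simple functor is compatible with them; hence it
  acts on the localization, where \<open>j\<close> is still natural. Let \<open>i\<^sub>K : H\<^sup>0(K) \<rightarrow> K\<close> be the inclusion. If \<open>K\<close> is
  \<open>T\<close>-acyclic, then all \<open>T\<^sup>n\<^sup>+\<^sup>1 i\<^sub>K\<close> and therefore \<open>B i\<^sub>K\<close> are weak equivalences; if \<open>K\<close> is presentable, so
  is \<open>j\<^sub>K\<close>. Thus \<open>j\<^sub>L\<^sup>-\<^sup>1 B(i\<^sub>L) B(\<alpha>) B(i\<^sub>K)\<^sup>-\<^sup>1 j\<^sub>K\<close> is a lift of \<open>\<alpha>\<close>. Conversely \<open>\<phi> i\<^sub>K\<close> determines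
  \<open>B \<phi>\<close>, and \<open>B \<phi>\<close> determines \<open>\<phi> = j\<^sub>L\<^sup>-\<^sup>1 B(\<phi>) j\<^sub>K\<close>.\<close>

section \<open>Additive categories\<close>

text \<open>The obstacle is that objects of \<open>mon_ch\<close> carry all the coherence of lax
  monoidal functors with values in complexes, while tensor products of complexes, \<open>T K\<close>
  and the simple object are only raw formulas. Coherence is not computed but extracted from arrows,
  since the ends of an arrow are objects: the tensor product of two values of a functor is the
  source of a Kuenneth morphism, the functor \<open>H0\<close> is an end of \<alpha>, and
  \<open>T K\<close> and the simple object are ends of images of identities under maps that preserve
  \<open>W\<close>. What has to be computed is that transformations are natural and monoidal; the
  longest case is \<open>saw_map\<close>, where the Alexander-Whitney Kuenneth morphisms are
  compared summand by summand. The localization comes without a calculus of fractions, so its arrows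
  are handled as words: an endofunctor that preserves \<open>W\<close> acts letter by letter, and
  existence and uniqueness of lifts are rewritings of words.\<close>

lemma mem_Hom: "f \<in> Hom C X Y \<longleftrightarrow> f \<in> Arr C \<and> Dom C f = X \<and> Cod C f = Y"
  by (simp add: Hom_def)

context category
begin

text \<open>Typing is expressed by \<open>Arr\<close>, \<open>Dom\<close> and \<open>Cod\<close>
  rather than by \<open>Hom\<close>, because the simplifier can then discharge side conditions
  without guessing sources and targets.\<close>

lemma comp_arr [simp]:
  assumes "f \<in> Arr C" "g \<in> Arr C" "Dom C g = Cod C f"
  shows "g \<cdot>\<^bsub>C\<^esub> f \<in> Arr C" "Dom C (g \<cdot>\<^bsub>C\<^esub> f) = Dom C f" "Cod C (g \<cdot>\<^bsub>C\<^esub> f) = Cod C g"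
  using comp_hom[of f "Dom C f" "Cod C f" g "Cod C g"] assms by (auto simp: mem_Hom)

lemma id_arr [simp]:
  assumes "X \<in> Obj C"
  shows "Id C X \<in> Arr C" "Dom C (Id C X) = X" "Cod C (Id C X) = X"
  using id_hom[OF assms] by (auto simp: mem_Hom)

lemmas ends_obj [simp] = dom_obj cod_obj

lemma comp_id [simp]:
  "f \<in> Arr C \<Longrightarrow> X = Cod C f \<Longrightarrow> Id C X \<cdot>\<^bsub>C\<^esub> f = f"
  "f \<in> Arr C \<Longrightarrow> X = Dom C f \<Longrightarrow> f \<cdot>\<^bsub>C\<^esub> Id C X = f"
  by (auto intro: id_left id_right simp: mem_Hom)

lemma comp_assoc_arr [simp]:
  assumes "f \<in> Arr C" "g \<in> Arr C" "h \<in> Arr C" "Dom C g = Cod C f" "Dom C h = Cod C g"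
  shows "(h \<cdot>\<^bsub>C\<^esub> g) \<cdot>\<^bsub>C\<^esub> f = h \<cdot>\<^bsub>C\<^esub> (g \<cdot>\<^bsub>C\<^esub> f)"
  using comp_assoc[of f "Dom C f" "Cod C f" g "Cod C g" h "Cod C h"] assms by (simp add: mem_Hom)

text \<open>Composites are kept nested to the right by \<open>comp_assoc_arr\<close>, so an equation
  for \<open>g\<close> followed by \<open>h\<close> no longer matches once a further arrow
  \<open>f\<close> precedes \<open>g\<close>. This is the form that still applies.\<close>

lemma comp_reduce:
  assumes "h \<cdot>\<^bsub>C\<^esub> g = k" "f \<in> Arr C" "g \<in> Arr C" "h \<in> Arr C" "Dom C g = Cod C f" "Dom C h = Cod C g"
  shows "h \<cdot>\<^bsub>C\<^esub> (g \<cdot>\<^bsub>C\<^esub> f) = k \<cdot>\<^bsub>C\<^esub> f"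
  using assms by (simp flip: comp_assoc_arr)

end

text \<open>\<open>hsum\<close> is a \<open>finprod\<close> over the support, and
  \<open>finprod\<close> over an infinite set is the neutral element. Finiteness of the support
  therefore has to accompany a family before its sum can be moved through additive maps.\<close>

definition finsupp :: "('o, 'm, 'z) acat_scheme \<Rightarrow> 'o \<Rightarrow> 'o \<Rightarrow> ('i \<Rightarrow> 'm) \<Rightarrow> bool" where
  "finsupp A X Y f \<longleftrightarrow> (\<forall>i. f i \<in> Hom A X Y) \<and> finite {i. f i \<noteq> Zer A X Y}"

lemma carrier_hom_group [simp]: "carrier (hom_group A X Y) = Hom A X Y"
  and mult_hom_group [simp]: "mult (hom_group A X Y) = Add A"
  and one_hom_group [simp]: "one (hom_group A X Y) = Zer A X Y"
  by (simp_all add: hom_group_def)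

context abelian_category
begin

abbreviation compA (infixr "\<odot>" 70) where "g \<odot> f \<equiv> g \<cdot>\<^bsub>A\<^esub> f"

abbreviation hg where "hg \<equiv> hom_group A"

lemma hg_monoid: "\<lbrakk>X \<in> Obj A; Y \<in> Obj A\<rbrakk> \<Longrightarrow> comm_monoid (hg X Y)"
  using hom_comm_group comm_group.axioms(1) by blast

lemma hg_group: "\<lbrakk>X \<in> Obj A; Y \<in> Obj A\<rbrakk> \<Longrightarrow> group (hg X Y)"
  using hom_comm_group comm_group.axioms(2) by blast

lemma zer_arr [simp]:
  assumes "X \<in> Obj A" "Y \<in> Obj A"
  shows "Zer A X Y \<in> Arr A" "Dom A (Zer A X Y) = X" "Cod A (Zer A X Y) = Y"
  using monoid.one_closed[OF comm_monoid.axioms(1)[OF hg_monoid[OF assms]]] by (auto simp: mem_Hom)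

lemma add_arr [simp]:
  assumes "f \<in> Arr A" "g \<in> Arr A" "Dom A f = Dom A g" "Cod A f = Cod A g"
  shows "Add A f g \<in> Arr A" "Dom A (Add A f g) = Dom A g" "Cod A (Add A f g) = Cod A g"
  using monoid.m_closed[OF comm_monoid.axioms(1)[OF hg_monoid], of "Dom A g" "Cod A g" f g] assms
  by (auto simp: mem_Hom)

lemma add_zer [simp]:
  assumes "f \<in> Arr A" "Dom A f = X" "Cod A f = Y"
  shows "Add A f (Zer A X Y) = f" "Add A (Zer A X Y) f = f"
  using monoid.r_one[OF comm_monoid.axioms(1)[OF hg_monoid], of X Y f]
   monoid.l_one[OF comm_monoid.axioms(1)[OF hg_monoid], of X Y f] assms
  by (auto simp: mem_Hom)

lemma add_assoc:
  assumes "f \<in> Arr A" "g \<in> Arr A" "h \<in> Arr A" "Dom A f = Dom A g" "Cod A f = Cod A g"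
    "Dom A h = Dom A g" "Cod A h = Cod A g"
  shows "Add A (Add A f g) h = Add A f (Add A g h)"
  using monoid.m_assoc[OF comm_monoid.axioms(1)[OF hg_monoid], of "Dom A g" "Cod A g" f g h] assms
  by (auto simp: mem_Hom)

lemma add_comm:
  assumes "f \<in> Arr A" "g \<in> Arr A" "Dom A f = Dom A g" "Cod A f = Cod A g"
  shows "Add A f g = Add A g f"
  using comm_monoid.m_comm[OF hg_monoid, of "Dom A g" "Cod A g" f g] assms
  by (auto simp: mem_Hom)

lemma neg_arr [simp]:
  assumes "f \<in> Arr A"
  shows "neg A f \<in> Arr A" "Dom A (neg A f) = Dom A f" "Cod A (neg A f) = Cod A f"
  using group.inv_closed[OF hg_group, of "Dom A f" "Cod A f" f] assms
  by (auto simp: mem_Hom neg_def)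

lemma add_neg [simp]:
  assumes "f \<in> Arr A"
  shows "Add A f (neg A f) = Zer A (Dom A f) (Cod A f)"
  using group.r_inv[OF hg_group, of "Dom A f" "Cod A f" f] assms
  by (auto simp: mem_Hom neg_def)

lemma neg_unique:
  assumes "f \<in> Arr A" "g \<in> Arr A" "Dom A f = Dom A g" "Cod A f = Cod A g"
    "Add A f g = Zer A (Dom A g) (Cod A g)"
  shows "g = neg A f"
  using group.inv_equality[OF hg_group, of "Dom A f" "Cod A f" g f] assms add_comm[of f g]
  by (auto simp: mem_Hom neg_def)

text \<open>Cancellation in the group of arrows. It shows that additive maps preserve zero arrows,
  as 0 + 0 = 0.\<close>

lemma idem_zer:
  assumes "f \<in> Arr A" "Add A f f = f" "Dom A f = X" "Cod A f = Y"
  shows "f = Zer A X Y"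
proof -
  have "f = Add A f (Add A f (neg A f))" using assms(1,3,4) by simp
  also have "\<dots> = Add A (Add A f f) (neg A f)" using assms(1) by (subst add_assoc) simp_all
  also have "\<dots> = Zer A X Y" using assms by simp
  finally show ?thesis .
qed

lemma comp_add [simp]:
  assumes "f \<in> Arr A" "f' \<in> Arr A" "Dom A f = Dom A f'" "Cod A f = Cod A f'" "g \<in> Arr A"
  shows "Dom A g = Cod A f' \<Longrightarrow> g \<odot> Add A f f' = Add A (g \<odot> f) (g \<odot> f')"
    "Cod A g = Dom A f' \<Longrightarrow> Add A f f' \<odot> g = Add A (f \<odot> g) (f' \<odot> g)"
  using assms comp_add_right[of f "Dom A f'" "Cod A f'" f' g "Cod A g"]
    comp_add_left[of g "Dom A g" "Dom A f'" f "Cod A f'" f'] by (auto simp: mem_Hom)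

lemma comp_zer [simp]:
  assumes "f \<in> Arr A" "Z \<in> Obj A"
  shows "X = Cod A f \<Longrightarrow> Zer A X Z \<odot> f = Zer A (Dom A f) Z"
    "X = Dom A f \<Longrightarrow> f \<odot> Zer A Z X = Zer A Z (Cod A f)"
proof -
  assume X: "X = Cod A f"
  have "Add A (Zer A X Z \<odot> f) (Zer A X Z \<odot> f) = Add A (Zer A X Z) (Zer A X Z) \<odot> f"
    by (rule comp_add(2)[symmetric]) (use assms X in simp_all)
  then show "Zer A X Z \<odot> f = Zer A (Dom A f) Z"
    by (intro idem_zer) (use assms X in simp_all)
next
  assume X: "X = Dom A f"
  have "Add A (f \<odot> Zer A Z X) (f \<odot> Zer A Z X) = f \<odot> Add A (Zer A Z X) (Zer A Z X)"
    by (rule comp_add(1)[symmetric]) (use assms X in simp_all)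
  then show "f \<odot> Zer A Z X = Zer A Z (Cod A f)"
    by (intro idem_zer) (use assms X in simp_all)
qed

lemma comp_neg [simp]:
  assumes "f \<in> Arr A" "g \<in> Arr A" "Dom A g = Cod A f"
  shows "g \<odot> neg A f = neg A (g \<odot> f)" "neg A g \<odot> f = neg A (g \<odot> f)"
proof -
  have "Add A (g \<odot> f) (g \<odot> neg A f) = g \<odot> Add A f (neg A f)"
    by (rule comp_add(1)[symmetric]) (use assms in simp_all)
  then show "g \<odot> neg A f = neg A (g \<odot> f)"
    by (intro neg_unique) (use assms in simp_all)
  have "Add A (g \<odot> f) (neg A g \<odot> f) = Add A g (neg A g) \<odot> f"
    by (rule comp_add(2)[symmetric]) (use assms in simp_all)
  then show "neg A g \<odot> f = neg A (g \<odot> f)"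
    by (intro neg_unique) (use assms in simp_all)
qed

lemma sgn_arr [simp]:
  assumes "f \<in> Arr A"
  shows "sgn_arr A k f \<in> Arr A" "Dom A (sgn_arr A k f) = Dom A f" "Cod A (sgn_arr A k f) = Cod A f"
  using assms by (auto simp: sgn_arr_def)

lemma comp_sgn [simp]:
  assumes "f \<in> Arr A" "g \<in> Arr A" "Dom A g = Cod A f"
  shows "g \<odot> sgn_arr A k f = sgn_arr A k (g \<odot> f)" "sgn_arr A k g \<odot> f = sgn_arr A k (g \<odot> f)"
  using assms by (auto simp: sgn_arr_def)

section \<open>Sums of families of arrows\<close>

lemma hsum_arr:
  assumes "X \<in> Obj A" "Y \<in> Obj A" "\<And>i. f i \<in> Hom A X Y"
  shows "hsum A X Y f \<in> Arr A" "Dom A (hsum A X Y f) = X" "Cod A (hsum A X Y f) = Y"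
proof -
  interpret comm_monoid "hg X Y" using assms hg_monoid by simp
  have "hsum A X Y f \<in> Hom A X Y"
    unfolding hsum_def using finprod_closed[of f] assms(3) by auto
  then show "hsum A X Y f \<in> Arr A" "Dom A (hsum A X Y f) = X" "Cod A (hsum A X Y f) = Y"
    by (auto simp: mem_Hom)
qed

lemma finprod_hg_arr:
  assumes "X \<in> Obj A" "Y \<in> Obj A" "\<And>i. i \<in> S \<Longrightarrow> f i \<in> Hom A X Y"
  shows "finprod (hg X Y) f S \<in> Arr A" "Dom A (finprod (hg X Y) f S) = X" "Cod A (finprod (hg X Y) f S) = Y"
proof -
  interpret comm_monoid "hg X Y" using assms hg_monoid by simp
  have "finprod (hg X Y) f S \<in> Hom A X Y"
    using finprod_closed[of f S] assms(3) by auto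
  then show "finprod (hg X Y) f S \<in> Arr A" "Dom A (finprod (hg X Y) f S) = X" "Cod A (finprod (hg X Y) f S) = Y"
    by (auto simp: mem_Hom)
qed

text \<open>Here and in the next two lemmas \<open>h\<close> stands for any additive operation on
  arrows: composing or tensoring with a fixed arrow, on either side.\<close>

lemma additive_zer:
  assumes o: "X \<in> Obj A" "Y \<in> Obj A" "X' \<in> Obj A" "Y' \<in> Obj A"
    and h: "\<And>u. u \<in> Hom A X Y \<Longrightarrow> h u \<in> Hom A X' Y'"
    and add: "\<And>u v. \<lbrakk>u \<in> Hom A X Y; v \<in> Hom A X Y\<rbrakk> \<Longrightarrow> h (Add A u v) = Add A (h u) (h v)"
  shows "h (Zer A X Y) = Zer A X' Y'"
  using o h[of "Zer A X Y"] add[of "Zer A X Y" "Zer A X Y"]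
  by (intro idem_zer) (auto simp: mem_Hom)

lemma additive_finprod:
  assumes o: "X \<in> Obj A" "Y \<in> Obj A" "X' \<in> Obj A" "Y' \<in> Obj A"
    and h: "\<And>u. u \<in> Hom A X Y \<Longrightarrow> h u \<in> Hom A X' Y'"
    and add: "\<And>u v. \<lbrakk>u \<in> Hom A X Y; v \<in> Hom A X Y\<rbrakk> \<Longrightarrow> h (Add A u v) = Add A (h u) (h v)"
    and S: "finite S" and f: "\<And>i. i \<in> S \<Longrightarrow> f i \<in> Hom A X Y"
  shows "h (finprod (hg X Y) f S) = finprod (hg X' Y') (\<lambda>i. h (f i)) S"
proof -
  interpret P: comm_monoid "hg X Y" using o hg_monoid by simp
  interpret Q: comm_monoid "hg X' Y'" using o hg_monoid by simp
  note zz = additive_zer[OF o h add]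
  show ?thesis using S f
  proof (induction S)
    case empty
    then show ?case by (simp add: zz)
  next
    case (insert x F)
    have "h (finprod (hg X Y) f (insert x F)) = h (f x \<otimes>\<^bsub>hg X Y\<^esub> finprod (hg X Y) f F)"
      using insert by (subst P.finprod_insert) auto
    also have "\<dots> = Add A (h (f x)) (h (finprod (hg X Y) f F))"
      using insert P.finprod_closed[of f F] add by auto
    also have "\<dots> = finprod (hg X' Y') (\<lambda>i. h (f i)) (insert x F)"
      using insert h by (subst Q.finprod_insert) auto
    finally show ?case .
  qed
qed

lemma hsum_finprod:
  assumes "X \<in> Obj A" "Y \<in> Obj A" "\<And>i. f i \<in> Hom A X Y" "finite S" "{i. f i \<noteq> Zer A X Y} \<subseteq> S"
  shows "hsum A X Y f = finprod (hg X Y) f S"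
proof -
  interpret comm_monoid "hg X Y" using assms hg_monoid by simp
  show ?thesis unfolding hsum_def
    by (rule finprod_mono_neutral_cong_left) (use assms in auto)
qed

lemma additive_hsum:
  assumes o: "X \<in> Obj A" "Y \<in> Obj A" "X' \<in> Obj A" "Y' \<in> Obj A"
    and h: "\<And>u. u \<in> Hom A X Y \<Longrightarrow> h u \<in> Hom A X' Y'"
    and add: "\<And>u v. \<lbrakk>u \<in> Hom A X Y; v \<in> Hom A X Y\<rbrakk> \<Longrightarrow> h (Add A u v) = Add A (h u) (h v)"
    and f: "finsupp A X Y f"
  shows "finsupp A X' Y' (\<lambda>i. h (f i))" "h (hsum A X Y f) = hsum A X' Y' (\<lambda>i. h (f i))"
proof -
  let ?S = "{i. f i \<noteq> Zer A X Y}"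
  note zz = additive_zer[OF o h add]
  have sub: "{i. h (f i) \<noteq> Zer A X' Y'} \<subseteq> ?S" using zz by auto
  have S: "finite ?S" and fi: "\<And>i. f i \<in> Hom A X Y" using f by (auto simp: finsupp_def)
  show "finsupp A X' Y' (\<lambda>i. h (f i))" using sub S fi h by (auto simp: finsupp_def intro: finite_subset)
  show "h (hsum A X Y f) = hsum A X' Y' (\<lambda>i. h (f i))"
  proof -
    have "hsum A X' Y' (\<lambda>i. h (f i)) = finprod (hg X' Y') (\<lambda>i. h (f i)) ?S"
      by (rule hsum_finprod) (use o h fi S sub in auto)
    also have "\<dots> = h (finprod (hg X Y) f ?S)"
      by (rule additive_finprod[symmetric]) (use o h add fi S in auto)
    finally show ?thesis by (simp only: hsum_def)
  qed
qed

lemma finsupp_comp: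
  assumes "finsupp A X Y f" "X \<in> Obj A" "Y \<in> Obj A" "g \<in> Arr A"
  shows "Dom A g = Y \<Longrightarrow> finsupp A X (Cod A g) (\<lambda>i. g \<odot> f i)"
    "Cod A g = X \<Longrightarrow> finsupp A (Dom A g) Y (\<lambda>i. f i \<odot> g)"
  using additive_hsum(1)[of X Y X "Cod A g" "\<lambda>u. g \<odot> u" f] additive_hsum(1)[of X Y "Dom A g" Y "\<lambda>u. u \<odot> g" f] assms
  by (simp_all add: mem_Hom)

lemma comp_hsum:
  assumes "finsupp A X Y f" "X \<in> Obj A" "Y \<in> Obj A" "g \<in> Arr A"
  shows "Dom A g = Y \<Longrightarrow> g \<odot> hsum A X Y f = hsum A X (Cod A g) (\<lambda>i. g \<odot> f i)"
    "Cod A g = X \<Longrightarrow> hsum A X Y f \<odot> g = hsum A (Dom A g) Y (\<lambda>i. f i \<odot> g)"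
  using additive_hsum(2)[of X Y X "Cod A g" "\<lambda>u. g \<odot> u" f] additive_hsum(2)[of X Y "Dom A g" Y "\<lambda>u. u \<odot> g" f] assms
  by (simp_all add: mem_Hom)

lemma hsum_single:
  assumes "X \<in> Obj A" "Y \<in> Obj A" "f k \<in> Hom A X Y" "\<And>i. i \<noteq> k \<Longrightarrow> f i = Zer A X Y"
  shows "hsum A X Y f = f k"
proof -
  interpret comm_monoid "hg X Y" using assms hg_monoid by simp
  have fi: "f i \<in> Hom A X Y" for i using assms by (cases "i = k") (auto simp: mem_Hom)
  have "{i. f i \<noteq> Zer A X Y} \<subseteq> {k}" using assms by auto
  then have "hsum A X Y f = finprod (hg X Y) f {k}" using assms fi by (intro hsum_finprod) auto
  also have "\<dots> = f k" using assms(3) by (simp add: mem_Hom)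
  finally show ?thesis .
qed

lemma hsum_two:
  assumes o: "X \<in> Obj A" "Y \<in> Obj A" and "f k \<in> Hom A X Y" "f l \<in> Hom A X Y" "k \<noteq> l"
    "\<And>i. i \<noteq> k \<Longrightarrow> i \<noteq> l \<Longrightarrow> f i = Zer A X Y"
  shows "hsum A X Y f = Add A (f k) (f l)"
proof -
  interpret comm_monoid "hg X Y" using assms hg_monoid by simp
  have fi: "f i \<in> Hom A X Y" for i using assms by (cases "i = k"; cases "i = l") (auto simp: mem_Hom)
  have "{i. f i \<noteq> Zer A X Y} \<subseteq> {k, l}" using assms by auto
  then have "hsum A X Y f = finprod (hg X Y) f {k, l}" using assms fi by (intro hsum_finprod) auto
  also have "\<dots> = Add A (f k) (f l)" using assms by (simp add: mem_Hom)
  finally show ?thesis .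
qed

section \<open>Zero objects and biproducts\<close>

lemma zero_obj_zero [simp]: "is_zero_obj A (zero_obj A)"
  unfolding zero_obj_def using ex_zero by (rule someI_ex)

lemma zero_obj_obj [simp]: "zero_obj A \<in> Obj A"
  using zero_obj_zero by (simp add: is_zero_obj_def del: zero_obj_zero)

lemma is_zero_obj_obj: "is_zero_obj A Z \<Longrightarrow> Z \<in> Obj A"
  by (simp add: is_zero_obj_def)

lemma into_zero_obj: "\<lbrakk>is_zero_obj A (Cod A f); f \<in> Arr A\<rbrakk> \<Longrightarrow> f = Zer A (Dom A f) (Cod A f)"
  and from_zero_obj: "\<lbrakk>is_zero_obj A (Dom A f); f \<in> Arr A\<rbrakk> \<Longrightarrow> f = Zer A (Dom A f) (Cod A f)"
  by (auto simp: is_zero_obj_def mem_Hom) (metis zer_arr dom_obj cod_obj)+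

text \<open>Replaces the universal property by one equation between endomorphisms, which additive
  operations such as tensoring with an object preserve.\<close>

lemma zero_obj_iff:
  assumes "Z \<in> Obj A"
  shows "is_zero_obj A Z \<longleftrightarrow> Id A Z = Zer A Z Z"
proof
  assume "is_zero_obj A Z"
  then have "is_zero_obj A (Cod A (Id A Z))" using assms by simp
  from into_zero_obj[OF this] show "Id A Z = Zer A Z Z" using assms by simp
next
  assume e: "Id A Z = Zer A Z Z"
  have "f = Zer A X Z" if "f \<in> Hom A X Z" for f X
  proof -
    have "f = Id A Z \<odot> f" using that by (simp add: mem_Hom)
    also have "\<dots> = Zer A X Z" unfolding e using that assms by (simp add: mem_Hom)
    finally show ?thesis .
  qed
  moreover have "f = Zer A Z X" if "f \<in> Hom A Z X" for f X
  proof -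
    have "f = f \<odot> Id A Z" using that by (simp add: mem_Hom)
    also have "\<dots> = Zer A Z X" unfolding e using that assms by (simp add: mem_Hom)
    finally show ?thesis .
  qed
  ultimately show "is_zero_obj A Z"
    unfolding is_zero_obj_def using assms by (metis mem_Hom zer_arr)
qed

lemma factor_zero:
  assumes "is_zero_obj A (Cod A f)" "f \<in> Arr A" "g \<in> Arr A" "Dom A g = Cod A f"
  shows "g \<odot> f = Zer A (Dom A f) (Cod A g)"
  using into_zero_obj[OF assms(1,2)] comp_zer(2)[of g "Dom A f" "Cod A f"] assms(2-4) by simp

lemma biprod_simps:
  assumes "is_biproduct A V S"
  shows "bob S \<in> Obj A" "bin S i \<in> Arr A" "Dom A (bin S i) = V i" "Cod A (bin S i) = bob S"
    "bpr S i \<in> Arr A" "Dom A (bpr S i) = bob S" "Cod A (bpr S i) = V i" "V i \<in> Obj A"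
    "bpr S j \<odot> bin S i = (if i = j then Id A (V i) else Zer A (V i) (V j))"
    "finsupp A (bob S) (bob S) (\<lambda>i. bin S i \<odot> bpr S i)"
    "hsum A (bob S) (bob S) (\<lambda>i. bin S i \<odot> bpr S i) = Id A (bob S)"
proof -
  show "bob S \<in> Obj A" "bin S i \<in> Arr A" "Dom A (bin S i) = V i" "Cod A (bin S i) = bob S"
    "bpr S i \<in> Arr A" "Dom A (bpr S i) = bob S" "Cod A (bpr S i) = V i"
    "bpr S j \<odot> bin S i = (if i = j then Id A (V i) else Zer A (V i) (V j))"
    "hsum A (bob S) (bob S) (\<lambda>i. bin S i \<odot> bpr S i) = Id A (bob S)" for i
    using assms by (auto simp: is_biproduct_def mem_Hom)
  show "V i \<in> Obj A" using \<open>\<And>i. bin S i \<in> Arr A\<close>[of i] \<open>\<And>i. Dom A (bin S i) = V i\<close>[of i] dom_obj by metis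
  show "finsupp A (bob S) (bob S) (\<lambda>i. bin S i \<odot> bpr S i)"
    using assms by (auto simp: is_biproduct_def finsupp_def mem_Hom)
qed

text \<open>The identity of a biproduct is the sum of the projections followed by the inclusions, so
  an arrow out of it is recovered from its restrictions to the summands.\<close>

lemma biprod_ext:
  assumes "is_biproduct A V S" "f \<in> Arr A" "g \<in> Arr A" "Dom A f = bob S" "Dom A g = bob S"
    "\<And>i. f \<odot> bin S i = g \<odot> bin S i" "Cod A f = Cod A g"
  shows "f = g"
proof -
  note s = biprod_simps[OF assms(1)]
  have e: "h = hsum A (bob S) (Cod A h) (\<lambda>i. (h \<odot> bin S i) \<odot> bpr S i)"
    if "h \<in> Arr A" "Dom A h = bob S" for h
    using comp_hsum(1)[OF s(10), of h] s that by simp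
  show ?thesis using e[of f] e[of g] assms by simp
qed

text \<open>\<open>is_biproduct\<close> admits an infinite index type, while an abelian category
  only supplies binary biproducts. The induction runs over a finite set outside which the objects
  vanish and splits off one index at a time.\<close>

lemma biproduct_finite_support:
  assumes "finite F" "\<And>i. V i \<in> Obj A" "\<And>i. i \<notin> F \<Longrightarrow> is_zero_obj A (V i)"
  shows "\<exists>S. is_biproduct A V S"
  using assms
proof (induction F arbitrary: V)
  case empty
  let ?Z = "zero_obj A"
  have Z: "Id A (V i) = Zer A (V i) (V i)" "Id A ?Z = Zer A ?Z ?Z" for i
    using empty zero_obj_iff zero_obj_iff[THEN iffD1, OF zero_obj_obj zero_obj_zero] by blast+
  have "is_biproduct A V \<lparr>bob = ?Z, bin = \<lambda>i. Zer A (V i) ?Z, bpr = \<lambda>i. Zer A ?Z (V i)\<rparr>"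
    using empty Z comm_monoid.finprod_empty[OF hg_monoid, of ?Z ?Z]
    by (auto simp: is_biproduct_def mem_Hom hsum_def)
  then show ?case by blast
next
  case (insert k F)
  \<comment> \<open>Emptying the place \<open>k\<close> leaves the support in \<open>F\<close>; the
    object \<open>V k\<close> comes back as the \<open>True\<close> summand of the binary biproduct
    \<open>R\<close>.\<close>
  define V' where "V' = V(k := zero_obj A)"
  have "\<exists>S. is_biproduct A V' S"
    by (rule insert.IH) (use insert in \<open>auto simp: V'_def\<close>)
  then obtain S where S: "is_biproduct A V' S" by blast
  note s = biprod_simps[OF S]
  obtain R where R: "is_biproduct A (\<lambda>b. if b then V k else bob S) R"
    using ex_biproduct[of "V k" "bob S"] s insert by auto
  note r = biprod_simps[OF R]
  define bi where "bi i = (if i = k then bin R True else bin R False \<odot> bin S i)" for i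
  define bp where "bp i = (if i = k then bpr R True else bpr S i \<odot> bpr R False)" for i
  have V: "V i \<in> Obj A" "i \<noteq> k \<Longrightarrow> V' i = V i" for i using insert by (auto simp: V'_def)
  have arr: "bi i \<in> Hom A (V i) (bob R)" "bp i \<in> Hom A (bob R) (V i)" for i
    using s r V by (auto simp: bi_def bp_def mem_Hom)
  have delta: "bp j \<odot> bi i = (if i = j then Id A (V i) else Zer A (V i) (V j))" for i j
  proof -
    have a: "bpr R False \<odot> (bin R False \<odot> bin S i) = bin S i"
      using comp_reduce[OF r(9)[where j=False and i=False], of "bin S i"] s r by simp
    have b: "bpr R True \<odot> (bin R False \<odot> bin S i) = Zer A (V' i) (V k)"
      using comp_reduce[OF r(9)[where j=True and i=False], of "bin S i"] s r V(1)[of k] by simp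
    show ?thesis
      using s r V a b by (auto simp: bi_def bp_def)
  qed
  let ?t = "\<lambda>i. bi i \<odot> bp i"
  let ?u = "\<lambda>i. bin R False \<odot> (bin S i \<odot> bpr S i) \<odot> bpr R False"
  have tt: "?t i = (if i = k then bin R True \<odot> bpr R True else ?u i)" for i
    using s r V by (auto simp: bi_def bp_def)
  have f1: "finsupp A (bob R) (bob S) (\<lambda>i. (bin S i \<odot> bpr S i) \<odot> bpr R False)"
    using finsupp_comp(2)[OF s(10), of "bpr R False"] s r by simp
  have fu: "finsupp A (bob R) (bob R) ?u"
    using finsupp_comp(1)[OF f1, of "bin R False"] s r by simp
  have su: "hsum A (bob R) (bob R) ?u = bin R False \<odot> bpr R False"
    using comp_hsum(2)[OF s(10), of "bpr R False"] comp_hsum(1)[OF f1, of "bin R False"] s r by simp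
  \<comment> \<open>The inner biproduct still has an inclusion and a projection at \<open>k\<close>,
    but they meet in the zero object put there, so this index is free for the new summand.\<close>
  have uk: "?u k = Zer A (bob R) (bob R)"
  proof -
    have "is_zero_obj A (Cod A (bpr S k))" by (simp add: s) (simp add: V'_def)
    from factor_zero[OF this, of "bin S k"] have "bin S k \<odot> bpr S k = Zer A (bob S) (bob S)"
      by (simp add: s)
    then show ?thesis using r s(1) by simp
  qed
  have fin: "finite {i. ?t i \<noteq> Zer A (bob R) (bob R)}"
  proof (rule finite_subset)
    show "{i. ?t i \<noteq> Zer A (bob R) (bob R)} \<subseteq> insert k {i. ?u i \<noteq> Zer A (bob R) (bob R)}"
      unfolding tt by auto
    show "finite (insert k {i. ?u i \<noteq> Zer A (bob R) (bob R)})"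
      using fu unfolding finsupp_def by blast
  qed
  have "hsum A (bob R) (bob R) ?t = Id A (bob R)"
  proof -
    interpret comm_monoid "hg (bob R) (bob R)" using r hg_monoid by simp
    let ?F = "{i. ?u i \<noteq> Zer A (bob R) (bob R)}"
    have k: "k \<notin> ?F" "finite ?F" using uk fu unfolding finsupp_def by blast+
    have th: "?t i \<in> Hom A (bob R) (bob R)" for i using arr by (simp add: mem_Hom)
    have "hsum A (bob R) (bob R) ?t = finprod (hg (bob R) (bob R)) ?t (insert k ?F)"
    proof (rule hsum_finprod)
      show "{i. ?t i \<noteq> Zer A (bob R) (bob R)} \<subseteq> insert k ?F"
        unfolding tt by auto
    qed (use k r th in simp_all)
    also have "\<dots> = Add A (?t k) (finprod (hg (bob R) (bob R)) ?t ?F)"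
      using k th by (subst finprod_insert) simp_all
    also have "finprod (hg (bob R) (bob R)) ?t ?F = finprod (hg (bob R) (bob R)) ?u ?F"
    proof (rule finprod_cong')
      show "?u \<in> ?F \<rightarrow> carrier (hg (bob R) (bob R))" using fu by (simp add: finsupp_def)
      show "?t i = ?u i" if "i \<in> ?F" for i using that k unfolding tt by auto
    qed simp
    also have "\<dots> = bin R False \<odot> bpr R False" using su by (simp add: hsum_def)
    also have "Add A (?t k) (bin R False \<odot> bpr R False) =
        hsum A (bob R) (bob R) (\<lambda>i. bin R i \<odot> bpr R i)"
      using hsum_two[of "bob R" "bob R" "\<lambda>i. bin R i \<odot> bpr R i" True False] r
      by (auto simp: tt mem_Hom)
    finally show ?thesis using r by simp
  qed
  then have "is_biproduct A V \<lparr>bob = bob R, bin = bi, bpr = bp\<rparr>"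
    using arr delta fin r by (simp add: is_biproduct_def)
  then show ?case by blast
qed

lemma dsum_biproduct:
  assumes "finite F" "\<And>i. V i \<in> Obj A" "\<And>i. i \<notin> F \<Longrightarrow> is_zero_obj A (V i)"
  shows "is_biproduct A V (dsum A V)"
  unfolding dsum_def using biproduct_finite_support[OF assms] by (rule someI_ex)

end

text \<open>The typing and the bound under which the sums \<open>tsum\<close> are biproducts. That a
  total complex is a complex is not derived from relations between the differentials: it is known
  because the complex is a value of a functor or the source of a Kuenneth morphism.\<close>

definition pre_dcx :: "('o, 'm, 'z) acat_scheme \<Rightarrow> ('o, 'm) dcx \<Rightarrow> bool" where
  "pre_dcx A X \<longleftrightarrow> dcx_bounded_below A X \<and> (\<forall>p q. dob X p q \<in> Obj A \<and>
     dhor X p q \<in> Hom A (dob X p q) (dob X (p + 1) q) \<and>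
     dver X p q \<in> Hom A (dob X p q) (dob X p (q + 1)))"

text \<open>Bidegreewise arrows without differentials are enough to compose total maps and to
  restrict them to summands; \<open>dcx_map\<close> is reserved for the proof that a total map is a
  chain map.\<close>

definition dcx_hom where
  "dcx_hom A X Y f \<longleftrightarrow> (\<forall>p q. f p q \<in> Hom A (dob X p q) (dob Y p q))"

definition dcx_map where
  "dcx_map A X Y f \<longleftrightarrow> dcx_hom A X Y f \<and> (\<forall>p q.
     dhor Y p q \<cdot>\<^bsub>A\<^esub> f p q = f (p + 1) q \<cdot>\<^bsub>A\<^esub> dhor X p q \<and>
     dver Y p q \<cdot>\<^bsub>A\<^esub> f p q = f p (q + 1) \<cdot>\<^bsub>A\<^esub> dver X p q)"

context abelian_category
begin

lemma biprod_cotuple: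
  assumes S: "is_biproduct A V S" and Y: "Y \<in> Obj A" and g: "\<And>i. g i \<in> Hom A (V i) Y"
  shows "finsupp A (bob S) Y (\<lambda>i. g i \<odot> bpr S i)"
    and "hsum A (bob S) Y (\<lambda>i. g i \<odot> bpr S i) \<odot> bin S k = g k"
    and "hsum A (bob S) Y (\<lambda>i. g i \<odot> bpr S i) \<in> Arr A"
    and "Dom A (hsum A (bob S) Y (\<lambda>i. g i \<odot> bpr S i)) = bob S"
    and "Cod A (hsum A (bob S) Y (\<lambda>i. g i \<odot> bpr S i)) = Y"
proof -
  note s = biprod_simps[OF S]
  have gh: "g i \<in> Arr A" "Dom A (g i) = V i" "Cod A (g i) = Y" for i
    using g[of i] by (simp_all add: mem_Hom)
  \<comment> \<open>A summand that contributes nothing to the identity has zero projection. The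
    support of the family \<open>g i \<odot> bpr S i\<close> thus lies in that of the identity,
    which is finite by the definition of a biproduct.\<close>
  have pr0: "bpr S i = Zer A (bob S) (V i)"
    if z: "bin S i \<odot> bpr S i = Zer A (bob S) (bob S)" for i
  proof -
    have "bpr S i = (bpr S i \<odot> bin S i) \<odot> bpr S i"
      by (subst s(9)) (simp add: s)
    also have "\<dots> = bpr S i \<odot> (bin S i \<odot> bpr S i)"
      by (rule comp_assoc_arr) (simp_all add: s)
    also have "\<dots> = Zer A (bob S) (V i)" unfolding z by (simp add: s)
    finally show ?thesis .
  qed
  have sub: "{i. g i \<odot> bpr S i \<noteq> Zer A (bob S) Y} \<subseteq>
      {i. bin S i \<odot> bpr S i \<noteq> Zer A (bob S) (bob S)}" (is "?P \<subseteq> ?Q")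
  proof (rule ccontr)
    assume "\<not> ?P \<subseteq> ?Q"
    then obtain i where i: "g i \<odot> bpr S i \<noteq> Zer A (bob S) Y"
      and z: "bin S i \<odot> bpr S i = Zer A (bob S) (bob S)" by blast
    show False using i unfolding pr0[OF z] by (simp add: s gh)
  qed
  have fq: "finite ?Q" using s(10) unfolding finsupp_def by blast
  have hom: "g i \<odot> bpr S i \<in> Hom A (bob S) Y" for i
    using gh s by (simp add: mem_Hom)
  show f: "finsupp A (bob S) Y (\<lambda>i. g i \<odot> bpr S i)"
    unfolding finsupp_def using hom finite_subset[OF sub fq] by blast
  have "hsum A (bob S) Y (\<lambda>i. g i \<odot> bpr S i) \<odot> bin S k
     = hsum A (V k) Y (\<lambda>i. (g i \<odot> bpr S i) \<odot> bin S k)"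
    using comp_hsum(2)[OF f, of "bin S k"] by (simp add: s Y)
  also have "\<dots> = (g k \<odot> bpr S k) \<odot> bin S k"
  proof (rule hsum_single)
    fix i assume "i \<noteq> k"
    then show "(g i \<odot> bpr S i) \<odot> bin S k = Zer A (V k) Y"
      by (simp add: s gh)
  qed (simp_all add: s gh Y mem_Hom)
  also have "\<dots> = g k" by (simp add: s gh)
  finally show "hsum A (bob S) Y (\<lambda>i. g i \<odot> bpr S i) \<odot> bin S k = g k" .
  show "hsum A (bob S) Y (\<lambda>i. g i \<odot> bpr S i) \<in> Arr A"
    "Dom A (hsum A (bob S) Y (\<lambda>i. g i \<odot> bpr S i)) = bob S"
    "Cod A (hsum A (bob S) Y (\<lambda>i. g i \<odot> bpr S i)) = Y"
    using hsum_arr[of "bob S" Y "\<lambda>i. g i \<odot> bpr S i", OF s(1) Y hom] by blast+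
qed

section \<open>Total complexes\<close>

lemma pre_dcx_simps [simp]:
  assumes "pre_dcx A X"
  shows "dob X p q \<in> Obj A" "dhor X p q \<in> Arr A" "Dom A (dhor X p q) = dob X p q"
    "Cod A (dhor X p q) = dob X (p + 1) q" "dver X p q \<in> Arr A" "Dom A (dver X p q) = dob X p q"
    "Cod A (dver X p q) = dob X p (q + 1)"
  using assms by (simp_all add: pre_dcx_def mem_Hom)

lemma tsum_biproduct:
  assumes "pre_dcx A X"
  shows "is_biproduct A (\<lambda>p. dob X p (n - p)) (tsum A X n)"
proof -
  obtain N where N: "\<And>p q. p < N \<or> q < N \<Longrightarrow> is_zero_obj A (dob X p q)"
    using assms unfolding pre_dcx_def dcx_bounded_below_def by blast
  \<comment> \<open>For p outside the interval below, p < N or n - p < N, so the summand of bidegree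
    (p, n - p) is a zero object.\<close>
  show ?thesis unfolding tsum_def
    by (rule dsum_biproduct[of "{N..n - N}"]) (use assms N in auto)
qed

lemma tsum_simps [simp]:
  assumes "pre_dcx A X"
  shows "bob (tsum A X n) \<in> Obj A" "bin (tsum A X n) p \<in> Arr A"
    "Dom A (bin (tsum A X n) p) = dob X p (n - p)" "Cod A (bin (tsum A X n) p) = bob (tsum A X n)"
    "bpr (tsum A X n) p \<in> Arr A" "Dom A (bpr (tsum A X n) p) = bob (tsum A X n)"
    "Cod A (bpr (tsum A X n) p) = dob X p (n - p)"
  using biprod_simps[OF tsum_biproduct[OF assms]] by simp_all

lemma tsum_delta:
  assumes "pre_dcx A X"
  shows "bpr (tsum A X n) q \<odot> bin (tsum A X n) p
    = (if p = q then Id A (dob X p (n - p)) else Zer A (dob X p (n - p)) (dob X q (n - q)))"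
  using biprod_simps(9)[OF tsum_biproduct[OF assms]] .

lemma cob_tot [simp]: "cob (tot A X) n = bob (tsum A X n)"
  by (simp add: tot_def)

lemma tsum_ext:
  assumes "pre_dcx A X" "f \<in> Arr A" "g \<in> Arr A" "Dom A f = bob (tsum A X n)"
    "Dom A g = bob (tsum A X n)" "Cod A f = Cod A g"
    "\<And>p. f \<odot> bin (tsum A X n) p = g \<odot> bin (tsum A X n) p"
  shows "f = g"
  by (rule biprod_ext[OF tsum_biproduct]) (use assms in simp_all)

lemma cdf_tot:
  assumes X: "pre_dcx A X"
  shows "cdf (tot A X) n \<in> Arr A" "Dom A (cdf (tot A X) n) = bob (tsum A X n)"
    "Cod A (cdf (tot A X) n) = bob (tsum A X (n + 1))"
    "cdf (tot A X) n \<odot> bin (tsum A X n) p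
      = Add A (bin (tsum A X (n + 1)) (p + 1) \<odot> dhor X p (n - p))
          (sgn_arr A p (bin (tsum A X (n + 1)) p \<odot> dver X p (n - p)))"
proof -
  let ?g = "\<lambda>p. Add A (bin (tsum A X (n + 1)) (p + 1) \<odot> dhor X p (n - p))
          (sgn_arr A p (bin (tsum A X (n + 1)) p \<odot> dver X p (n - p)))"
  \<comment> \<open>\<open>bin (tsum A X (n + 1)) p\<close> starts at second degree n + 1 - p, which
    must be recognised as the target degree (n - p) + 1 of \<open>dver X p (n - p)\<close>.\<close>
  have ar: "n + 1 - p = n - p + 1" for p :: int by simp
  have g: "?g p \<in> Hom A (dob X p (n - p)) (bob (tsum A X (n + 1)))" for p
    using X by (simp add: mem_Hom ar)
  have e: "cdf (tot A X) n = hsum A (bob (tsum A X n)) (bob (tsum A X (n + 1))) (\<lambda>p. ?g p \<odot> bpr (tsum A X n) p)"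
    unfolding tot_def using X by (simp add: ar)
  show "cdf (tot A X) n \<in> Arr A" "Dom A (cdf (tot A X) n) = bob (tsum A X n)"
    "Cod A (cdf (tot A X) n) = bob (tsum A X (n + 1))"
    "cdf (tot A X) n \<odot> bin (tsum A X n) p = ?g p"
    unfolding e using biprod_cotuple(2-5)[OF tsum_biproduct[OF X] tsum_simps(1)[OF X] g] by simp_all
qed

lemma dcx_hom_simps:
  assumes "dcx_hom A X Y f"
  shows "f p q \<in> Arr A" "Dom A (f p q) = dob X p q" "Cod A (f p q) = dob Y p q"
  using assms by (auto simp: dcx_hom_def mem_Hom)

lemma tot_map_simps:
  assumes X: "pre_dcx A X" and Y: "pre_dcx A Y" and f: "dcx_hom A X Y f"
  shows "dat (tot_map A X Y f) n \<in> Arr A" "Dom A (dat (tot_map A X Y f) n) = bob (tsum A X n)"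
    "Cod A (dat (tot_map A X Y f) n) = bob (tsum A Y n)"
    "dat (tot_map A X Y f) n \<odot> bin (tsum A X n) p = bin (tsum A Y n) p \<odot> f p (n - p)"
proof -
  let ?g = "\<lambda>p. bin (tsum A Y n) p \<odot> f p (n - p)"
  note fs = dcx_hom_simps[OF f]
  have g: "?g p \<in> Hom A (dob X p (n - p)) (bob (tsum A Y n))" for p
    using X Y fs by (simp add: mem_Hom)
  have e: "dat (tot_map A X Y f) n = hsum A (bob (tsum A X n)) (bob (tsum A Y n)) (\<lambda>p. ?g p \<odot> bpr (tsum A X n) p)"
    unfolding tot_map_def using X Y fs by simp
  show "dat (tot_map A X Y f) n \<in> Arr A" "Dom A (dat (tot_map A X Y f) n) = bob (tsum A X n)"
    "Cod A (dat (tot_map A X Y f) n) = bob (tsum A Y n)"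
    "dat (tot_map A X Y f) n \<odot> bin (tsum A X n) p = ?g p"
    unfolding e using biprod_cotuple(2-5)[OF tsum_biproduct[OF X] tsum_simps(1)[OF Y] g] by simp_all
qed

lemma tot_map_ends [simp]: "src (tot_map A X Y f) = tot A X" "tgt (tot_map A X Y f) = tot A Y"
  by (simp_all add: tot_map_def)

lemma tot_map_comp:
  assumes X: "pre_dcx A X" and Y: "pre_dcx A Y" and Z: "pre_dcx A Z"
    and f: "dcx_hom A X Y f" and g: "dcx_hom A Y Z g"
    and h: "\<And>p q. h p q = g p q \<odot> f p q"
  shows "dat (tot_map A Y Z g) n \<odot> dat (tot_map A X Y f) n = dat (tot_map A X Z h) n"
proof -
  note fs = dcx_hom_simps[OF f] and gs = dcx_hom_simps[OF g]
  have hh: "dcx_hom A X Z h"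
    unfolding dcx_hom_def h using fs gs by (simp add: mem_Hom)
  note F = tot_map_simps[OF X Y f] and G = tot_map_simps[OF Y Z g] and H = tot_map_simps[OF X Z hh]
  show ?thesis
  proof (rule tsum_ext[OF X])
    fix p
    have "dat (tot_map A Y Z g) n \<odot> (bin (tsum A Y n) p \<odot> f p (n - p))
      = (bin (tsum A Z n) p \<odot> g p (n - p)) \<odot> f p (n - p)"
      by (rule comp_reduce[OF G(4)]) (use fs gs G Y in simp_all)
    then show "(dat (tot_map A Y Z g) n \<odot> dat (tot_map A X Y f) n) \<odot> bin (tsum A X n) p =
         dat (tot_map A X Z h) n \<odot> bin (tsum A X n) p"
      using F G H X Y Z fs gs by (simp add: h)
  qed (use F G H X Y Z in simp_all)
qed

lemma tot_map_id:
  assumes X: "pre_dcx A X" and f: "\<And>p q. f p q = Id A (dob X p q)"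
  shows "dat (tot_map A X X f) n = Id A (bob (tsum A X n))"
proof -
  have h: "dcx_hom A X X f" unfolding dcx_hom_def f using X by (simp add: mem_Hom)
  show ?thesis
  proof (rule tsum_ext[OF X])
    fix p
    show "dat (tot_map A X X f) n \<odot> bin (tsum A X n) p = Id A (bob (tsum A X n)) \<odot> bin (tsum A X n) p"
      unfolding tot_map_simps(4)[OF X X h] f using X by simp
  qed (use X tot_map_simps[OF X X h] in simp_all)
qed

text \<open>Checked on each summand: a map of double complexes keeps the first degree p, so the sign
  in front of the vertical differential is the same on both sides.\<close>

lemma tot_map_chain:
  assumes X: "pre_dcx A X" and Y: "pre_dcx A Y" and f: "dcx_map A X Y f"
  shows "cdf (tot A Y) n \<odot> dat (tot_map A X Y f) n = dat (tot_map A X Y f) (n + 1) \<odot> cdf (tot A X) n"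
proof -
  have fh: "dcx_hom A X Y f" using f by (simp add: dcx_map_def)
  have fd: "dhor Y p q \<odot> f p q = f (p + 1) q \<odot> dhor X p q"
    "dver Y p q \<odot> f p q = f p (q + 1) \<odot> dver X p q" for p q
    using f by (simp_all add: dcx_map_def)
  note fs = dcx_hom_simps[OF fh]
  note F = tot_map_simps[OF X Y fh]
  note dX = cdf_tot[OF X] and dY = cdf_tot[OF Y]
  have ar: "n + 1 - p = n - p + 1" for p :: int by simp
  show ?thesis
  proof (rule tsum_ext[OF X])
    fix p
    let ?L = "Add A (bin (tsum A Y (n + 1)) (p + 1) \<odot> f (p + 1) (n - p) \<odot> dhor X p (n - p))
       (sgn_arr A p (bin (tsum A Y (n + 1)) p \<odot> f p (n - p + 1) \<odot> dver X p (n - p)))"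
    have "cdf (tot A Y) n \<odot> (bin (tsum A Y n) p \<odot> f p (n - p)) =
      Add A (bin (tsum A Y (n + 1)) (p + 1) \<odot> dhor Y p (n - p))
          (sgn_arr A p (bin (tsum A Y (n + 1)) p \<odot> dver Y p (n - p))) \<odot> f p (n - p)"
      by (rule comp_reduce[OF dY(4)]) (use fs Y dY in simp_all)
    also have "\<dots> = ?L" using fs X Y by (simp add: ar fd)
    finally have 1: "cdf (tot A Y) n \<odot> (bin (tsum A Y n) p \<odot> f p (n - p)) = ?L" .
    have 2: "dat (tot_map A X Y f) (n + 1) \<odot> (bin (tsum A X (n + 1)) (p + 1) \<odot> dhor X p (n - p))
      = (bin (tsum A Y (n + 1)) (p + 1) \<odot> f (p + 1) (n + 1 - (p + 1))) \<odot> dhor X p (n - p)"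
      by (rule comp_reduce[OF F(4)]) (use fs F X in simp_all)
    have 3: "dat (tot_map A X Y f) (n + 1) \<odot> (bin (tsum A X (n + 1)) p \<odot> dver X p (n - p))
      = (bin (tsum A Y (n + 1)) p \<odot> f p (n + 1 - p)) \<odot> dver X p (n - p)"
      by (rule comp_reduce[OF F(4)]) (use fs F X in \<open>simp_all add: ar\<close>)
    show "(cdf (tot A Y) n \<odot> dat (tot_map A X Y f) n) \<odot> bin (tsum A X n) p =
         (dat (tot_map A X Y f) (n + 1) \<odot> cdf (tot A X) n) \<odot> bin (tsum A X n) p"
      using 2 3 fs F(1-3) X Y dX dY(1-3) by (simp add: F(4) 1 ar)
  qed (use F dX dY X Y in simp_all)
qed

end

section \<open>The category of complexes\<close>

lemma ch_cat_simps:
  "Obj (ch_cat A) = {X. is_complex A X \<and> (\<exists>N. vanishes_below A N X)}"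
  "a \<in> Arr (ch_cat A) \<longleftrightarrow> src a \<in> Obj (ch_cat A) \<and> tgt a \<in> Obj (ch_cat A) \<and> is_chain_map A (src a) (tgt a) (dat a)"
  "Dom (ch_cat A) a = src a" "Cod (ch_cat A) a = tgt a"
  by (auto simp: ch_cat_def Let_def split: prod.splits)

lemma ch_comp: "b \<cdot>\<^bsub>ch_cat A\<^esub> a = (src a, tgt b, \<lambda>n. dat b n \<cdot>\<^bsub>A\<^esub> dat a n)"
  by (simp add: ch_cat_def Let_def)

lemma ch_dat_comp [simp]: "dat (b \<cdot>\<^bsub>ch_cat A\<^esub> a) n = dat b n \<cdot>\<^bsub>A\<^esub> dat a n"
  by (simp add: ch_comp)

lemma ch_id: "Id (ch_cat A) X = (X, X, \<lambda>n. Id A (cob X n))"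
  by (simp add: ch_cat_def Let_def)

lemma ch_dat_id [simp]: "dat (Id (ch_cat A) X) n = Id A (cob X n)"
  by (simp add: ch_id)

context abelian_category
begin

abbreviation "Ch \<equiv> ch_cat A"

lemma ch_obj:
  assumes "X \<in> Obj Ch"
  shows "cob X n \<in> Obj A" "cdf X n \<in> Arr A" "Dom A (cdf X n) = cob X n"
    "Cod A (cdf X n) = cob X (n + 1)"
    "cdf X (n + 1) \<odot> cdf X n = Zer A (cob X n) (cob X (n + 1 + 1))"
    "\<exists>N. vanishes_below A N X"
  using assms by (auto simp: ch_cat_simps(1) is_complex_def mem_Hom)

lemma ch_arr:
  assumes "a \<in> Arr Ch"
  shows "dat a n \<in> Arr A" "Dom A (dat a n) = cob (Dom Ch a) n" "Cod A (dat a n) = cob (Cod Ch a) n"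
    "cdf (Cod Ch a) n \<odot> dat a n = dat a (n + 1) \<odot> cdf (Dom Ch a) n"
  using assms by (auto simp: ch_cat_simps(2-4) is_chain_map_def mem_Hom)

lemma ch_ext:
  assumes "a \<in> Arr Ch" "b \<in> Arr Ch" "Dom Ch a = Dom Ch b" "Cod Ch a = Cod Ch b"
    "\<And>n. dat a n = dat b n"
  shows "a = b"
  using assms by (auto simp: ch_cat_simps(3,4) prod_eq_iff)

lemma ch_homI:
  assumes "X \<in> Obj Ch" "Y \<in> Obj Ch" "src a = X" "tgt a = Y"
    "\<And>n. dat a n \<in> Hom A (cob X n) (cob Y n)"
    "\<And>n. cdf Y n \<odot> dat a n = dat a (n + 1) \<odot> cdf X n"
  shows "a \<in> Hom Ch X Y"
  using assms by (simp add: mem_Hom ch_cat_simps(2-4) is_chain_map_def)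

lemma category_ch: "category Ch"
proof
  fix X assume X: "X \<in> Obj Ch"
  show "Id Ch X \<in> Hom Ch X X"
    by (rule ch_homI) (use X ch_obj[OF X] in \<open>simp_all add: ch_id mem_Hom\<close>)
next
  fix f g X Y Z assume f: "f \<in> Hom Ch X Y" and g: "g \<in> Hom Ch Y Z"
  have fs: "f \<in> Arr Ch" "src f = X" "tgt f = Y" and gs: "g \<in> Arr Ch" "src g = Y" "tgt g = Z"
    using f g by (simp_all add: mem_Hom ch_cat_simps(3,4))
  have o: "X \<in> Obj Ch" "Y \<in> Obj Ch" "Z \<in> Obj Ch"
    using fs gs by (auto simp: ch_cat_simps(2))
  note ff = ch_arr[OF fs(1), unfolded ch_cat_simps(3,4) fs(2-)]
    and gg = ch_arr[OF gs(1), unfolded ch_cat_simps(3,4) gs(2-)]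
  show "g \<cdot>\<^bsub>Ch\<^esub> f \<in> Hom Ch X Z"
  proof (rule ch_homI)
    fix n
    have "cdf Z n \<odot> dat g n \<odot> dat f n = (dat g (n + 1) \<odot> cdf Y n) \<odot> dat f n"
      by (rule comp_reduce) (use ff gg ch_obj o in simp_all)
    also have "\<dots> = dat g (n + 1) \<odot> cdf Y n \<odot> dat f n"
      by (rule comp_assoc_arr) (use ff(1-3) gg(1-3) ch_obj o in simp_all)
    also have "\<dots> = (dat g (n + 1) \<odot> dat f (n + 1)) \<odot> cdf X n"
      unfolding ff(4) by (rule comp_assoc_arr[symmetric]) (use ff(1-3) gg(1-3) ch_obj o in simp_all)
    finally show "cdf Z n \<odot> dat (g \<cdot>\<^bsub>Ch\<^esub> f) n = dat (g \<cdot>\<^bsub>Ch\<^esub> f) (n + 1) \<odot> cdf X n"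
      by simp
  qed (use o fs(2-) gs(2-) ff(1-3) gg(1-3) in \<open>simp_all add: ch_comp mem_Hom\<close>)
next
  fix f X Y assume f: "f \<in> Hom Ch X Y"
  then have fs: "f \<in> Arr Ch" "src f = X" "tgt f = Y"
    by (simp_all add: mem_Hom ch_cat_simps(3,4))
  note ff = ch_arr[OF fs(1), unfolded ch_cat_simps(3,4) fs(2-)]
  show "Id Ch Y \<cdot>\<^bsub>Ch\<^esub> f = f" "f \<cdot>\<^bsub>Ch\<^esub> Id Ch X = f"
    using fs(2-) ff(1-3) by (simp_all add: ch_comp ch_id prod_eq_iff fun_eq_iff)
next
  fix f g h X Y Z V assume "f \<in> Hom Ch X Y" "g \<in> Hom Ch Y Z" "h \<in> Hom Ch Z V"
  then have fs: "f \<in> Arr Ch" "src f = X" "tgt f = Y" "g \<in> Arr Ch" "src g = Y" "tgt g = Z"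
    "h \<in> Arr Ch" "src h = Z" "tgt h = V"
    by (simp_all add: mem_Hom ch_cat_simps(3,4))
  note ff = ch_arr[OF fs(1), unfolded ch_cat_simps(3,4) fs]
    and gg = ch_arr[OF fs(4), unfolded ch_cat_simps(3,4) fs]
    and hh = ch_arr[OF fs(7), unfolded ch_cat_simps(3,4) fs]
  show "(h \<cdot>\<^bsub>Ch\<^esub> g) \<cdot>\<^bsub>Ch\<^esub> f = h \<cdot>\<^bsub>Ch\<^esub> (g \<cdot>\<^bsub>Ch\<^esub> f)"
    using fs(2,3,5,6,8,9) ff(1-3) gg(1-3) hh(1-3) by (simp add: ch_comp prod_eq_iff fun_eq_iff)
qed (simp_all add: ch_cat_simps(2-4))

end

context abelian_monoidal_category
begin

section \<open>The tensor product of complexes\<close>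

lemma tensor_arr [simp]:
  assumes "f \<in> Arr A" "g \<in> Arr A"
  shows "TA M f g \<in> Arr A" "Dom A (TA M f g) = TO M (Dom A f) (Dom A g)"
    "Cod A (TA M f g) = TO M (Cod A f) (Cod A g)"
  using tensor_hom[of f "Dom A f" "Cod A f" g "Dom A g" "Cod A g"] assms by (auto simp: mem_Hom)

lemmas tensor_obj_simp [simp] = tensor_obj

lemma tensor_comp_arr:
  assumes "f \<in> Arr A" "f' \<in> Arr A" "Dom A f' = Cod A f" "g \<in> Arr A" "g' \<in> Arr A" "Dom A g' = Cod A g"
  shows "TA M f' g' \<odot> TA M f g = TA M (f' \<odot> f) (g' \<odot> g)"
  using tensor_comp[of f "Dom A f" "Cod A f" f' "Cod A f'" g "Dom A g" "Cod A g" g' "Cod A g'"] assms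
  by (simp add: mem_Hom)

lemma tensor_zer_left [simp]:
  assumes "X \<in> Obj A" "Y \<in> Obj A" "g \<in> Arr A"
  shows "TA M (Zer A X Y) g = Zer A (TO M X (Dom A g)) (TO M Y (Cod A g))"
  by (rule additive_zer[where h = "\<lambda>u. TA M u g"]) (use assms tensor_add_left in \<open>auto simp: mem_Hom\<close>)

lemma tensor_zer_right [simp]:
  assumes "X \<in> Obj A" "Y \<in> Obj A" "g \<in> Arr A"
  shows "TA M g (Zer A X Y) = Zer A (TO M (Dom A g) X) (TO M (Cod A g) Y)"
  by (rule additive_zer[where h = "\<lambda>u. TA M g u"]) (use assms tensor_add_right in \<open>auto simp: mem_Hom\<close>)

lemma tensor_zero_obj:
  assumes "is_zero_obj A X" "Y \<in> Obj A"
  shows "is_zero_obj A (TO M X Y)" "is_zero_obj A (TO M Y X)"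
proof -
  have X: "X \<in> Obj A" using assms is_zero_obj_obj by blast
  have e: "Id A X = Zer A X X" using assms X zero_obj_iff by blast
  have "Id A (TO M X Y) = TA M (Zer A X X) (Id A Y)" using tensor_id[OF X assms(2)] e by simp
  then show "is_zero_obj A (TO M X Y)" using X assms by (simp add: zero_obj_iff)
  have "Id A (TO M Y X) = TA M (Id A Y) (Zer A X X)" using tensor_id[OF assms(2) X] e by simp
  then show "is_zero_obj A (TO M Y X)" using X assms by (simp add: zero_obj_iff)
qed

text \<open>The tensor product is additive in each variable separately, so the two decompositions of
  identities are expanded one factor at a time: \<open>dec\<close> treats the first factor,
  \<open>dec2\<close> the second.\<close>

lemma tensor_biprod_ext:
  assumes S: "is_biproduct A V S" and R: "is_biproduct A V' R"
    and f: "f \<in> Arr A" "Dom A f = TO M (bob S) (bob R)"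
    and g: "g \<in> Arr A" "Dom A g = TO M (bob S) (bob R)" "Cod A f = Cod A g"
    and e: "\<And>i j. f \<odot> TA M (bin S i) (bin R j) = g \<odot> TA M (bin S i) (bin R j)"
  shows "f = g"
proof -
  note s = biprod_simps[OF S] and r = biprod_simps[OF R]
  let ?S = "bob S" and ?R = "bob R"
  have dec: "h \<odot> TA M (Id A ?S) u = hsum A (TO M ?S (Dom A u)) (Cod A h) (\<lambda>i. h \<odot> TA M (bin S i \<odot> bpr S i) u)"
    if h: "h \<in> Arr A" "Dom A h = TO M ?S ?R" and u: "u \<in> Arr A" "Cod A u = ?R" for h u
    using additive_hsum(2)[of ?S ?S "TO M ?S (Dom A u)" "Cod A h" "\<lambda>v. h \<odot> TA M v u", OF _ _ _ _ _ _ s(10)]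
      s h u by (simp add: mem_Hom tensor_add_left[of _ ?S ?S])
  have dec2: "h \<odot> TA M v (Id A ?R) = hsum A (TO M (Dom A v) ?R) (Cod A h) (\<lambda>j. h \<odot> TA M v (bin R j \<odot> bpr R j))"
    if h: "h \<in> Arr A" "Dom A h = TO M ?S ?R" and v: "v \<in> Arr A" "Cod A v = ?S" for h v
    using additive_hsum(2)[of ?R ?R "TO M (Dom A v) ?R" "Cod A h" "\<lambda>u. h \<odot> TA M v u", OF _ _ _ _ _ _ r(10)]
      r h v by (simp add: mem_Hom tensor_add_right[of _ _ ?R ?R])
  have ij: "h \<odot> TA M (bin S i \<odot> bpr S i) (bin R j \<odot> bpr R j)
     = (h \<odot> TA M (bin S i) (bin R j)) \<odot> TA M (bpr S i) (bpr R j)"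
    if h: "h \<in> Arr A" "Dom A h = TO M ?S ?R" for h i j
    using h s r by (simp add: tensor_comp_arr)
  have i: "f \<odot> TA M (bin S i \<odot> bpr S i) (Id A ?R) = g \<odot> TA M (bin S i \<odot> bpr S i) (Id A ?R)" for i
    using dec2[OF f, of "bin S i \<odot> bpr S i"] dec2[OF g(1,2), of "bin S i \<odot> bpr S i"] s r g(3)
    by (simp add: ij[OF f] ij[OF g(1,2)] e)
  have "f \<odot> TA M (Id A ?S) (Id A ?R) = g \<odot> TA M (Id A ?S) (Id A ?R)"
    using dec[OF f, of "Id A ?R"] dec[OF g(1,2), of "Id A ?R"] s r g(3) by (simp add: i)
  then show ?thesis using f g s r by (simp add: tensor_id)
qed

lemma pre_dcx_tens:
  assumes "X \<in> Obj Ch" "Y \<in> Obj Ch"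
  shows "pre_dcx A (tens_dcx A M X Y)"
proof -
  note x = ch_obj[OF assms(1)] and y = ch_obj[OF assms(2)]
  obtain N where N: "vanishes_below A N X" using x(6) by blast
  obtain K where K: "vanishes_below A K Y" using y(6) by blast
  have "is_zero_obj A (TO M (cob X p) (cob Y q))" if "p < min N K \<or> q < min N K" for p q
    using that N K x(1) y(1) by (auto simp: vanishes_below_def intro: tensor_zero_obj)
  then have "dcx_bounded_below A (tens_dcx A M X Y)"
    unfolding dcx_bounded_below_def by (auto simp: tens_dcx_def intro!: exI[of _ "min N K"])
  then show ?thesis using x(1-4) y(1-4)
    unfolding pre_dcx_def by (simp add: tens_dcx_def mem_Hom)
qed

lemma dob_tens [simp]: "dob (tens_dcx A M X Y) p q = TO M (cob X p) (cob Y q)"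
  by (simp add: tens_dcx_def)

lemma TA_ch: "TA (ch_tensor A M) f g = tot_map A (tens_dcx A M (src f) (src g)) (tens_dcx A M (tgt f) (tgt g))
              (\<lambda>p q. TA M (dat f p) (dat g q))"
  by (simp add: ch_tensor_def Let_def)

lemma TO_ch: "TO (ch_tensor A M) X Y = tot A (tens_dcx A M X Y)"
  by (simp add: ch_tensor_def Let_def tens_def)

lemma tens_map:
  assumes f: "f \<in> Arr Ch" and g: "g \<in> Arr Ch"
  shows "dcx_map A (tens_dcx A M (Dom Ch f) (Dom Ch g)) (tens_dcx A M (Cod Ch f) (Cod Ch g))
    (\<lambda>p q. TA M (dat f p) (dat g q))"
proof -
  have o: "Dom Ch f \<in> Obj Ch" "Cod Ch f \<in> Obj Ch" "Dom Ch g \<in> Obj Ch" "Cod Ch g \<in> Obj Ch"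
    using f g by (simp_all add: ch_cat_simps(2-4))
  note oo = o[THEN ch_obj(1)] o[THEN ch_obj(2)] o[THEN ch_obj(3)] o[THEN ch_obj(4)]
  note ff = ch_arr[OF f] and gg = ch_arr[OF g]
  show ?thesis
    unfolding dcx_map_def dcx_hom_def
    using ff(1-3) gg(1-3) oo by (simp add: mem_Hom tens_dcx_def tensor_comp_arr ff(4) gg(4))
qed

lemma TA_ch_simps:
  assumes f: "f \<in> Arr Ch" and g: "g \<in> Arr Ch"
  shows "dat (TA (ch_tensor A M) f g) n \<in> Arr A"
    "Dom A (dat (TA (ch_tensor A M) f g) n) = bob (tsum A (tens_dcx A M (Dom Ch f) (Dom Ch g)) n)"
    "Cod A (dat (TA (ch_tensor A M) f g) n) = bob (tsum A (tens_dcx A M (Cod Ch f) (Cod Ch g)) n)"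
    "dat (TA (ch_tensor A M) f g) n \<odot> tens_in A M (Dom Ch f) (Dom Ch g) n p
      = tens_in A M (Cod Ch f) (Cod Ch g) n p \<odot> TA M (dat f p) (dat g (n - p))"
proof -
  have o: "Dom Ch f \<in> Obj Ch" "Cod Ch f \<in> Obj Ch" "Dom Ch g \<in> Obj Ch" "Cod Ch g \<in> Obj Ch"
    using f g by (simp_all add: ch_cat_simps(2-4))
  have h: "dcx_hom A (tens_dcx A M (Dom Ch f) (Dom Ch g)) (tens_dcx A M (Cod Ch f) (Cod Ch g))
    (\<lambda>p q. TA M (dat f p) (dat g q))" using tens_map[OF f g] by (simp add: dcx_map_def)
  note t = tot_map_simps[OF pre_dcx_tens[OF o(1,3)] pre_dcx_tens[OF o(2,4)] h, unfolded ch_cat_simps(3,4)]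
  show "dat (TA (ch_tensor A M) f g) n \<in> Arr A"
    "Dom A (dat (TA (ch_tensor A M) f g) n) = bob (tsum A (tens_dcx A M (Dom Ch f) (Dom Ch g)) n)"
    "Cod A (dat (TA (ch_tensor A M) f g) n) = bob (tsum A (tens_dcx A M (Cod Ch f) (Cod Ch g)) n)"
    "dat (TA (ch_tensor A M) f g) n \<odot> tens_in A M (Dom Ch f) (Dom Ch g) n p
      = tens_in A M (Cod Ch f) (Cod Ch g) n p \<odot> TA M (dat f p) (dat g (n - p))"
    unfolding TA_ch ch_cat_simps(3,4) tens_in_def using t by simp_all
qed

text \<open>That the two tensor products are complexes is a hypothesis. Wherever the lemma is
  applied they are sources of Kuenneth morphisms, which settles the matter.\<close>

lemma TA_ch_hom:
  assumes f: "f \<in> Arr Ch" and g: "g \<in> Arr Ch"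
    and o: "TO (ch_tensor A M) (Dom Ch f) (Dom Ch g) \<in> Obj Ch" "TO (ch_tensor A M) (Cod Ch f) (Cod Ch g) \<in> Obj Ch"
  shows "TA (ch_tensor A M) f g \<in> Hom Ch (TO (ch_tensor A M) (Dom Ch f) (Dom Ch g)) (TO (ch_tensor A M) (Cod Ch f) (Cod Ch g))"
proof (rule ch_homI)
  have ob: "Dom Ch f \<in> Obj Ch" "Cod Ch f \<in> Obj Ch" "Dom Ch g \<in> Obj Ch" "Cod Ch g \<in> Obj Ch"
    using f g by (simp_all add: ch_cat_simps(2-4))
  show "cdf (TO (ch_tensor A M) (Cod Ch f) (Cod Ch g)) n \<odot> dat (TA (ch_tensor A M) f g) n =
         dat (TA (ch_tensor A M) f g) (n + 1) \<odot> cdf (TO (ch_tensor A M) (Dom Ch f) (Dom Ch g)) n" for n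
    using tot_map_chain[OF pre_dcx_tens[OF ob(1,3)] pre_dcx_tens[OF ob(2,4)] tens_map[OF f g]]
    unfolding TO_ch TA_ch ch_cat_simps(3,4) .
qed (use o TA_ch_simps[OF f g] in \<open>simp_all add: TO_ch TA_ch mem_Hom ch_cat_simps(3,4)\<close>)

lemma TA_ch_comp:
  assumes f: "f \<in> Arr Ch" "f' \<in> Arr Ch" "Dom Ch f' = Cod Ch f" and g: "g \<in> Arr Ch" "g' \<in> Arr Ch" "Dom Ch g' = Cod Ch g"
  shows "TA (ch_tensor A M) f' g' \<cdot>\<^bsub>Ch\<^esub> TA (ch_tensor A M) f g = TA (ch_tensor A M) (f' \<cdot>\<^bsub>Ch\<^esub> f) (g' \<cdot>\<^bsub>Ch\<^esub> g)"
proof -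
  have o: "Dom Ch f \<in> Obj Ch" "Cod Ch f \<in> Obj Ch" "Dom Ch g \<in> Obj Ch" "Cod Ch g \<in> Obj Ch"
    "Cod Ch f' \<in> Obj Ch" "Cod Ch g' \<in> Obj Ch"
    using f g by (simp_all add: ch_cat_simps(2-4))
  have h: "dcx_hom A (tens_dcx A M (Dom Ch f) (Dom Ch g)) (tens_dcx A M (Cod Ch f) (Cod Ch g))
    (\<lambda>p q. TA M (dat f p) (dat g q))"
    "dcx_hom A (tens_dcx A M (Cod Ch f) (Cod Ch g)) (tens_dcx A M (Cod Ch f') (Cod Ch g'))
    (\<lambda>p q. TA M (dat f' p) (dat g' q))"
    using tens_map[OF f(1) g(1)] tens_map[OF f(2) g(2)] f(3) g(3) by (simp_all add: dcx_map_def)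
  have "dat (TA (ch_tensor A M) f' g') n \<odot> dat (TA (ch_tensor A M) f g) n = dat (TA (ch_tensor A M) (f' \<cdot>\<^bsub>Ch\<^esub> f) (g' \<cdot>\<^bsub>Ch\<^esub> g)) n" for n
  proof -
    have "TA M (dat (f' \<cdot>\<^bsub>Ch\<^esub> f) p) (dat (g' \<cdot>\<^bsub>Ch\<^esub> g) q) = TA M (dat f' p) (dat g' q) \<odot> TA M (dat f p) (dat g q)" for p q
      using ch_arr(1-3)[OF f(1)] ch_arr(1-3)[OF f(2)] ch_arr(1-3)[OF g(1)] ch_arr(1-3)[OF g(2)] f(3) g(3)
      by (simp add: tensor_comp_arr)
    from tot_map_comp[OF pre_dcx_tens[OF o(1,3)] pre_dcx_tens[OF o(2,4)] pre_dcx_tens[OF o(5,6)] h this, of n]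
    show ?thesis using f(3) g(3) by (simp add: TA_ch ch_cat_simps(3,4) ch_comp)
  qed
  then show ?thesis using f(3) g(3) by (simp add: prod_eq_iff fun_eq_iff ch_comp TA_ch)
qed

lemma TA_ch_id:
  assumes "X \<in> Obj Ch" "Y \<in> Obj Ch"
  shows "TA (ch_tensor A M) (Id Ch X) (Id Ch Y) = Id Ch (TO (ch_tensor A M) X Y)"
  using assms tot_map_id[OF pre_dcx_tens[OF assms], of "\<lambda>p q. TA M (Id A (cob X p)) (Id A (cob Y q))"]
  by (simp add: prod_eq_iff fun_eq_iff TA_ch TO_ch ch_id tensor_id ch_obj)

end

section \<open>The standard construction of a monad\<close>

locale monad = category D
  for D :: "('x, 'y, 'z) cat_scheme" +
  fixes T :: "'x \<Rightarrow> 'x" and Tm :: "'y \<Rightarrow> 'y" and \<eta> \<mu> :: "'x \<Rightarrow> 'y"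
  assumes T_obj [simp]: "K \<in> Obj D \<Longrightarrow> T K \<in> Obj D"
    and T_arr [simp]: "f \<in> Arr D \<Longrightarrow> Tm f \<in> Arr D" "f \<in> Arr D \<Longrightarrow> Dom D (Tm f) = T (Dom D f)"
      "f \<in> Arr D \<Longrightarrow> Cod D (Tm f) = T (Cod D f)"
    and T_id [simp]: "K \<in> Obj D \<Longrightarrow> Tm (Id D K) = Id D (T K)"
    and T_comp: "\<lbrakk>f \<in> Arr D; g \<in> Arr D; Dom D g = Cod D f\<rbrakk> \<Longrightarrow> Tm (g \<cdot>\<^bsub>D\<^esub> f) = Tm g \<cdot>\<^bsub>D\<^esub> Tm f"
    and unit_arr [simp]: "K \<in> Obj D \<Longrightarrow> \<eta> K \<in> Arr D" "K \<in> Obj D \<Longrightarrow> Dom D (\<eta> K) = K"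
      "K \<in> Obj D \<Longrightarrow> Cod D (\<eta> K) = T K"
    and mult_arr [simp]: "K \<in> Obj D \<Longrightarrow> \<mu> K \<in> Arr D" "K \<in> Obj D \<Longrightarrow> Dom D (\<mu> K) = T (T K)"
      "K \<in> Obj D \<Longrightarrow> Cod D (\<mu> K) = T K"
    and unit_nat: "f \<in> Arr D \<Longrightarrow> Tm f \<cdot>\<^bsub>D\<^esub> \<eta> (Dom D f) = \<eta> (Cod D f) \<cdot>\<^bsub>D\<^esub> f"
    and mult_nat: "f \<in> Arr D \<Longrightarrow> Tm f \<cdot>\<^bsub>D\<^esub> \<mu> (Dom D f) = \<mu> (Cod D f) \<cdot>\<^bsub>D\<^esub> Tm (Tm f)"
    and mult_unit: "K \<in> Obj D \<Longrightarrow> \<mu> K \<cdot>\<^bsub>D\<^esub> \<eta> (T K) = Id D (T K)"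
      "K \<in> Obj D \<Longrightarrow> \<mu> K \<cdot>\<^bsub>D\<^esub> Tm (\<eta> K) = Id D (T K)"
    and mult_assoc: "K \<in> Obj D \<Longrightarrow> \<mu> K \<cdot>\<^bsub>D\<^esub> Tm (\<mu> K) = \<mu> K \<cdot>\<^bsub>D\<^esub> \<mu> (T K)"
begin

lemma Tpow_obj [simp]: "K \<in> Obj D \<Longrightarrow> (T ^^ n) K \<in> Obj D"
  by (induction n) simp_all

lemma Tmpow_arr [simp]:
  assumes "f \<in> Arr D"
  shows "(Tm ^^ n) f \<in> Arr D" "Dom D ((Tm ^^ n) f) = (T ^^ n) (Dom D f)"
    "Cod D ((Tm ^^ n) f) = (T ^^ n) (Cod D f)"
  using assms by (induction n) simp_all

lemma Tmpow_id: "K \<in> Obj D \<Longrightarrow> (Tm ^^ n) (Id D K) = Id D ((T ^^ n) K)"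
  by (induction n) simp_all

lemma Tmpow_comp:
  assumes "f \<in> Arr D" "g \<in> Arr D" "Dom D g = Cod D f"
  shows "(Tm ^^ n) (g \<cdot>\<^bsub>D\<^esub> f) = (Tm ^^ n) g \<cdot>\<^bsub>D\<^esub> (Tm ^^ n) f"
  using assms by (induction n) (simp_all add: T_comp)

lemma pow_add: "(T ^^ i) ((T ^^ j) K) = (T ^^ (i + j)) K" "(Tm ^^ i) ((Tm ^^ j) f) = (Tm ^^ (i + j)) f"
  by (simp_all add: funpow_add)

text \<open>These equations fold iterates into a single power, and are used without
  \<open>funpow.simps\<close>, which would unfold them again.\<close>

lemma pow_Suc: "T ((T ^^ j) K) = (T ^^ (Suc j)) K" "Tm ((Tm ^^ j) f) = (Tm ^^ (Suc j)) f"
  by simp_all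

lemma pow_Suc_swap: "(T ^^ j) (T K) = (T ^^ (Suc j)) K" "(Tm ^^ j) (Tm f) = (Tm ^^ (Suc j)) f"
  by (simp_all add: funpow_swap1)

definition std :: "'x \<Rightarrow> ('x, 'y) cosimp" where
  "std K = \<lparr>cso = (\<lambda>n. (T ^^ (n + 1)) K),
     cface = (\<lambda>n i. (Tm ^^ i) (\<eta> ((T ^^ (n + 1 - i)) K))),
     cdeg = (\<lambda>n i. (Tm ^^ i) (\<mu> ((T ^^ (n - i)) K)))\<rparr>"

text \<open>Each cosimplicial identity is a power of \<open>T\<close> applied to one law: naturality
  of \<eta> or \<mu>, a unit law, or associativity. A larger index is written as the smaller one
  plus a rest, and \<open>m\<close> counts the copies of \<open>T\<close> that remain inside; this
  turns the truncated subtractions into sums.\<close>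

lemma std_cosimplicial:
  assumes K: "K \<in> Obj D"
  shows "is_cosimplicial D (std K)"
  unfolding is_cosimplicial_def
proof (intro conjI allI impI)
  let ?O = "\<lambda>n. (T ^^ n) K"
  have O [simp]: "?O n \<in> Obj D" for n using K by simp
  fix n i j :: nat
  show "cso (std K) n \<in> Obj D" using K by (simp add: std_def)
  show "cface (std K) n i \<in> Hom D (cso (std K) n) (cso (std K) (n + 1))" if "i \<le> n + 1"
    using K that by (simp add: std_def mem_Hom pow_add pow_Suc pow_Suc_swap del: funpow.simps)
  show "cdeg (std K) n i \<in> Hom D (cso (std K) (n + 1)) (cso (std K) n)" if "i \<le> n"
    using K that by (simp add: std_def mem_Hom pow_add pow_Suc pow_Suc_swap del: funpow.simps)
  show "cface (std K) (n + 1) j \<cdot>\<^bsub>D\<^esub> cface (std K) n i = cface (std K) (n + 1) i \<cdot>\<^bsub>D\<^esub> cface (std K) n (j - 1)"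
    if "i < j \<and> j \<le> n + 2"
  proof -
    from that obtain k where k: "j = i + Suc k" using less_iff_Suc_add by auto
    define m where "m = n + 2 - j"
    have n: "n + 1 - i = k + m" "n + 1 + 1 - j = m" "n + 1 + 1 - i = Suc (k + m)" "n + 1 - (i + k) = m" "j - 1 = i + k"
      using that k by (auto simp: m_def)
    let ?x = "(Tm ^^ k) (\<eta> (?O m))"
    have x: "?x \<in> Arr D" "Dom D ?x = ?O (k + m)" "Cod D ?x = ?O (Suc (k + m))"
      using K by (simp_all add: pow_add pow_Suc pow_Suc_swap del: funpow.simps)
    have "(Tm ^^ i) (Tm ?x) \<cdot>\<^bsub>D\<^esub> (Tm ^^ i) (\<eta> (?O (k + m))) = (Tm ^^ i) (\<eta> (?O (Suc (k + m)))) \<cdot>\<^bsub>D\<^esub> (Tm ^^ i) ?x"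
      using Tmpow_comp[of "\<eta> (?O (k + m))" "Tm ?x" i] Tmpow_comp[of ?x "\<eta> (?O (Suc (k + m)))" i] unit_nat[OF x(1)] x O
      by (simp del: funpow.simps)
    then show ?thesis
      unfolding std_def cosimp.simps n unfolding k by (simp only: pow_add pow_Suc)
  qed
  show "cdeg (std K) n j \<cdot>\<^bsub>D\<^esub> cdeg (std K) (n + 1) i = cdeg (std K) n i \<cdot>\<^bsub>D\<^esub> cdeg (std K) (n + 1) (j + 1)"
    if "i \<le> j \<and> j \<le> n"
  proof -
    from that obtain k where k: "j = i + k" using le_Suc_ex by blast
    define m where "m = n - j"
    have n: "n + 1 - i = Suc (k + m)" "n - j = m" "n - i = k + m" "n + 1 - (i + Suc k) = m" "j + 1 = i + Suc k"
      using that k by (auto simp: m_def)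
    have "(Tm ^^ k) (\<mu> (?O m)) \<cdot>\<^bsub>D\<^esub> \<mu> (?O (Suc (k + m))) = \<mu> (?O (k + m)) \<cdot>\<^bsub>D\<^esub> (Tm ^^ (Suc k)) (\<mu> (?O m))"
    \<comment> \<open>Equal indices call for associativity of \<mu>; for distinct indices naturality
      of \<mu> is enough.\<close>
    proof (cases k)
      case 0
      then show ?thesis using mult_assoc[OF O[of m]] by simp
    next
      case (Suc k')
      let ?x = "(Tm ^^ k') (\<mu> (?O m))"
      have x: "?x \<in> Arr D" "Dom D ?x = ?O (Suc (Suc (k' + m)))" "Cod D ?x = ?O (Suc (k' + m))"
        using K by (simp_all add: pow_add pow_Suc pow_Suc_swap del: funpow.simps)
      show ?thesis
        using mult_nat[OF x(1)] unfolding x Suc by (simp only: pow_add pow_Suc add_Suc)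
    qed
    moreover have "\<mu> (?O (Suc (k + m))) \<in> Arr D" "Dom D ((Tm ^^ k) (\<mu> (?O m))) = Cod D (\<mu> (?O (Suc (k + m))))"
      "Dom D (\<mu> (?O (k + m))) = Cod D ((Tm ^^ (Suc k)) (\<mu> (?O m)))"
      using K by (simp_all add: pow_add pow_Suc pow_Suc_swap del: funpow.simps)
    ultimately have "(Tm ^^ i) ((Tm ^^ k) (\<mu> (?O m))) \<cdot>\<^bsub>D\<^esub> (Tm ^^ i) (\<mu> (?O (Suc (k + m))))
       = (Tm ^^ i) (\<mu> (?O (k + m))) \<cdot>\<^bsub>D\<^esub> (Tm ^^ i) ((Tm ^^ (Suc k)) (\<mu> (?O m)))"
      using Tmpow_comp[of "\<mu> (?O (Suc (k + m)))" "(Tm ^^ k) (\<mu> (?O m))" i]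
        Tmpow_comp[of "(Tm ^^ (Suc k)) (\<mu> (?O m))" "\<mu> (?O (k + m))" i] O by (simp del: funpow.simps)
    then show ?thesis
      unfolding std_def cosimp.simps n unfolding k by (simp only: pow_add pow_Suc)
  qed
  show "cdeg (std K) (n + 1) j \<cdot>\<^bsub>D\<^esub> cface (std K) (n + 1) i = cface (std K) n i \<cdot>\<^bsub>D\<^esub> cdeg (std K) n (j - 1)"
    if "i < j \<and> j \<le> n + 1"
  proof -
    from that obtain k where k: "j = i + Suc k" using less_iff_Suc_add by auto
    define m where "m = n + 1 - j"
    have n: "n + 1 - j = m" "n + 1 + 1 - i = Suc (Suc (k + m))" "n + 1 - i = Suc (k + m)" "n - (i + k) = m" "j - 1 = i + k"
      using that k by (auto simp: m_def)
    let ?x = "(Tm ^^ k) (\<mu> (?O m))"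
    have x: "?x \<in> Arr D" "Dom D ?x = ?O (Suc (Suc (k + m)))" "Cod D ?x = ?O (Suc (k + m))"
      using K by (simp_all add: pow_add pow_Suc pow_Suc_swap del: funpow.simps)
    have "(Tm ^^ i) (Tm ?x) \<cdot>\<^bsub>D\<^esub> (Tm ^^ i) (\<eta> (?O (Suc (Suc (k + m))))) = (Tm ^^ i) (\<eta> (?O (Suc (k + m)))) \<cdot>\<^bsub>D\<^esub> (Tm ^^ i) ?x"
      using Tmpow_comp[of "\<eta> (?O (Suc (Suc (k + m))))" "Tm ?x" i] Tmpow_comp[of ?x "\<eta> (?O (Suc (k + m)))" i] unit_nat[OF x(1)] x O
      by (simp del: funpow.simps)
    then show ?thesis
      unfolding std_def cosimp.simps n unfolding k by (simp only: pow_add pow_Suc)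
  qed
  show "cdeg (std K) n i \<cdot>\<^bsub>D\<^esub> cface (std K) n i = Id D (cso (std K) n)"
    "cdeg (std K) n i \<cdot>\<^bsub>D\<^esub> cface (std K) n (i + 1) = Id D (cso (std K) n)" if "i \<le> n"
  proof -
    define m where "m = n - i"
    have n: "i + Suc m - i = Suc m" "n - i = m" "i + Suc m - (i + 1) = m" "n + 1 = i + Suc m"
      using that by (auto simp: m_def)
    have t: "?O (Suc m) = T (?O m)" by simp
    have "(Tm ^^ i) (\<mu> (?O m)) \<cdot>\<^bsub>D\<^esub> (Tm ^^ i) (\<eta> (?O (Suc m))) = Id D ((T ^^ i) (?O (Suc m)))"
      unfolding t using O[of m] by (subst Tmpow_comp[symmetric]) (simp_all add: mult_unit Tmpow_id)
    then show "cdeg (std K) n i \<cdot>\<^bsub>D\<^esub> cface (std K) n i = Id D (cso (std K) n)"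
      unfolding std_def cosimp.simps n by (simp only: pow_add)
    have "(Tm ^^ i) (\<mu> (?O m)) \<cdot>\<^bsub>D\<^esub> (Tm ^^ i) (Tm (\<eta> (?O m))) = Id D ((T ^^ i) (?O (Suc m)))"
      unfolding t using O[of m] by (subst Tmpow_comp[symmetric]) (simp_all add: mult_unit Tmpow_id)
    then show "cdeg (std K) n i \<cdot>\<^bsub>D\<^esub> cface (std K) n (i + 1) = Id D (cso (std K) n)"
      unfolding std_def cosimp.simps n by (simp only: pow_add pow_Suc_swap Suc_eq_plus1)
  qed
  show "cdeg (std K) (n + 1) j \<cdot>\<^bsub>D\<^esub> cface (std K) (n + 1) i = cface (std K) n (i - 1) \<cdot>\<^bsub>D\<^esub> cdeg (std K) n j"
    if "j + 1 < i \<and> i \<le> n + 2"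
  proof -
    from that obtain k where k: "i = j + Suc (Suc k)" using less_iff_Suc_add by auto
    define m where "m = n + 2 - i"
    have n: "n + 1 - j = Suc (k + m)" "n + 1 + 1 - i = m" "n - j = k + m" "n + 1 - (j + Suc k) = m" "i - 1 = j + Suc k"
      using that k by (auto simp: m_def)
    let ?x = "(Tm ^^ k) (\<eta> (?O m))"
    have x: "?x \<in> Arr D" "Dom D ?x = ?O (k + m)" "Cod D ?x = ?O (Suc (k + m))"
      using K by (simp_all add: pow_add pow_Suc pow_Suc_swap del: funpow.simps)
    have "(Tm ^^ j) (\<mu> (?O (Suc (k + m)))) \<cdot>\<^bsub>D\<^esub> (Tm ^^ j) (Tm (Tm ?x)) = (Tm ^^ j) (Tm ?x) \<cdot>\<^bsub>D\<^esub> (Tm ^^ j) (\<mu> (?O (k + m)))"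
      using Tmpow_comp[of "Tm (Tm ?x)" "\<mu> (?O (Suc (k + m)))" j] Tmpow_comp[of "\<mu> (?O (k + m))" "Tm ?x" j] mult_nat[OF x(1)] x O
      by (simp del: funpow.simps)
    then show ?thesis
      unfolding std_def cosimp.simps n unfolding k by (simp only: pow_add pow_Suc)
  qed
qed

text \<open>Splitting off the outer \<open>i\<close> copies of \<open>T\<close> turns each square
  into the image of a naturality square of \<eta> or \<mu> at an iterate of
  \<open>f\<close>.\<close>

lemma std_map:
  assumes f: "f \<in> Arr D"
  shows "is_cosimp_map D (std (Dom D f)) (std (Cod D f)) (\<lambda>n. (Tm ^^ (n + 1)) f)"
  unfolding is_cosimp_map_def
proof (intro conjI allI impI)
  let ?K = "Dom D f" and ?L = "Cod D f"
  fix n i :: nat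
  show "is_cosimplicial D (std ?K)" "is_cosimplicial D (std ?L)" using f by (simp_all add: std_cosimplicial)
  show "(Tm ^^ (n + 1)) f \<in> Hom D (cso (std ?K) n) (cso (std ?L) n)"
    using f by (simp add: mem_Hom std_def)
  show "(Tm ^^ (n + 1 + 1)) f \<cdot>\<^bsub>D\<^esub> cface (std ?K) n i = cface (std ?L) n i \<cdot>\<^bsub>D\<^esub> (Tm ^^ (n + 1)) f"
    if "i \<le> n + 1"
  proof -
    define m where "m = n + 1 - i"
    have n: "n + 1 + 1 = i + Suc m" "n + 1 = i + m" "i + m - i = m" using that by (auto simp: m_def)
    let ?x = "(Tm ^^ m) f"
    have x: "?x \<in> Arr D" "Dom D ?x = (T ^^ m) ?K" "Cod D ?x = (T ^^ m) ?L" using f by simp_all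
    have o: "(T ^^ m) ?K \<in> Obj D" "(T ^^ m) ?L \<in> Obj D" using f by simp_all
    have "(Tm ^^ i) (Tm ?x) \<cdot>\<^bsub>D\<^esub> (Tm ^^ i) (\<eta> ((T ^^ m) ?K)) = (Tm ^^ i) (\<eta> ((T ^^ m) ?L)) \<cdot>\<^bsub>D\<^esub> (Tm ^^ i) ?x"
      using Tmpow_comp[of "\<eta> ((T ^^ m) ?K)" "Tm ?x" i] Tmpow_comp[of ?x "\<eta> ((T ^^ m) ?L)" i] unit_nat[OF x(1)] x o
      by (simp del: funpow.simps)
    then show ?thesis
      unfolding std_def cosimp.simps n by (simp only: pow_add pow_Suc Suc_eq_plus1 add.assoc)
  qed
  show "(Tm ^^ (n + 1)) f \<cdot>\<^bsub>D\<^esub> cdeg (std ?K) n i = cdeg (std ?L) n i \<cdot>\<^bsub>D\<^esub> (Tm ^^ (n + 1 + 1)) f"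
    if "i \<le> n"
  proof -
    define m where "m = n - i"
    have n: "n + 1 + 1 = i + Suc (Suc m)" "n + 1 = i + Suc m" "n - i = m" using that by (auto simp: m_def)
    let ?x = "(Tm ^^ m) f"
    have x: "?x \<in> Arr D" "Dom D ?x = (T ^^ m) ?K" "Cod D ?x = (T ^^ m) ?L" using f by simp_all
    have o: "(T ^^ m) ?K \<in> Obj D" "(T ^^ m) ?L \<in> Obj D" using f by simp_all
    have "(Tm ^^ i) (Tm ?x) \<cdot>\<^bsub>D\<^esub> (Tm ^^ i) (\<mu> ((T ^^ m) ?K)) = (Tm ^^ i) (\<mu> ((T ^^ m) ?L)) \<cdot>\<^bsub>D\<^esub> (Tm ^^ i) (Tm (Tm ?x))"
      using Tmpow_comp[of "\<mu> ((T ^^ m) ?K)" "Tm ?x" i] Tmpow_comp[of "Tm (Tm ?x)" "\<mu> ((T ^^ m) ?L)" i] mult_nat[OF x(1)] x o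
      by (simp del: funpow.simps)
    then show ?thesis
      unfolding std_def cosimp.simps n by (simp only: pow_add pow_Suc Suc_eq_plus1 add.assoc)
  qed
qed

end

section \<open>Monoidal functors with values in complexes\<close>

lemma op_cat_simps [simp]:
  "Obj (op_cat C) = Obj C" "Arr (op_cat C) = Arr C" "Dom (op_cat C) = Cod C" "Cod (op_cat C) = Dom C"
  "Id (op_cat C) = Id C" "g \<cdot>\<^bsub>op_cat C\<^esub> f = f \<cdot>\<^bsub>C\<^esub> g"
  by (simp_all add: op_cat_def)

lemma Hom_op_cat [simp]: "Hom (op_cat C) X Y = Hom C Y X"
  by (auto simp: Hom_def)

lemma op_tensor_simps [simp]:
  "TO (op_tensor C M) = TO M" "TA (op_tensor C M) = TA M" "TU (op_tensor C M) = TU M"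
  by (simp_all add: op_tensor_def)

lemma mon_ch_simps:
  "Obj (mon_ch C MC A MA) = {K. is_mfunctor (op_cat C) (op_tensor C MC) (ch_cat A) (ch_tensor A MA) K \<and>
     (\<exists>N. vanishes_below_on C A N K)}"
  "a \<in> Arr (mon_ch C MC A MA) \<longleftrightarrow> src a \<in> Obj (mon_ch C MC A MA) \<and> tgt a \<in> Obj (mon_ch C MC A MA) \<and>
     is_mnat (op_cat C) (op_tensor C MC) (ch_cat A) (ch_tensor A MA) (src a) (tgt a) (dat a)"
  "Dom (mon_ch C MC A MA) a = src a" "Cod (mon_ch C MC A MA) a = tgt a"
  by (auto simp: mon_ch_def full_sub_def mon_cat_def split: prod.splits)

lemma mon_ch_comp: "b \<cdot>\<^bsub>mon_ch C MC A MA\<^esub> a = (src a, tgt b, \<lambda>X \<in> Obj C. dat b X \<cdot>\<^bsub>ch_cat A\<^esub> dat a X)"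
  by (simp add: mon_ch_def full_sub_def mon_cat_def)

lemma mon_ch_id: "Id (mon_ch C MC A MA) K = (K, K, \<lambda>X \<in> Obj C. Id (ch_cat A) (FO K X))"
  by (simp add: mon_ch_def full_sub_def mon_cat_def)

locale mon_setting = C: monoidal_category C MC + A: abelian_monoidal_category A MA
  for C :: "('o, 'm, 'y) cat_scheme" and MC :: "('o, 'm) tensor"
    and A :: "('p, 'n, 'z) acat_scheme" and MA :: "('p, 'n) tensor"
begin

sublocale Ch: category "ch_cat A" by (rule A.category_ch)

abbreviation "Ch \<equiv> ch_cat A"
abbreviation "N \<equiv> ch_tensor A MA"
abbreviation "D \<equiv> mon_ch C MC A MA"

lemma C_tensor_arr [simp]:
  assumes "f \<in> Arr C" "g \<in> Arr C"
  shows "TA MC f g \<in> Arr C" "Dom C (TA MC f g) = TO MC (Dom C f) (Dom C g)"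
    "Cod C (TA MC f g) = TO MC (Cod C f) (Cod C g)"
  using C.tensor_hom[of f "Dom C f" "Cod C f" g "Dom C g" "Cod C g"] assms by (auto simp: mem_Hom)

lemmas C_tensor_obj [simp] = C.tensor_obj C.unit_obj

lemma D_obj [simp]:
  assumes "K \<in> Obj D"
  shows "X \<in> Obj C \<Longrightarrow> FO K X \<in> Obj Ch"
    "f \<in> Arr C \<Longrightarrow> FM K f \<in> Arr Ch" "f \<in> Arr C \<Longrightarrow> Dom Ch (FM K f) = FO K (Cod C f)"
    "f \<in> Arr C \<Longrightarrow> Cod Ch (FM K f) = FO K (Dom C f)"
    "X \<in> Obj C \<Longrightarrow> FM K (Id C X) = Id Ch (FO K X)"
    "X \<in> Obj C \<Longrightarrow> Y \<in> Obj C \<Longrightarrow> FK K X Y \<in> Arr Ch"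
    "X \<in> Obj C \<Longrightarrow> Y \<in> Obj C \<Longrightarrow> Dom Ch (FK K X Y) = TO N (FO K X) (FO K Y)"
    "X \<in> Obj C \<Longrightarrow> Y \<in> Obj C \<Longrightarrow> Cod Ch (FK K X Y) = FO K (TO MC X Y)"
    "X \<in> Obj C \<Longrightarrow> Y \<in> Obj C \<Longrightarrow> TO N (FO K X) (FO K Y) \<in> Obj Ch"
    "FU K \<in> Arr Ch" "Dom Ch (FU K) = TU N" "Cod Ch (FU K) = FO K (TU MC)"
proof -
  have m: "is_mfunctor (op_cat C) (op_tensor C MC) Ch N K" using assms by (simp add: mon_ch_simps)
  show *: "FO K X \<in> Obj Ch" if "X \<in> Obj C" using that m by (simp add: is_mfunctor_def is_functor_def)
  show "FM K f \<in> Arr Ch" "Dom Ch (FM K f) = FO K (Cod C f)" "Cod Ch (FM K f) = FO K (Dom C f)"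
    if "f \<in> Arr C" using that m by (simp_all add: is_mfunctor_def is_functor_def mem_Hom)
  show "FM K (Id C X) = Id Ch (FO K X)" if "X \<in> Obj C" using that m by (simp add: is_mfunctor_def is_functor_def)
  show k: "FK K X Y \<in> Arr Ch" "Dom Ch (FK K X Y) = TO N (FO K X) (FO K Y)" "Cod Ch (FK K X Y) = FO K (TO MC X Y)"
    if "X \<in> Obj C" "Y \<in> Obj C" using that m by (simp_all add: is_mfunctor_def mem_Hom)
  \<comment> \<open>An arrow has its ends in the category. So the tensor product is a bounded below
    complex, without its differential ever being squared.\<close>
  show "TO N (FO K X) (FO K Y) \<in> Obj Ch" if "X \<in> Obj C" "Y \<in> Obj C"
    using Ch.dom_obj[OF k(1)[OF that]] k(2)[OF that] by simp
  show "FU K \<in> Arr Ch" "Dom Ch (FU K) = TU N" "Cod Ch (FU K) = FO K (TU MC)"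
    using m by (simp_all add: is_mfunctor_def mem_Hom)
qed

lemma D_obj_comp:
  assumes "K \<in> Obj D" "f \<in> Arr C" "g \<in> Arr C" "Dom C g = Cod C f"
  shows "FM K (g \<cdot>\<^bsub>C\<^esub> f) = FM K f \<cdot>\<^bsub>Ch\<^esub> FM K g"
proof -
  have "is_functor (op_cat C) Ch K" using assms by (simp add: mon_ch_simps is_mfunctor_def)
  then show ?thesis using assms(2-4) by (simp add: is_functor_def)
qed

lemma FK_nat:
  assumes "K \<in> Obj D" "f \<in> Arr C" "g \<in> Arr C"
  shows "FK K (Dom C f) (Dom C g) \<cdot>\<^bsub>Ch\<^esub> TA N (FM K f) (FM K g) = FM K (TA MC f g) \<cdot>\<^bsub>Ch\<^esub> FK K (Cod C f) (Cod C g)"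
proof -
  have "is_mfunctor (op_cat C) (op_tensor C MC) Ch N K" using assms by (simp add: mon_ch_simps)
  then show ?thesis using assms(2,3) by (simp add: is_mfunctor_def)
qed

lemma TA_arr [simp]:
  assumes "f \<in> Arr Ch" "g \<in> Arr Ch"
    and "TO N (Dom Ch f) (Dom Ch g) \<in> Obj Ch" "TO N (Cod Ch f) (Cod Ch g) \<in> Obj Ch"
  shows "TA N f g \<in> Arr Ch" "Dom Ch (TA N f g) = TO N (Dom Ch f) (Dom Ch g)"
    "Cod Ch (TA N f g) = TO N (Cod Ch f) (Cod Ch g)"
  using A.TA_ch_hom[OF assms] by (simp_all add: mem_Hom)

lemma D_arr [simp]:
  assumes "a \<in> Arr D"
  shows "Dom D a \<in> Obj D" "Cod D a \<in> Obj D"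
    "X \<in> Obj C \<Longrightarrow> dat a X \<in> Arr Ch" "X \<in> Obj C \<Longrightarrow> Dom Ch (dat a X) = FO (Dom D a) X"
    "X \<in> Obj C \<Longrightarrow> Cod Ch (dat a X) = FO (Cod D a) X"
  using assms by (auto simp: mon_ch_simps(2-4) is_mnat_def is_nat_def mem_Hom)

lemma D_arr_nat:
  assumes "a \<in> Arr D" "f \<in> Arr C"
  shows "dat a (Dom C f) \<cdot>\<^bsub>Ch\<^esub> FM (Dom D a) f = FM (Cod D a) f \<cdot>\<^bsub>Ch\<^esub> dat a (Cod C f)"
  using assms by (auto simp: mon_ch_simps(2-4) is_mnat_def is_nat_def)

lemma D_arr_mon:
  assumes "a \<in> Arr D" "X \<in> Obj C" "Y \<in> Obj C"
  shows "dat a (TO MC X Y) \<cdot>\<^bsub>Ch\<^esub> FK (Dom D a) X Y = FK (Cod D a) X Y \<cdot>\<^bsub>Ch\<^esub> TA N (dat a X) (dat a Y)"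
  using assms by (auto simp: mon_ch_simps(2-4) is_mnat_def)

lemma D_arr_unit:
  assumes "a \<in> Arr D"
  shows "dat a (TU MC) \<cdot>\<^bsub>Ch\<^esub> FU (Dom D a) = FU (Cod D a)"
  using assms by (auto simp: mon_ch_simps(2-4) is_mnat_def)

lemma D_arrI:
  assumes "K \<in> Obj D" "L \<in> Obj D" "src a = K" "tgt a = L"
    and "dat a \<in> extensional (Obj C)" "\<And>X. X \<in> Obj C \<Longrightarrow> dat a X \<in> Hom Ch (FO K X) (FO L X)"
    and "\<And>f. f \<in> Arr C \<Longrightarrow> dat a (Dom C f) \<cdot>\<^bsub>Ch\<^esub> FM K f = FM L f \<cdot>\<^bsub>Ch\<^esub> dat a (Cod C f)"
    and "\<And>X Y. \<lbrakk>X \<in> Obj C; Y \<in> Obj C\<rbrakk> \<Longrightarrow>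
      dat a (TO MC X Y) \<cdot>\<^bsub>Ch\<^esub> FK K X Y = FK L X Y \<cdot>\<^bsub>Ch\<^esub> TA N (dat a X) (dat a Y)"
    and "dat a (TU MC) \<cdot>\<^bsub>Ch\<^esub> FU K = FU L"
  shows "a \<in> Arr D" "Dom D a = K" "Cod D a = L"
  using assms by (simp_all add: mon_ch_simps(2-4) is_mnat_def is_nat_def)

lemma D_ext:
  assumes "a \<in> Arr D" "b \<in> Arr D" "Dom D a = Dom D b" "Cod D a = Cod D b"
    "\<And>X. X \<in> Obj C \<Longrightarrow> dat a X = dat b X"
  shows "a = b"
proof -
  have "dat a \<in> extensional (Obj C)" "dat b \<in> extensional (Obj C)"
    using assms by (simp_all add: mon_ch_simps(2) is_mnat_def is_nat_def)
  then have "dat a = dat b" using assms(5) by (rule extensionalityI)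
  then show ?thesis using assms(3,4) by (simp add: mon_ch_simps(3,4) prod_eq_iff)
qed

lemma D_dat_comp [simp]: "X \<in> Obj C \<Longrightarrow> dat (b \<cdot>\<^bsub>D\<^esub> a) X = dat b X \<cdot>\<^bsub>Ch\<^esub> dat a X"
  by (simp add: mon_ch_comp)

lemma D_dat_id [simp]: "X \<in> Obj C \<Longrightarrow> dat (Id D K) X = Id Ch (FO K X)"
  by (simp add: mon_ch_id)

lemma D_id:
  assumes K: "K \<in> Obj D"
  shows "Id D K \<in> Arr D" "Dom D (Id D K) = K" "Cod D (Id D K) = K"
  by (rule D_arrI[OF K K, of "Id D K"]; use K in \<open>simp add: mon_ch_id mem_Hom A.TA_ch_id\<close>)+

lemma D_comp:
  assumes a: "a \<in> Arr D" and b: "b \<in> Arr D" and ab: "Dom D b = Cod D a"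
  shows "b \<cdot>\<^bsub>D\<^esub> a \<in> Arr D" "Dom D (b \<cdot>\<^bsub>D\<^esub> a) = Dom D a" "Cod D (b \<cdot>\<^bsub>D\<^esub> a) = Cod D b"
proof -
  have s: "src (b \<cdot>\<^bsub>D\<^esub> a) = Dom D a" "tgt (b \<cdot>\<^bsub>D\<^esub> a) = Cod D b" "dat (b \<cdot>\<^bsub>D\<^esub> a) \<in> extensional (Obj C)"
    by (simp_all add: mon_ch_comp mon_ch_simps(3,4))
  have h: "dat (b \<cdot>\<^bsub>D\<^esub> a) X \<in> Hom Ch (FO (Dom D a) X) (FO (Cod D b) X)" if "X \<in> Obj C" for X
    using that a b ab by (simp add: mem_Hom)
  have n: "dat (b \<cdot>\<^bsub>D\<^esub> a) (Dom C f) \<cdot>\<^bsub>Ch\<^esub> FM (Dom D a) f = FM (Cod D b) f \<cdot>\<^bsub>Ch\<^esub> dat (b \<cdot>\<^bsub>D\<^esub> a) (Cod C f)"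
    if f: "f \<in> Arr C" for f
  proof -
    have "dat b (Dom C f) \<cdot>\<^bsub>Ch\<^esub> FM (Cod D a) f \<cdot>\<^bsub>Ch\<^esub> dat a (Cod C f)
        = (FM (Cod D b) f \<cdot>\<^bsub>Ch\<^esub> dat b (Cod C f)) \<cdot>\<^bsub>Ch\<^esub> dat a (Cod C f)"
      by (rule Ch.comp_reduce) (use a b f ab D_arr_nat[OF b f] in simp_all)
    then show ?thesis using a b ab f by (simp add: D_arr_nat)
  qed
  have m: "dat (b \<cdot>\<^bsub>D\<^esub> a) (TO MC X Y) \<cdot>\<^bsub>Ch\<^esub> FK (Dom D a) X Y
      = FK (Cod D b) X Y \<cdot>\<^bsub>Ch\<^esub> TA N (dat (b \<cdot>\<^bsub>D\<^esub> a) X) (dat (b \<cdot>\<^bsub>D\<^esub> a) Y)"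
    if X: "X \<in> Obj C" "Y \<in> Obj C" for X Y
  proof -
    have "dat b (TO MC X Y) \<cdot>\<^bsub>Ch\<^esub> FK (Cod D a) X Y \<cdot>\<^bsub>Ch\<^esub> TA N (dat a X) (dat a Y)
      = (FK (Cod D b) X Y \<cdot>\<^bsub>Ch\<^esub> TA N (dat b X) (dat b Y)) \<cdot>\<^bsub>Ch\<^esub> TA N (dat a X) (dat a Y)"
      by (rule Ch.comp_reduce) (use a b ab X D_arr_mon[OF b X] in simp_all)
    then show ?thesis using a b ab X by (simp add: D_arr_mon A.TA_ch_comp)
  qed
  have u: "dat (b \<cdot>\<^bsub>D\<^esub> a) (TU MC) \<cdot>\<^bsub>Ch\<^esub> FU (Dom D a) = FU (Cod D b)"
    using a b ab D_arr_unit[OF a] D_arr_unit[OF b] by simp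
  show "b \<cdot>\<^bsub>D\<^esub> a \<in> Arr D" "Dom D (b \<cdot>\<^bsub>D\<^esub> a) = Dom D a" "Cod D (b \<cdot>\<^bsub>D\<^esub> a) = Cod D b"
    by (rule D_arrI[OF D_arr(1)[OF a] D_arr(2)[OF b] s h n m u]; assumption)+
qed

lemma category_D: "category D"
proof
  show "Id D X \<in> Hom D X X" if "X \<in> Obj D" for X using that D_id by (simp add: mem_Hom)
  show "g \<cdot>\<^bsub>D\<^esub> f \<in> Hom D X Z" if "f \<in> Hom D X Y" "g \<in> Hom D Y Z" for f g X Y Z
    using that D_comp by (simp add: mem_Hom)
  show "Id D Y \<cdot>\<^bsub>D\<^esub> f = f" "f \<cdot>\<^bsub>D\<^esub> Id D X = f" if "f \<in> Hom D X Y" for f X Y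
    using that by (auto intro!: D_ext simp: mem_Hom D_comp D_id)
  show "(h \<cdot>\<^bsub>D\<^esub> g) \<cdot>\<^bsub>D\<^esub> f = h \<cdot>\<^bsub>D\<^esub> (g \<cdot>\<^bsub>D\<^esub> f)"
    if "f \<in> Hom D X Y" "g \<in> Hom D Y Z" "h \<in> Hom D Z V" for f g h X Y Z V
    by (rule D_ext; use that in \<open>simp add: mem_Hom D_comp\<close>)
qed simp_all

sublocale D: category D by (rule category_D)

end

section \<open>The triple induced by a monoidal cotriple\<close>

locale triple_setting = mon_setting C MC A MA
  for C :: "('o, 'm, 'y) cat_scheme" and MC :: "('o, 'm) tensor"
    and A :: "('p, 'n, 'z) acat_scheme" and MA :: "('p, 'n) tensor" +
  fixes G :: "('o, 'm, 'o, 'm) mfctr" and \<epsilon> \<delta> :: "'o \<Rightarrow> 'm" and W :: "('o, 'm, 'p, 'n) chm_arr set"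
  assumes cotriple: "monoidal_cotriple C MC G \<epsilon> \<delta>"
    and W_arr: "W \<subseteq> Arr (mon_ch C MC A MA)"
    and W_id: "K \<in> Obj (mon_ch C MC A MA) \<Longrightarrow> Id (mon_ch C MC A MA) K \<in> W"
    and T_W: "T_map C A G ` W \<subseteq> W"
begin

lemma G_mf: "is_mfunctor (op_cat C) (op_tensor C MC) (op_cat C) (op_tensor C MC) G"
  and eps_mn: "is_mnat (op_cat C) (op_tensor C MC) (op_cat C) (op_tensor C MC) (id_mf (op_cat C) (op_tensor C MC)) G \<epsilon>"
  and del_mn: "is_mnat (op_cat C) (op_tensor C MC) (op_cat C) (op_tensor C MC) (comp_mf (op_cat C) (op_cat C) G G) G \<delta>"
  and cotriple_laws:
    "X \<in> Obj C \<Longrightarrow> \<epsilon> (FO G X) \<cdot>\<^bsub>C\<^esub> \<delta> X = Id C (FO G X)"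
    "X \<in> Obj C \<Longrightarrow> FM G (\<epsilon> X) \<cdot>\<^bsub>C\<^esub> \<delta> X = Id C (FO G X)"
    "X \<in> Obj C \<Longrightarrow> \<delta> (FO G X) \<cdot>\<^bsub>C\<^esub> \<delta> X = FM G (\<delta> X) \<cdot>\<^bsub>C\<^esub> \<delta> X"
  using cotriple by (auto simp: monoidal_cotriple_def Let_def)

lemma G_simps [simp]:
  "X \<in> Obj C \<Longrightarrow> FO G X \<in> Obj C"
  "f \<in> Arr C \<Longrightarrow> FM G f \<in> Arr C" "f \<in> Arr C \<Longrightarrow> Dom C (FM G f) = FO G (Dom C f)"
  "f \<in> Arr C \<Longrightarrow> Cod C (FM G f) = FO G (Cod C f)"
  "X \<in> Obj C \<Longrightarrow> FM G (Id C X) = Id C (FO G X)"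
  "X \<in> Obj C \<Longrightarrow> Y \<in> Obj C \<Longrightarrow> FK G X Y \<in> Arr C"
  "X \<in> Obj C \<Longrightarrow> Y \<in> Obj C \<Longrightarrow> Dom C (FK G X Y) = FO G (TO MC X Y)"
  "X \<in> Obj C \<Longrightarrow> Y \<in> Obj C \<Longrightarrow> Cod C (FK G X Y) = TO MC (FO G X) (FO G Y)"
  "FU G \<in> Arr C" "Dom C (FU G) = FO G (TU MC)" "Cod C (FU G) = TU MC"
  using G_mf by (simp_all add: is_mfunctor_def is_functor_def mem_Hom)

lemma eps_simps [simp]:
  assumes "X \<in> Obj C"
  shows "\<epsilon> X \<in> Arr C" "Dom C (\<epsilon> X) = FO G X" "Cod C (\<epsilon> X) = X"
  using eps_mn assms by (simp_all add: is_mnat_def is_nat_def id_mf_def mem_Hom)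

lemma del_simps [simp]:
  assumes "X \<in> Obj C"
  shows "\<delta> X \<in> Arr C" "Dom C (\<delta> X) = FO G X" "Cod C (\<delta> X) = FO G (FO G X)"
  using del_mn assms by (simp_all add: is_mnat_def is_nat_def comp_mf_def mem_Hom)

lemma eps_nat: "f \<in> Arr C \<Longrightarrow> f \<cdot>\<^bsub>C\<^esub> \<epsilon> (Dom C f) = \<epsilon> (Cod C f) \<cdot>\<^bsub>C\<^esub> FM G f"
  using eps_mn by (simp add: is_mnat_def is_nat_def id_mf_def)

lemma del_nat: "f \<in> Arr C \<Longrightarrow> FM G (FM G f) \<cdot>\<^bsub>C\<^esub> \<delta> (Dom C f) = \<delta> (Cod C f) \<cdot>\<^bsub>C\<^esub> FM G f"
  using del_mn by (simp add: is_mnat_def is_nat_def comp_mf_def)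

lemma eps_mon: "X \<in> Obj C \<Longrightarrow> Y \<in> Obj C \<Longrightarrow> \<epsilon> (TO MC X Y) = TA MC (\<epsilon> X) (\<epsilon> Y) \<cdot>\<^bsub>C\<^esub> FK G X Y"
  using eps_mn by (simp add: is_mnat_def id_mf_def)

lemma eps_unit: "\<epsilon> (TU MC) = FU G"
  using eps_mn by (simp add: is_mnat_def id_mf_def)

lemma del_mon: "X \<in> Obj C \<Longrightarrow> Y \<in> Obj C \<Longrightarrow>
    (FK G (FO G X) (FO G Y) \<cdot>\<^bsub>C\<^esub> FM G (FK G X Y)) \<cdot>\<^bsub>C\<^esub> \<delta> (TO MC X Y) = TA MC (\<delta> X) (\<delta> Y) \<cdot>\<^bsub>C\<^esub> FK G X Y"
  using del_mn by (simp add: is_mnat_def comp_mf_def)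

lemma del_unit: "(FU G \<cdot>\<^bsub>C\<^esub> FM G (FU G)) \<cdot>\<^bsub>C\<^esub> \<delta> (TU MC) = FU G"
  using del_mn by (simp add: is_mnat_def comp_mf_def)

abbreviation "T \<equiv> T_obj C A G"
abbreviation "Tm \<equiv> T_map C A G"
abbreviation "\<eta> \<equiv> T_unit C A G \<epsilon>"
abbreviation "\<mu> \<equiv> T_mult C A G \<delta>"

lemma T_simps [simp]:
  "X \<in> Obj C \<Longrightarrow> FO (T K) X = FO K (FO G X)"
  "f \<in> Arr C \<Longrightarrow> FM (T K) f = FM K (FM G f)"
  "X \<in> Obj C \<Longrightarrow> Y \<in> Obj C \<Longrightarrow> FK (T K) X Y = FM K (FK G X Y) \<cdot>\<^bsub>Ch\<^esub> FK K (FO G X) (FO G Y)"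
  "FU (T K) = FM K (FU G) \<cdot>\<^bsub>Ch\<^esub> FU K"
  by (simp_all add: T_obj_def comp_mf_def)

text \<open>Since identities belong to \<open>W\<close> and \<open>T\<close> preserves \<open>W\<close>, the functors \<open>T K\<close> come for free.\<close>

lemma T_obj_D [simp]: "K \<in> Obj D \<Longrightarrow> T K \<in> Obj D"
proof -
  assume "K \<in> Obj D"
  then have "Tm (Id D K) \<in> Arr D" using W_id T_W W_arr by blast
  then show ?thesis by (simp add: mon_ch_simps(2) T_map_def mon_ch_id)
qed

text \<open>The Kuenneth morphism of \<open>T K\<close> is that of \<open>K\<close> at
  \<open>G X\<close> and \<open>G Y\<close>, followed by \<open>K\<close> applied to the structure
  arrow \<open>FK G X Y\<close>. Compatibility of \<open>a\<close> covers the first factor and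
  naturality of \<open>a\<close> at this arrow the second; the unit is treated in the same
  way.\<close>

lemma T_map_D:
  assumes a: "a \<in> Arr D"
  shows "Tm a \<in> Arr D" "Dom D (Tm a) = T (Dom D a)" "Cod D (Tm a) = T (Cod D a)"
proof -
  have s: "src (Tm a) = T (Dom D a)" "tgt (Tm a) = T (Cod D a)" "dat (Tm a) \<in> extensional (Obj C)"
    "\<And>X. X \<in> Obj C \<Longrightarrow> dat (Tm a) X = dat a (FO G X)"
    by (simp_all add: T_map_def mon_ch_simps(3,4))
  have h: "dat (Tm a) X \<in> Hom Ch (FO (T (Dom D a)) X) (FO (T (Cod D a)) X)" if "X \<in> Obj C" for X
    using that a by (simp add: mem_Hom s)
  have n: "dat (Tm a) (Dom C f) \<cdot>\<^bsub>Ch\<^esub> FM (T (Dom D a)) f = FM (T (Cod D a)) f \<cdot>\<^bsub>Ch\<^esub> dat (Tm a) (Cod C f)"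
    if f: "f \<in> Arr C" for f
    using D_arr_nat[OF a, of "FM G f"] f by (simp add: s)
  have m: "dat (Tm a) (TO MC X Y) \<cdot>\<^bsub>Ch\<^esub> FK (T (Dom D a)) X Y
      = FK (T (Cod D a)) X Y \<cdot>\<^bsub>Ch\<^esub> TA N (dat (Tm a) X) (dat (Tm a) Y)"
    if X: "X \<in> Obj C" "Y \<in> Obj C" for X Y
  proof -
    let ?k = "FK G X Y"
    have "dat a (FO G (TO MC X Y)) \<cdot>\<^bsub>Ch\<^esub> FM (Dom D a) ?k \<cdot>\<^bsub>Ch\<^esub> FK (Dom D a) (FO G X) (FO G Y)
      = (FM (Cod D a) ?k \<cdot>\<^bsub>Ch\<^esub> dat a (TO MC (FO G X) (FO G Y))) \<cdot>\<^bsub>Ch\<^esub> FK (Dom D a) (FO G X) (FO G Y)"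
      by (rule Ch.comp_reduce) (use X a D_arr_nat[OF a, of ?k] in simp_all)
    then show ?thesis using X a D_arr_mon[OF a, of "FO G X" "FO G Y"] by (simp add: s)
  qed
  have u: "dat (Tm a) (TU MC) \<cdot>\<^bsub>Ch\<^esub> FU (T (Dom D a)) = FU (T (Cod D a))"
  proof -
    have "dat a (FO G (TU MC)) \<cdot>\<^bsub>Ch\<^esub> FM (Dom D a) (FU G) \<cdot>\<^bsub>Ch\<^esub> FU (Dom D a)
      = (FM (Cod D a) (FU G) \<cdot>\<^bsub>Ch\<^esub> dat a (TU MC)) \<cdot>\<^bsub>Ch\<^esub> FU (Dom D a)"
      by (rule Ch.comp_reduce) (use a D_arr_nat[OF a, of "FU G"] in simp_all)
    then show ?thesis using a D_arr_unit[OF a] by (simp add: s)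
  qed
  have o: "T (Dom D a) \<in> Obj D" "T (Cod D a) \<in> Obj D" using a by simp_all
  show "Tm a \<in> Arr D" "Dom D (Tm a) = T (Dom D a)" "Cod D (Tm a) = T (Cod D a)"
    by (rule D_arrI[OF o s(1-3) h n m u]; assumption)+
qed

text \<open>Monoidality combines naturality of \<open>FK K\<close> at a pair of components of the
  counit with the monoidality \<open>eps_mon\<close> of the counit itself. The multiplication below
  is handled alike, with \<open>del_mon\<close>.\<close>

lemma T_unit_D:
  assumes K: "K \<in> Obj D"
  shows "\<eta> K \<in> Arr D" "Dom D (\<eta> K) = K" "Cod D (\<eta> K) = T K"
proof -
  have s: "src (\<eta> K) = K" "tgt (\<eta> K) = T K" "dat (\<eta> K) \<in> extensional (Obj C)"
    "\<And>X. X \<in> Obj C \<Longrightarrow> dat (\<eta> K) X = FM K (\<epsilon> X)"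
    by (simp_all add: T_unit_def)
  have h: "dat (\<eta> K) X \<in> Hom Ch (FO K X) (FO (T K) X)" if "X \<in> Obj C" for X
    using that K by (simp add: mem_Hom s)
  have n: "dat (\<eta> K) (Dom C f) \<cdot>\<^bsub>Ch\<^esub> FM K f = FM (T K) f \<cdot>\<^bsub>Ch\<^esub> dat (\<eta> K) (Cod C f)"
    if f: "f \<in> Arr C" for f
    using f K eps_nat[OF f] by (simp add: s flip: D_obj_comp)
  have m: "dat (\<eta> K) (TO MC X Y) \<cdot>\<^bsub>Ch\<^esub> FK K X Y = FK (T K) X Y \<cdot>\<^bsub>Ch\<^esub> TA N (dat (\<eta> K) X) (dat (\<eta> K) Y)"
    if X: "X \<in> Obj C" "Y \<in> Obj C" for X Y
    using X K FK_nat[OF K, of "\<epsilon> X" "\<epsilon> Y"] by (simp add: s eps_mon D_obj_comp)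
  have u: "dat (\<eta> K) (TU MC) \<cdot>\<^bsub>Ch\<^esub> FU K = FU (T K)"
    by (simp add: s eps_unit)
  show "\<eta> K \<in> Arr D" "Dom D (\<eta> K) = K" "Cod D (\<eta> K) = T K"
    by (rule D_arrI[OF K T_obj_D[OF K] s(1-3) h n m u]; assumption)+
qed

lemma T_mult_D:
  assumes K: "K \<in> Obj D"
  shows "\<mu> K \<in> Arr D" "Dom D (\<mu> K) = T (T K)" "Cod D (\<mu> K) = T K"
proof -
  have s: "src (\<mu> K) = T (T K)" "tgt (\<mu> K) = T K" "dat (\<mu> K) \<in> extensional (Obj C)"
    "\<And>X. X \<in> Obj C \<Longrightarrow> dat (\<mu> K) X = FM K (\<delta> X)"
    by (simp_all add: T_mult_def)
  have h: "dat (\<mu> K) X \<in> Hom Ch (FO (T (T K)) X) (FO (T K) X)" if "X \<in> Obj C" for X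
    using that K by (simp add: mem_Hom s)
  have n: "dat (\<mu> K) (Dom C f) \<cdot>\<^bsub>Ch\<^esub> FM (T (T K)) f = FM (T K) f \<cdot>\<^bsub>Ch\<^esub> dat (\<mu> K) (Cod C f)"
    if f: "f \<in> Arr C" for f
    using f K del_nat[OF f] by (simp add: s flip: D_obj_comp)
  have m: "dat (\<mu> K) (TO MC X Y) \<cdot>\<^bsub>Ch\<^esub> FK (T (T K)) X Y = FK (T K) X Y \<cdot>\<^bsub>Ch\<^esub> TA N (dat (\<mu> K) X) (dat (\<mu> K) Y)"
    if X: "X \<in> Obj C" "Y \<in> Obj C" for X Y
  proof -
    let ?k = "FK K (FO G (FO G X)) (FO G (FO G Y))"
    have "dat (\<mu> K) (TO MC X Y) \<cdot>\<^bsub>Ch\<^esub> FK (T (T K)) X Y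
      = FM K ((FK G (FO G X) (FO G Y) \<cdot>\<^bsub>C\<^esub> FM G (FK G X Y)) \<cdot>\<^bsub>C\<^esub> \<delta> (TO MC X Y)) \<cdot>\<^bsub>Ch\<^esub> ?k"
      using X K by (simp add: s D_obj_comp)
    also have "\<dots> = FM K (TA MC (\<delta> X) (\<delta> Y) \<cdot>\<^bsub>C\<^esub> FK G X Y) \<cdot>\<^bsub>Ch\<^esub> ?k"
      by (simp only: del_mon[OF X])
    also have "\<dots> = FK (T K) X Y \<cdot>\<^bsub>Ch\<^esub> TA N (dat (\<mu> K) X) (dat (\<mu> K) Y)"
      using X K FK_nat[OF K, of "\<delta> X" "\<delta> Y"] by (simp add: s D_obj_comp)
    finally show ?thesis .
  qed
  have u: "dat (\<mu> K) (TU MC) \<cdot>\<^bsub>Ch\<^esub> FU (T (T K)) = FU (T K)"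
  proof -
    have "dat (\<mu> K) (TU MC) \<cdot>\<^bsub>Ch\<^esub> FU (T (T K)) = FM K ((FU G \<cdot>\<^bsub>C\<^esub> FM G (FU G)) \<cdot>\<^bsub>C\<^esub> \<delta> (TU MC)) \<cdot>\<^bsub>Ch\<^esub> FU K"
      using K by (simp add: s D_obj_comp)
    then show ?thesis by (simp only: del_unit T_simps)
  qed
  show "\<mu> K \<in> Arr D" "Dom D (\<mu> K) = T (T K)" "Cod D (\<mu> K) = T K"
    by (rule D_arrI[OF T_obj_D[OF T_obj_D[OF K]] T_obj_D[OF K] s(1-3) h n m u]; assumption)+
qed

lemma T_dat:
  "X \<in> Obj C \<Longrightarrow> dat (Tm a) X = dat a (FO G X)" "X \<in> Obj C \<Longrightarrow> dat (\<eta> K) X = FM K (\<epsilon> X)"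
  "X \<in> Obj C \<Longrightarrow> dat (\<mu> K) X = FM K (\<delta> X)"
  by (simp_all add: T_map_def T_unit_def T_mult_def)

text \<open>Objectwise, each monad law is the image of a comonad law under the contravariant functor
  \<open>K\<close>. Contravariance decides which is which: the law for
  \<open>FM G (\<epsilon> X)\<close> yields the unit law for \<eta> at \<open>T K\<close>, the law
  for \<open>\<epsilon> (FO G X)\<close> the one for \<open>T\<close> of \<eta>.\<close>

sublocale monad D T Tm \<eta> \<mu>
proof
  note td = T_map_D T_unit_D T_mult_D
  show "Tm (Id D K) = Id D (T K)" if "K \<in> Obj D" for K
    by (rule D_ext; use that in \<open>simp add: td T_dat\<close>)
  show "Tm (g \<cdot>\<^bsub>D\<^esub> f) = Tm g \<cdot>\<^bsub>D\<^esub> Tm f" if "f \<in> Arr D" "g \<in> Arr D" "Dom D g = Cod D f" for f g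
    by (rule D_ext; use that in \<open>simp add: td T_dat\<close>)
  show "Tm f \<cdot>\<^bsub>D\<^esub> \<eta> (Dom D f) = \<eta> (Cod D f) \<cdot>\<^bsub>D\<^esub> f" if "f \<in> Arr D" for f
  proof (rule D_ext)
    show "dat (Tm f \<cdot>\<^bsub>D\<^esub> \<eta> (Dom D f)) X = dat (\<eta> (Cod D f) \<cdot>\<^bsub>D\<^esub> f) X" if X: "X \<in> Obj C" for X
      using X D_arr_nat[OF \<open>f \<in> Arr D\<close>, of "\<epsilon> X"] by (simp add: T_dat)
  qed (use that in \<open>simp_all add: td\<close>)
  show "Tm f \<cdot>\<^bsub>D\<^esub> \<mu> (Dom D f) = \<mu> (Cod D f) \<cdot>\<^bsub>D\<^esub> Tm (Tm f)" if "f \<in> Arr D" for f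
  proof (rule D_ext)
    show "dat (Tm f \<cdot>\<^bsub>D\<^esub> \<mu> (Dom D f)) X = dat (\<mu> (Cod D f) \<cdot>\<^bsub>D\<^esub> Tm (Tm f)) X" if X: "X \<in> Obj C" for X
      using X D_arr_nat[OF \<open>f \<in> Arr D\<close>, of "\<delta> X"] by (simp add: T_dat)
  qed (use that in \<open>simp_all add: td\<close>)
  fix K assume K: "K \<in> Obj D"
  show "\<mu> K \<cdot>\<^bsub>D\<^esub> \<eta> (T K) = Id D (T K)"
  proof (rule D_ext)
    show "dat (\<mu> K \<cdot>\<^bsub>D\<^esub> \<eta> (T K)) X = dat (Id D (T K)) X" if X: "X \<in> Obj C" for X
      using X K D_obj_comp[OF K, of "\<delta> X" "FM G (\<epsilon> X)"] by (simp add: T_dat cotriple_laws)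
  qed (use K in \<open>simp_all add: td\<close>)
  show "\<mu> K \<cdot>\<^bsub>D\<^esub> Tm (\<eta> K) = Id D (T K)"
  proof (rule D_ext)
    show "dat (\<mu> K \<cdot>\<^bsub>D\<^esub> Tm (\<eta> K)) X = dat (Id D (T K)) X" if X: "X \<in> Obj C" for X
      using X K D_obj_comp[OF K, of "\<delta> X" "\<epsilon> (FO G X)"] by (simp add: T_dat cotriple_laws)
  qed (use K in \<open>simp_all add: td\<close>)
  show "\<mu> K \<cdot>\<^bsub>D\<^esub> Tm (\<mu> K) = \<mu> K \<cdot>\<^bsub>D\<^esub> \<mu> (T K)"
  proof (rule D_ext)
    show "dat (\<mu> K \<cdot>\<^bsub>D\<^esub> Tm (\<mu> K)) X = dat (\<mu> K \<cdot>\<^bsub>D\<^esub> \<mu> (T K)) X" if X: "X \<in> Obj C" for X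
      using X K D_obj_comp[OF K, of "\<delta> X" "\<delta> (FO G X)"] D_obj_comp[OF K, of "\<delta> X" "FM G (\<delta> X)"]
      by (simp add: T_dat cotriple_laws)
  qed (use K in \<open>simp_all add: td\<close>)
qed (simp_all add: T_map_D T_unit_D T_mult_D)

lemma std_constr_std: "std_constr C A G \<epsilon> \<delta> K = std K"
  by (simp add: std_constr_def std_def)

lemma Tpow_W: "a \<in> W \<Longrightarrow> (Tm ^^ n) a \<in> W"
  by (induction n) (use T_W in auto)

text \<open>The values of an iterate of \<open>T\<close> at \<open>K\<close> are among the values of
  \<open>K\<close>. One bound therefore serves all terms of the standard construction, as the total
  complex requires.\<close>

lemma vanishes_T: "vanishes_below_on C A b K \<Longrightarrow> vanishes_below_on C A b ((T ^^ n) K)"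
  by (induction n) (simp_all add: vanishes_below_on_def)

lemma std_bounded: "K \<in> Obj D \<Longrightarrow> cosimp_bounded_below C A (std K)"
  unfolding cosimp_bounded_below_def std_def cosimp.simps
  using vanishes_T by (fastforce simp: mon_ch_simps(1) simp del: funpow.simps)

end

section \<open>The Alexander--Whitney simple functor\<close>

context abelian_monoidal_category
begin

lemma tens_in_simps [simp]:
  assumes "X \<in> Obj Ch" "Y \<in> Obj Ch"
  shows "tens_in A M X Y n p \<in> Arr A" "Dom A (tens_in A M X Y n p) = TO M (cob X p) (cob Y (n - p))"
    "Cod A (tens_in A M X Y n p) = bob (tsum A (tens_dcx A M X Y) n)"
    "tens_pr A M X Y n p \<in> Arr A" "Dom A (tens_pr A M X Y n p) = bob (tsum A (tens_dcx A M X Y) n)"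
    "Cod A (tens_pr A M X Y n p) = TO M (cob X p) (cob Y (n - p))"
  using pre_dcx_tens[OF assms] by (simp_all add: tens_in_def tens_pr_def)

lemma tens_ext:
  assumes "X \<in> Obj Ch" "Y \<in> Obj Ch" "f \<in> Arr A" "g \<in> Arr A"
    "Dom A f = bob (tsum A (tens_dcx A M X Y) n)" "Dom A g = bob (tsum A (tens_dcx A M X Y) n)" "Cod A f = Cod A g"
    "\<And>p. f \<odot> tens_in A M X Y n p = g \<odot> tens_in A M X Y n p"
  shows "f = g"
  by (rule tsum_ext[OF pre_dcx_tens[OF assms(1,2)]]) (use assms in \<open>simp_all add: tens_in_def\<close>)

lemma tens_tot_ext:
  assumes P: "pre_dcx A P" and Q: "pre_dcx A Q" and o: "tot A P \<in> Obj Ch" "tot A Q \<in> Obj Ch"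
    and f: "f \<in> Arr A" "g \<in> Arr A" "Dom A f = bob (tsum A (tens_dcx A M (tot A P) (tot A Q)) n)"
      "Dom A g = bob (tsum A (tens_dcx A M (tot A P) (tot A Q)) n)" "Cod A f = Cod A g"
    and e: "\<And>m p r. f \<odot> tens_in A M (tot A P) (tot A Q) n m \<odot> TA M (bin (tsum A P m) p) (bin (tsum A Q (n - m)) r)
      = g \<odot> tens_in A M (tot A P) (tot A Q) n m \<odot> TA M (bin (tsum A P m) p) (bin (tsum A Q (n - m)) r)"
  shows "f = g"
proof (rule tens_ext[OF o f])
  fix m
  show "f \<odot> tens_in A M (tot A P) (tot A Q) n m = g \<odot> tens_in A M (tot A P) (tot A Q) n m"
    by (rule tensor_biprod_ext[OF tsum_biproduct[OF P, of m] tsum_biproduct[OF Q, of "n - m"]])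
      (use P Q o f e in simp_all)
qed

text \<open>The Kuenneth morphism of the simple object is one sum over triples (m, p, r) with
  natural p and r, not a nested sum. This lemma shows that such a sum has finite support and
  computes its restriction to a summand.\<close>

lemma tens_tot_cotuple:
  fixes g :: "int \<Rightarrow> nat \<Rightarrow> nat \<Rightarrow> 'm"
  assumes P: "pre_dcx A P" and Q: "pre_dcx A Q" and o: "tot A P \<in> Obj Ch" "tot A Q \<in> Obj Ch"
    and Z: "Z \<in> Obj A"
    and g: "\<And>m p r. g m p r \<in> Hom A (TO M (dob P (int p) (m - int p)) (dob Q (int r) (n - m - int r))) Z"
  defines "h \<equiv> hsum A (bob (tsum A (tens_dcx A M (tot A P) (tot A Q)) n)) Z (\<lambda>(m, p, r).
     g m p r \<odot> TA M (bpr (tsum A P m) (int p)) (bpr (tsum A Q (n - m)) (int r)) \<odot> tens_pr A M (tot A P) (tot A Q) n m)"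
  shows "h \<in> Arr A" "Dom A h = bob (tsum A (tens_dcx A M (tot A P) (tot A Q)) n)" "Cod A h = Z"
    "h \<odot> tens_in A M (tot A P) (tot A Q) n m \<odot> TA M (bin (tsum A P m) (int p)) (bin (tsum A Q (n - m)) (int r)) = g m p r"
proof -
  let ?S = "bob (tsum A (tens_dcx A M (tot A P) (tot A Q)) n)"
  let ?pr = "\<lambda>m p r. TA M (bpr (tsum A P m) (int p)) (bpr (tsum A Q (n - m)) (int r)) \<odot> tens_pr A M (tot A P) (tot A Q) n m"
  let ?in = "\<lambda>m p r. tens_in A M (tot A P) (tot A Q) n m \<odot> TA M (bin (tsum A P m) (int p)) (bin (tsum A Q (n - m)) (int r))"
  let ?V = "\<lambda>m p r. TO M (dob P (int p) (m - int p)) (dob Q (int r) (n - m - int r))"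
  have pr: "?pr m p r \<in> Arr A" "Dom A (?pr m p r) = ?S" "Cod A (?pr m p r) = ?V m p r"
    and inn: "?in m p r \<in> Arr A" "Dom A (?in m p r) = ?V m p r" "Cod A (?in m p r) = ?S"
    and S: "?S \<in> Obj A" and V: "?V m p r \<in> Obj A" for m p r
    using P Q o pre_dcx_tens[OF o] by simp_all
  have gs: "g m p r \<in> Arr A" "Dom A (g m p r) = ?V m p r" "Cod A (g m p r) = Z" for m p r
    using g[of m p r] by (simp_all add: mem_Hom)
  let ?t = "\<lambda>(m, p, r). g m p r \<odot> ?pr m p r"
  have th: "?t i \<in> Hom A ?S Z" for i
    using pr gs by (cases i) (simp add: mem_Hom)
  obtain N1 where N1: "\<And>p q. p < N1 \<or> q < N1 \<Longrightarrow> is_zero_obj A (dob P p q)"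
    using P unfolding pre_dcx_def dcx_bounded_below_def by blast
  obtain N2 where N2: "\<And>p q. p < N2 \<or> q < N2 \<Longrightarrow> is_zero_obj A (dob Q p q)"
    using Q unfolding pre_dcx_def dcx_bounded_below_def by blast
  \<comment> \<open>A nonzero term needs m - p >= N1 and n - m - r >= N2. As p and r are
    nonnegative, m lies between N1 and n - N2, and both p and r are at most n - N1 - N2.\<close>
  let ?b = "nat (n - N1 - N2)"
  have sub: "{i. ?t i \<noteq> Zer A ?S Z} \<subseteq> {N1..n - N2} \<times> {..?b} \<times> {..?b}"
  proof
    fix i assume i: "i \<in> {i. ?t i \<noteq> Zer A ?S Z}"
    obtain m p r where mpr: "i = (m, p, r)" by (cases i) auto
    have "\<not> is_zero_obj A (?V m p r)"
    proof
      assume "is_zero_obj A (?V m p r)"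
      then have "is_zero_obj A (Cod A (?pr m p r))" by (simp only: pr)
      from factor_zero[OF this pr(1) gs(1)[of m p r]] have "?t i = Zer A ?S Z"
        unfolding mpr by (simp only: pr gs prod.case)
      then show False using i by simp
    qed
    then have "\<not> is_zero_obj A (dob P (int p) (m - int p))" "\<not> is_zero_obj A (dob Q (int r) (n - m - int r))"
      using tensor_zero_obj P Q by (metis pre_dcx_simps(1))+
    then have "\<not> m - int p < N1" "\<not> n - m - int r < N2" using N1 N2 by blast+
    then show "i \<in> {N1..n - N2} \<times> {..?b} \<times> {..?b}" unfolding mpr by auto
  qed
  have F: "finsupp A ?S Z ?t"
    unfolding finsupp_def using th finite_subset[OF sub] by blast
  have h: "h = hsum A ?S Z ?t" by (simp add: h_def)
  show "h \<in> Arr A" "Dom A h = ?S" "Cod A h = Z"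
    unfolding h by (rule hsum_arr[where f = ?t, OF S Z th])+
  \<comment> \<open>The outer projections separate the values of m; for equal m the claim is the
    tensor product of two inner Kronecker deltas.\<close>
  have delta: "?pr m' p' r' \<odot> ?in m p r = (if (m', p', r') = (m, p, r) then Id A (?V m p r) else Zer A (?V m p r) (?V m' p' r'))"
    for m' p' r'
  proof (cases "m' = m")
    case False
    have "tens_pr A M (tot A P) (tot A Q) n m' \<odot> tens_in A M (tot A P) (tot A Q) n m =
      Zer A (TO M (bob (tsum A P m)) (bob (tsum A Q (n - m)))) (TO M (bob (tsum A P m')) (bob (tsum A Q (n - m'))))"
      using tsum_delta[OF pre_dcx_tens[OF o], of n m' m] False by (simp add: tens_in_def tens_pr_def)
    from comp_reduce[OF this, of "TA M (bin (tsum A P m) (int p)) (bin (tsum A Q (n - m)) (int r))"]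
    show ?thesis using False P Q o by simp
  next
    case True
    have "tens_pr A M (tot A P) (tot A Q) n m \<odot> tens_in A M (tot A P) (tot A Q) n m =
      Id A (TO M (bob (tsum A P m)) (bob (tsum A Q (n - m))))"
      using tsum_delta[OF pre_dcx_tens[OF o], of n m m] by (simp add: tens_in_def tens_pr_def)
    from comp_reduce[OF this, of "TA M (bin (tsum A P m) (int p)) (bin (tsum A Q (n - m)) (int r))"]
    have "?pr m p' r' \<odot> ?in m p r = TA M (bpr (tsum A P m) (int p') \<odot> bin (tsum A P m) (int p))
        (bpr (tsum A Q (n - m)) (int r') \<odot> bin (tsum A Q (n - m)) (int r))"
      using P Q o by (simp add: tensor_comp_arr)
    then show ?thesis unfolding True tsum_delta[OF P] tsum_delta[OF Q] using P Q by (auto simp: tensor_id)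
  qed
  have "h \<odot> ?in m p r = hsum A (?V m p r) Z (\<lambda>i. ?t i \<odot> ?in m p r)"
    unfolding h using comp_hsum(2)[OF F S Z inn(1)[of m p r] inn(3)[of m p r]] by (simp only: inn)
  also have "\<dots> = ?t (m, p, r) \<odot> ?in m p r"
  proof (rule hsum_single)
    have "?t (m, p, r) \<odot> ?in m p r = g m p r \<odot> (?pr m p r \<odot> ?in m p r)"
      unfolding prod.case by (rule comp_assoc_arr) (simp_all only: pr inn gs)
    show "?t (m, p, r) \<odot> ?in m p r \<in> Hom A (?V m p r) Z"
      unfolding mem_Hom using th[of "(m, p, r)"] inn[of m p r] comp_arr[of "?in m p r" "?t (m, p, r)"]
      unfolding mem_Hom by (simp only:)
    fix i assume i: "i \<noteq> (m, p, r)"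
    obtain m' p' r' where mpr: "i = (m', p', r')" by (cases i) auto
    have "?t i \<odot> ?in m p r = g m' p' r' \<odot> (?pr m' p' r' \<odot> ?in m p r)"
      unfolding mpr prod.case by (rule comp_assoc_arr) (simp_all only: pr inn gs)
    also have "\<dots> = g m' p' r' \<odot> Zer A (?V m p r) (?V m' p' r')"
      using i unfolding mpr delta by presburger
    also have "\<dots> = Zer A (?V m p r) Z"
      using comp_zer(2)[OF gs(1)[of m' p' r'] V[where m = m and p = p and r = r] gs(2)[of m' p' r', symmetric]] by (simp only: gs)
    finally show "?t i \<odot> ?in m p r = Zer A (?V m p r) Z" .
  qed (use V Z in blast)+
  also have "\<dots> = g m p r \<odot> (?pr m p r \<odot> ?in m p r)"
    unfolding prod.case by (rule comp_assoc_arr) (simp_all only: pr inn gs)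
  also have "\<dots> = g m p r" unfolding delta using gs by simp
  finally show "h \<odot> ?in m p r = g m p r" .
qed

end

text \<open>The case distinction shared by \<open>saw_obj\<close> and \<open>saw_map\<close>, named
  so that the same lemmas serve the action of a simple object on arrows of \<open>C\<close> and the
  maps between simple objects.\<close>

definition levelwise :: "('p, 'n, 'z) acat_scheme \<Rightarrow> (nat \<Rightarrow> (('p, 'n) cochain, int \<Rightarrow> 'n) tarr) \<Rightarrow> int \<Rightarrow> int \<Rightarrow> 'n" where
  "levelwise A g p q = (if p < 0 then Zer A (zero_obj A) (zero_obj A) else dat (g (nat p)) q)"

lemma saw_dcx_simps:
  "dob (saw_dcx A K X) p q = (if p < 0 then zero_obj A else cob (FO (cso K (nat p)) X) q)"
  "dhor (saw_dcx A K X) p q = (if p < 0 then Zer A (dob (saw_dcx A K X) p q) (dob (saw_dcx A K X) (p + 1) q)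
     else finprod (hom_group A (dob (saw_dcx A K X) p q) (dob (saw_dcx A K X) (p + 1) q))
          (\<lambda>i. sgn_arr A (int i) (dat (dat (cface K (nat p) i) X) q)) {..nat p + 1})"
  "dver (saw_dcx A K X) p q = (if p < 0 then Zer A (dob (saw_dcx A K X) p q) (dob (saw_dcx A K X) p (q + 1))
     else cdf (FO (cso K (nat p)) X) q)"
  by (simp_all add: saw_dcx_def Let_def)

context mon_setting
begin

abbreviation "sdc K X \<equiv> saw_dcx A K X"
abbreviation "saw \<equiv> saw_obj C MC A MA"

lemma saw_simps:
  "X \<in> Obj C \<Longrightarrow> FO (saw K) X = tot A (sdc K X)"
  "f \<in> Arr C \<Longrightarrow> FM (saw K) f = tot_map A (sdc K (Cod C f)) (sdc K (Dom C f)) (levelwise A (\<lambda>n. FM (cso K n) f))"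
  "X \<in> Obj C \<Longrightarrow> Y \<in> Obj C \<Longrightarrow> FK (saw K) X Y = saw_kunneth C MC A MA K X Y"
  "FU (saw K) = saw_coaug A K (TU MC) (FU (cso K 0))"
  by (simp_all add: saw_obj_def levelwise_def[abs_def])

lemma saw_map_simps:
  "src (saw_map C MC A MA K L f) = saw K" "tgt (saw_map C MC A MA K L f) = saw L"
  "dat (saw_map C MC A MA K L f) \<in> extensional (Obj C)"
  "X \<in> Obj C \<Longrightarrow> dat (saw_map C MC A MA K L f) X = tot_map A (sdc K X) (sdc L X) (levelwise A (\<lambda>n. dat (f n) X))"
  by (simp_all add: saw_map_def levelwise_def[abs_def])

text \<open>\<open>saw K \<in> Obj D\<close> belongs to the notion, which spares the verification of
  associativity for the Alexander-Whitney Kuenneth morphism. For standard constructions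
  \<open>admissible_std\<close> deduces it from the compatibility of \<open>W\<close> with the
  simple functor.\<close>

definition admissible :: "(('o, 'm, 'p, 'n) chm, ('o, 'm, 'p, 'n) chm_arr) cosimp \<Rightarrow> bool" where
  "admissible K \<longleftrightarrow> is_cosimplicial D K \<and> cosimp_bounded_below C A K \<and> saw K \<in> Obj D"

lemma cosimp_simps [simp]:
  assumes "admissible K"
  shows "cso K n \<in> Obj D" "i \<le> Suc n \<Longrightarrow> cface K n i \<in> Arr D" "i \<le> Suc n \<Longrightarrow> Dom D (cface K n i) = cso K n"
    "i \<le> Suc n \<Longrightarrow> Cod D (cface K n i) = cso K (Suc n)"
  using assms by (simp_all add: admissible_def is_cosimplicial_def mem_Hom)

lemma pre_dcx_saw [simp]:
  assumes K: "admissible K" and X: "X \<in> Obj C"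
  shows "pre_dcx A (sdc K X)"
proof -
  obtain b where b: "\<And>p. vanishes_below_on C A b (cso K p)"
    using K by (auto simp: admissible_def cosimp_bounded_below_def)
  have o: "dob (sdc K X) p q \<in> Obj A" for p q
    using K X A.ch_obj(1)[of "FO (cso K (nat p)) X"] by (simp add: saw_dcx_simps(1))
  \<comment> \<open>\<open>b\<close> bounds the internal degree of every term; 0 accounts for the
    columns of negative cosimplicial degree, which are zero objects by construction.\<close>
  have z: "is_zero_obj A (dob (sdc K X) p q)" if "p < min 0 b \<or> q < min 0 b" for p q
    using that b[of "nat p"] X by (auto simp: saw_dcx_simps(1) vanishes_below_on_def vanishes_below_def)
  have h: "dhor (sdc K X) p q \<in> Hom A (dob (sdc K X) p q) (dob (sdc K X) (p + 1) q)" for p q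
  proof (cases "p < 0")
    case True
    then show ?thesis using o by (simp add: saw_dcx_simps(2) mem_Hom)
  next
    case False
    have "sgn_arr A (int i) (dat (dat (cface K (nat p) i) X) q) \<in> Hom A (dob (sdc K X) p q) (dob (sdc K X) (p + 1) q)"
      if i: "i \<in> {..nat p + 1}" for i
    proof -
      have i': "i \<le> Suc (nat p)" "nat (p + 1) = Suc (nat p)" using i False by auto
      have "dat (cface K (nat p) i) X \<in> Arr Ch" using K X i' by simp
      from A.ch_arr(1-3)[OF this, of q] show ?thesis
        using K X i' False by (simp add: mem_Hom saw_dcx_simps(1))
    qed
    note fp = A.finprod_hg_arr[where S = "{..nat p + 1}"
        and f = "\<lambda>i. sgn_arr A (int i) (dat (dat (cface K (nat p) i) X) q)", OF o o this]
    have "dhor (sdc K X) p q = finprod (hom_group A (dob (sdc K X) p q) (dob (sdc K X) (p + 1) q))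
          (\<lambda>i. sgn_arr A (int i) (dat (dat (cface K (nat p) i) X) q)) {..nat p + 1}"
      unfolding saw_dcx_simps(2)[of A K X p q] if_not_P[OF False] ..
    then show ?thesis unfolding mem_Hom using fp by (simp only:)
  qed
  have v: "dver (sdc K X) p q \<in> Hom A (dob (sdc K X) p q) (dob (sdc K X) p (q + 1))" for p q
    using K X o A.ch_obj(2-4)[of "FO (cso K (nat p)) X"]
    by (cases "p < 0") (simp_all add: saw_dcx_simps mem_Hom)
  show ?thesis unfolding pre_dcx_def dcx_bounded_below_def using o z h v by blast
qed

lemma saw_tot_obj [simp]: "admissible K \<Longrightarrow> X \<in> Obj C \<Longrightarrow> tot A (sdc K X) \<in> Obj Ch"
  using D_obj(1)[of "saw K" X] by (simp add: admissible_def saw_simps)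

lemma levelwise_hom:
  assumes "admissible K" "admissible L" "X \<in> Obj C" "Y \<in> Obj C"
    "\<And>n. g n \<in> Arr Ch" "\<And>n. Dom Ch (g n) = FO (cso K n) X" "\<And>n. Cod Ch (g n) = FO (cso L n) Y"
  shows "dcx_hom A (sdc K X) (sdc L Y) (levelwise A g)"
  using A.ch_arr(1-3)[OF assms(5)] assms unfolding dcx_hom_def
  by (simp add: mem_Hom saw_dcx_simps levelwise_def)

lemma levelwise_comp:
  "(\<And>n. k n = h n \<cdot>\<^bsub>Ch\<^esub> g n) \<Longrightarrow> levelwise A k p q = levelwise A h p q \<odot> levelwise A g p q"
  by (simp add: levelwise_def)

lemma saw_in_simps [simp]:
  assumes "admissible K" "X \<in> Obj C"
  shows "saw_in A K X n p \<in> Arr A" "Dom A (saw_in A K X n p) = cob (FO (cso K p) X) (n - int p)"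
    "Cod A (saw_in A K X n p) = bob (tsum A (sdc K X) n)"
  using assms by (simp_all add: saw_in_def saw_dcx_simps)

lemma tot_map_saw_in:
  assumes "admissible K" "admissible L" "X \<in> Obj C" "Y \<in> Obj C" "dcx_hom A (sdc K X) (sdc L Y) (levelwise A g)"
  shows "dat (tot_map A (sdc K X) (sdc L Y) (levelwise A g)) n \<odot> saw_in A K X n p = saw_in A L Y n p \<odot> dat (g p) (n - int p)"
  using A.tot_map_simps(4)[OF pre_dcx_saw[OF assms(1,3)] pre_dcx_saw[OF assms(2,4)] assms(5), of n "int p"]
  by (simp add: saw_in_def levelwise_def)

lemma last_cofaces_simps [simp]:
  assumes "admissible K"
  shows "last_cofaces D K p q \<in> Arr D" "Dom D (last_cofaces D K p q) = cso K p"
    "Cod D (last_cofaces D K p q) = cso K (p + q)"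
  using assms by (induction q) simp_all

lemma zeroth_cofaces_simps [simp]:
  assumes "admissible K"
  shows "zeroth_cofaces D K q p \<in> Arr D" "Dom D (zeroth_cofaces D K q p) = cso K q"
    "Cod D (zeroth_cofaces D K q p) = cso K (q + p)"
  using assms by (induction p) simp_all

section \<open>Iterated cofaces and the Alexander-Whitney map on summands\<close>

lemma cosimp_map_simps [simp]:
  assumes "is_cosimp_map D K L f"
  shows "f n \<in> Arr D" "Dom D (f n) = cso K n" "Cod D (f n) = cso L n"
  using assms by (simp_all add: is_cosimp_map_def mem_Hom)

lemma cosimp_map_face:
  assumes "is_cosimp_map D K L f" "i \<le> Suc n"
  shows "f (Suc n) \<cdot>\<^bsub>D\<^esub> cface K n i = cface L n i \<cdot>\<^bsub>D\<^esub> f n"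
  using assms by (simp add: is_cosimp_map_def)

lemma last_cofaces_nat:
  assumes "admissible K" "admissible L" "is_cosimp_map D K L f"
  shows "f (p + q) \<cdot>\<^bsub>D\<^esub> last_cofaces D K p q = last_cofaces D L p q \<cdot>\<^bsub>D\<^esub> f p"
proof (induction q)
  case (Suc q)
  have "f (Suc (p + q)) \<cdot>\<^bsub>D\<^esub> cface K (p + q) (Suc (p + q)) \<cdot>\<^bsub>D\<^esub> last_cofaces D K p q
    = (cface L (p + q) (Suc (p + q)) \<cdot>\<^bsub>D\<^esub> f (p + q)) \<cdot>\<^bsub>D\<^esub> last_cofaces D K p q"
    by (rule D.comp_reduce) (use assms cosimp_map_face[OF assms(3)] in simp_all)
  then show ?case using assms Suc by simp
qed (use assms in simp)

lemma zeroth_cofaces_nat: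
  assumes "admissible K" "admissible L" "is_cosimp_map D K L f"
  shows "f (q + p) \<cdot>\<^bsub>D\<^esub> zeroth_cofaces D K q p = zeroth_cofaces D L q p \<cdot>\<^bsub>D\<^esub> f q"
proof (induction p)
  case (Suc p)
  have "f (Suc (q + p)) \<cdot>\<^bsub>D\<^esub> cface K (q + p) 0 \<cdot>\<^bsub>D\<^esub> zeroth_cofaces D K q p
    = (cface L (q + p) 0 \<cdot>\<^bsub>D\<^esub> f (q + p)) \<cdot>\<^bsub>D\<^esub> zeroth_cofaces D K q p"
    by (rule D.comp_reduce) (use assms cosimp_map_face[OF assms(3)] in simp_all)
  then show ?case using assms Suc by simp
qed (use assms in simp)

text \<open>One summand of the Kuenneth morphism, without its sign. The internal degrees
  \<open>a\<close> and \<open>b\<close> of the two factors are parameters of their own, so that the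
  intermediate degree appears as \<open>a + b\<close>; the arrow is typed when n = p + r + a +
  b.\<close>

definition aw :: "(('o, 'm, 'p, 'n) chm, ('o, 'm, 'p, 'n) chm_arr) cosimp \<Rightarrow> 'o \<Rightarrow> 'o \<Rightarrow> int \<Rightarrow> nat \<Rightarrow> nat \<Rightarrow> int \<Rightarrow> int \<Rightarrow> 'n" where
  "aw K X Y n p r a b = saw_in A K (TO MC X Y) n (p + r)
     \<odot> dat (FK (cso K (p + r)) X Y) (a + b)
     \<odot> tens_in A MA (FO (cso K (p + r)) X) (FO (cso K (p + r)) Y) (a + b) a
     \<odot> TA MA (dat (dat (last_cofaces D K p r) X) a) (dat (dat (zeroth_cofaces D K r p) Y) b)"

lemma ch_dat_arr [simp]:
  assumes "a \<in> Arr Ch"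
  shows "dat a n \<in> Arr A" "Dom A (dat a n) = cob (Dom Ch a) n" "Cod A (dat a n) = cob (Cod Ch a) n"
  using A.ch_arr[OF assms] by simp_all

lemma ch_cob_obj [simp]: "X \<in> Obj Ch \<Longrightarrow> cob X n \<in> Obj A"
  using A.ch_obj by simp

text \<open>Both iterated cofaces must land in the same term, of degree p + r, whereas the recursion
  of \<open>zeroth_cofaces\<close> produces the degree as r + p.\<close>

lemma zc_cod:
  assumes "admissible K"
  shows "Cod D (zeroth_cofaces D K r p) = cso K (p + r)"
  using assms by (simp add: add.commute)

lemma cob_TO [simp]: "cob (TO N X Y) n = bob (tsum A (tens_dcx A MA X Y) n)"
  by (simp add: A.TO_ch)

lemma aw_parts:
  assumes K: "admissible K" and X: "X \<in> Obj C" "Y \<in> Obj C"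
  shows "dat (dat (last_cofaces D K p r) X) a \<in> Arr A"
    "Dom A (dat (dat (last_cofaces D K p r) X) a) = cob (FO (cso K p) X) a"
    "Cod A (dat (dat (last_cofaces D K p r) X) a) = cob (FO (cso K (p + r)) X) a"
    "dat (dat (zeroth_cofaces D K r p) Y) b \<in> Arr A"
    "Dom A (dat (dat (zeroth_cofaces D K r p) Y) b) = cob (FO (cso K r) Y) b"
    "Cod A (dat (dat (zeroth_cofaces D K r p) Y) b) = cob (FO (cso K (p + r)) Y) b"
  using assms zc_cod[OF K] last_cofaces_simps[OF K] zeroth_cofaces_simps(1,2)[OF K]
  by (simp_all del: zeroth_cofaces_simps)

lemma aw_arr:
  assumes K: "admissible K" and X: "X \<in> Obj C" "Y \<in> Obj C" and n: "n - int (p + r) = a + b"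
  shows "aw K X Y n p r a b \<in> Arr A"
    "Dom A (aw K X Y n p r a b) = TO MA (cob (FO (cso K p) X) a) (cob (FO (cso K r) Y) b)"
    "Cod A (aw K X Y n p r a b) = bob (tsum A (sdc K (TO MC X Y)) n)"
  using aw_parts[OF K X] K X n unfolding aw_def by simp_all

lemma aw_comp:
  assumes K: "admissible K" and X: "X \<in> Obj C" "Y \<in> Obj C" and n: "n - int (p + r) = a + b"
    and u: "u \<in> Arr A" "Cod A u = TO MA (cob (FO (cso K p) X) a) (cob (FO (cso K r) Y) b)"
  shows "aw K X Y n p r a b \<odot> u = saw_in A K (TO MC X Y) n (p + r)
     \<odot> dat (FK (cso K (p + r)) X Y) (a + b)
     \<odot> tens_in A MA (FO (cso K (p + r)) X) (FO (cso K (p + r)) Y) (a + b) a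
     \<odot> TA MA (dat (dat (last_cofaces D K p r) X) a) (dat (dat (zeroth_cofaces D K r p) Y) b) \<odot> u"
  using aw_parts[OF K X] K X n u unfolding aw_def by simp

text \<open>Brings the sum defining \<open>saw_kunneth\<close> into the shape required by
  \<open>tens_tot_cotuple\<close>. From here on the morphism is used through its restrictions to
  summands only.\<close>

lemma kunneth_arr:
  assumes K: "admissible K" and X: "X \<in> Obj C" "Y \<in> Obj C"
  shows "dat (saw_kunneth C MC A MA K X Y) n \<in> Arr A"
    "Dom A (dat (saw_kunneth C MC A MA K X Y) n) = bob (tsum A (tens_dcx A MA (tot A (sdc K X)) (tot A (sdc K Y))) n)"
    "Cod A (dat (saw_kunneth C MC A MA K X Y) n) = bob (tsum A (sdc K (TO MC X Y)) n)"
    "dat (saw_kunneth C MC A MA K X Y) n \<odot> tens_in A MA (tot A (sdc K X)) (tot A (sdc K Y)) n m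
      \<odot> TA MA (saw_in A K X m p) (saw_in A K Y (n - m) r)
      = sgn_arr A ((m - int p) * int r) (aw K X Y n p r (m - int p) (n - m - int r))" (is ?eq)
proof -
  let ?s = "\<lambda>m p r. sgn_arr A ((m - int p) * int r) (aw K X Y n p r (m - int p) (n - m - int r))"
  let ?pr = "\<lambda>m p r. TA MA (bpr (tsum A (sdc K X) m) (int p)) (bpr (tsum A (sdc K Y) (n - m)) (int r))
        \<odot> tens_pr A MA (tot A (sdc K X)) (tot A (sdc K Y)) n m"
  \<comment> \<open>\<open>saw_kunneth\<close> writes the intermediate degree as n - p - r, while
    \<open>aw\<close> needs it as the sum of the internal degrees m - p and n - m - r.\<close>
  have ar: "n - int p - int r = (m - int p) + (n - m - int r)" for m p r by simp
  have aa: "aw K X Y n p r (m - int p) (n - m - int r) \<in> Arr A"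
    "Dom A (aw K X Y n p r (m - int p) (n - m - int r)) = TO MA (cob (FO (cso K p) X) (m - int p)) (cob (FO (cso K r) Y) (n - m - int r))"
    "Cod A (aw K X Y n p r (m - int p) (n - m - int r)) = bob (tsum A (sdc K (TO MC X Y)) n)" for m p r
    by (rule aw_arr[OF K X]; simp)+
  have P: "pre_dcx A (sdc K X)" "pre_dcx A (sdc K Y)" "tot A (sdc K X) \<in> Obj Ch" "tot A (sdc K Y) \<in> Obj Ch"
    using K X by simp_all
  have Z: "bob (tsum A (sdc K (TO MC X Y)) n) \<in> Obj A" using K X by simp
  have gh: "?s m p r \<in> Hom A (TO MA (dob (sdc K X) (int p) (m - int p)) (dob (sdc K Y) (int r) (n - m - int r)))
      (bob (tsum A (sdc K (TO MC X Y)) n))" for m p r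
    using aa by (simp add: mem_Hom saw_dcx_simps(1))
  have t: "sgn_arr A ((m - int p) * int r)
         (saw_in A K (TO MC X Y) n (p + r)
          \<odot> dat (FK (cso K (p + r)) X Y) (n - int p - int r)
          \<odot> tens_in A MA (FO (cso K (p + r)) X) (FO (cso K (p + r)) Y) (n - int p - int r) (m - int p)
          \<odot> TA MA (dat (dat (last_cofaces D K p r) X) (m - int p))
                     (dat (dat (zeroth_cofaces D K r p) Y) (n - m - int r))
          \<odot> TA MA (saw_pr A K X m p) (saw_pr A K Y (n - m) r)
          \<odot> tens_pr A MA (tot A (sdc K X)) (tot A (sdc K Y)) n m) = ?s m p r \<odot> ?pr m p r" for m p r
  proof -
    let ?a = "m - int p" and ?b = "n - m - int r"
    have nn: "n - int (p + r) = ?a + ?b" by simp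
    have prs: "?pr m p r \<in> Arr A" "Cod A (?pr m p r) = TO MA (cob (FO (cso K p) X) ?a) (cob (FO (cso K r) Y) ?b)"
      using P by (simp_all add: saw_dcx_simps(1))
    have "aw K X Y n p r ?a ?b \<odot> ?pr m p r = saw_in A K (TO MC X Y) n (p + r)
          \<odot> dat (FK (cso K (p + r)) X Y) (?a + ?b)
          \<odot> tens_in A MA (FO (cso K (p + r)) X) (FO (cso K (p + r)) Y) (?a + ?b) ?a
          \<odot> TA MA (dat (dat (last_cofaces D K p r) X) ?a) (dat (dat (zeroth_cofaces D K r p) Y) ?b)
          \<odot> ?pr m p r"
      by (rule aw_comp[OF K X nn prs])
    moreover have "sgn_arr A (?a * int r) (aw K X Y n p r ?a ?b \<odot> ?pr m p r) = ?s m p r \<odot> ?pr m p r"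
      by (rule A.comp_sgn(2)[symmetric]) (use prs aa in simp_all)
    ultimately show ?thesis unfolding ar[of p r m] saw_pr_def by (simp only:)
  qed
  have e: "dat (saw_kunneth C MC A MA K X Y) n = hsum A (bob (tsum A (tens_dcx A MA (tot A (sdc K X)) (tot A (sdc K Y))) n))
      (bob (tsum A (sdc K (TO MC X Y)) n)) (\<lambda>(m, p, r). ?s m p r \<odot> ?pr m p r)"
    unfolding saw_kunneth_def Let_def tens_def by (simp only: snd_conv t A.cob_tot)
  note c = A.tens_tot_cotuple[where g = ?s, OF P Z gh]
  show "dat (saw_kunneth C MC A MA K X Y) n \<in> Arr A"
    "Dom A (dat (saw_kunneth C MC A MA K X Y) n) = bob (tsum A (tens_dcx A MA (tot A (sdc K X)) (tot A (sdc K Y))) n)"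
    "Cod A (dat (saw_kunneth C MC A MA K X Y) n) = bob (tsum A (sdc K (TO MC X Y)) n)"
    unfolding e by (rule c)+
  show ?eq unfolding e saw_in_def by (rule c)
qed

text \<open>Summands in negative cosimplicial degree are zero, so the inclusions of the others suffice.\<close>

lemma saw_kunneth_ext:
  assumes K: "admissible K" and X: "X \<in> Obj C" "Y \<in> Obj C"
    and f: "f \<in> Arr A" "g \<in> Arr A" "Dom A f = bob (tsum A (tens_dcx A MA (tot A (sdc K X)) (tot A (sdc K Y))) n)"
      "Dom A g = bob (tsum A (tens_dcx A MA (tot A (sdc K X)) (tot A (sdc K Y))) n)" "Cod A f = Cod A g"
    and e: "\<And>m p r. f \<odot> tens_in A MA (tot A (sdc K X)) (tot A (sdc K Y)) n m \<odot> TA MA (saw_in A K X m p) (saw_in A K Y (n - m) r)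
      = g \<odot> tens_in A MA (tot A (sdc K X)) (tot A (sdc K Y)) n m \<odot> TA MA (saw_in A K X m p) (saw_in A K Y (n - m) r)"
  shows "f = g"
proof (rule A.tens_tot_ext[OF pre_dcx_saw[OF K X(1)] pre_dcx_saw[OF K X(2)] _ _ f])
  fix m p r
  have P: "pre_dcx A (sdc K X)" "pre_dcx A (sdc K Y)" "tot A (sdc K X) \<in> Obj Ch" "tot A (sdc K Y) \<in> Obj Ch"
    using K X by simp_all
  let ?i = "tens_in A MA (tot A (sdc K X)) (tot A (sdc K Y)) n m \<odot> TA MA (bin (tsum A (sdc K X) m) p) (bin (tsum A (sdc K Y) (n - m)) r)"
  show "f \<odot> ?i = g \<odot> ?i"
  proof (cases "p < 0 \<or> r < 0")
    case True
    have "is_zero_obj A (TO MA (dob (sdc K X) p (m - p)) (dob (sdc K Y) r (n - m - r)))"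
      using True
    proof
      assume "p < 0"
      then have "is_zero_obj A (dob (sdc K X) p (m - p))" by (simp add: saw_dcx_simps(1))
      then show ?thesis by (rule A.tensor_zero_obj(1)) (use P in simp)
    next
      assume "r < 0"
      then have "is_zero_obj A (dob (sdc K Y) r (n - m - r))" by (simp add: saw_dcx_simps(1))
      then show ?thesis by (rule A.tensor_zero_obj(2)) (use P in simp)
    qed
    then have "is_zero_obj A (Dom A (f \<odot> ?i))" "is_zero_obj A (Dom A (g \<odot> ?i))"
      using P f by simp_all
    from this[THEN A.from_zero_obj] show ?thesis using P f by simp
  next
    case False
    then show ?thesis using e[of m "nat p" "nat r"] by (simp add: saw_in_def)
  qed
qed (use K X in simp_all)

text \<open>The map \<open>f\<close> is moved past the four factors of \<open>aw\<close> one at a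
  time. Facts 1 to 4 are the squares used: the total map on a summand, monoidality of
  \<open>f\<close> in cosimplicial degree p + r, a tensor product of maps on a summand, and
  naturality of the iterated cofaces.\<close>

lemma aw_nat:
  assumes K: "admissible K" and L: "admissible L" and f: "is_cosimp_map D K L f"
    and X: "X \<in> Obj C" "Y \<in> Obj C" and n: "n - int (p + r) = a + b"
  shows "dat (tot_map A (sdc K (TO MC X Y)) (sdc L (TO MC X Y)) (levelwise A (\<lambda>n. dat (f n) (TO MC X Y)))) n \<odot> aw K X Y n p r a b
    = aw L X Y n p r a b \<odot> TA MA (dat (dat (f p) X) a) (dat (dat (f r) Y) b)"
proof -
  let ?XY = "TO MC X Y" and ?q = "p + r"
  let ?F = "dat (tot_map A (sdc K ?XY) (sdc L ?XY) (levelwise A (\<lambda>n. dat (f n) ?XY))) n"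
  let ?K = "cso K ?q" and ?L = "cso L ?q"
  let ?kc = "TA MA (dat (dat (last_cofaces D K p r) X) a) (dat (dat (zeroth_cofaces D K r p) Y) b)"
  let ?lc = "TA MA (dat (dat (last_cofaces D L p r) X) a) (dat (dat (zeroth_cofaces D L r p) Y) b)"
  let ?ki = "tens_in A MA (FO ?K X) (FO ?K Y) (a + b) a" and ?li = "tens_in A MA (FO ?L X) (FO ?L Y) (a + b) a"
  note fs = cosimp_map_simps[OF f]
  have XY: "?XY \<in> Obj C" using X by simp
  have lh: "dcx_hom A (sdc K ?XY) (sdc L ?XY) (levelwise A (\<lambda>n. dat (f n) ?XY))"
    by (rule levelwise_hom) (use K L fs XY in simp_all)
  note Fs = A.tot_map_simps(1-3)[OF pre_dcx_saw[OF K XY] pre_dcx_saw[OF L XY] lh]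
  note kp = aw_parts(1-3)[OF K X, of p r a] aw_parts(4-6)[OF K X, of r p b]
    and lp = aw_parts(1-3)[OF L X, of p r a] aw_parts(4-6)[OF L X, of r p b]
  have fa: "dat (f k) U \<in> Arr Ch" "Dom Ch (dat (f k) U) = FO (cso K k) U" "Cod Ch (dat (f k) U) = FO (cso L k) U"
    if "U \<in> Obj C" for k U
    using that fs by simp_all
  have o: "FO ?K X \<in> Obj Ch" "FO ?K Y \<in> Obj Ch" "FO ?L X \<in> Obj Ch" "FO ?L Y \<in> Obj Ch"
    using K L X by simp_all
  have kk: "dat (FK ?K X Y) (a + b) \<in> Arr A" "Dom A (dat (FK ?K X Y) (a + b)) = bob (tsum A (tens_dcx A MA (FO ?K X) (FO ?K Y)) (a + b))"
    "Cod A (dat (FK ?K X Y) (a + b)) = cob (FO ?K ?XY) (a + b)"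
    and ll: "dat (FK ?L X Y) (a + b) \<in> Arr A" "Dom A (dat (FK ?L X Y) (a + b)) = bob (tsum A (tens_dcx A MA (FO ?L X) (FO ?L Y)) (a + b))"
    "Cod A (dat (FK ?L X Y) (a + b)) = cob (FO ?L ?XY) (a + b)"
    using K L X by simp_all
  have si: "saw_in A K ?XY n ?q \<in> Arr A" "Dom A (saw_in A K ?XY n ?q) = cob (FO ?K ?XY) (a + b)"
    "saw_in A L ?XY n ?q \<in> Arr A" "Dom A (saw_in A L ?XY n ?q) = cob (FO ?L ?XY) (a + b)"
    "Cod A (saw_in A K ?XY n ?q) = bob (tsum A (sdc K ?XY) n)"
    using K L XY n by simp_all
  note ti = A.tens_in_simps(1-3)[OF o(1,2)] A.tens_in_simps(1-3)[OF o(3,4)]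
  have 1: "?F \<odot> saw_in A K ?XY n ?q = saw_in A L ?XY n ?q \<odot> dat (dat (f ?q) ?XY) (a + b)"
    using tot_map_saw_in[OF K L XY XY lh, of n ?q] n by simp
  have 2: "dat (dat (f ?q) ?XY) (a + b) \<odot> dat (FK ?K X Y) (a + b)
     = dat (FK ?L X Y) (a + b) \<odot> dat (TA N (dat (f ?q) X) (dat (f ?q) Y)) (a + b)"
    using arg_cong[OF D_arr_mon[OF fs(1) X, of ?q], of "\<lambda>u. dat u (a + b)"] by (simp add: fs)
  have 3: "dat (TA N (dat (f ?q) X) (dat (f ?q) Y)) (a + b) \<odot> ?ki
     = ?li \<odot> TA MA (dat (dat (f ?q) X) a) (dat (dat (f ?q) Y) b)"
    using A.TA_ch_simps(4)[OF fa(1)[OF X(1)] fa(1)[OF X(2)], of ?q ?q "a + b" a] by (simp add: fa X)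
  have ta: "dat (TA N (dat (f ?q) X) (dat (f ?q) Y)) (a + b) \<in> Arr A"
     "Dom A (dat (TA N (dat (f ?q) X) (dat (f ?q) Y)) (a + b)) = bob (tsum A (tens_dcx A MA (FO ?K X) (FO ?K Y)) (a + b))"
     "Cod A (dat (TA N (dat (f ?q) X) (dat (f ?q) Y)) (a + b)) = bob (tsum A (tens_dcx A MA (FO ?L X) (FO ?L Y)) (a + b))"
    using A.TA_ch_simps(1-3)[OF fa(1)[OF X(1)] fa(1)[OF X(2)], of ?q ?q "a + b"] by (simp_all add: fa X)
  have l4: "dat (dat (f ?q) X) a \<odot> dat (dat (last_cofaces D K p r) X) a
      = dat (dat (last_cofaces D L p r) X) a \<odot> dat (dat (f p) X) a"
    using arg_cong[OF last_cofaces_nat[OF K L f, of p r], of "\<lambda>u. dat (dat u X) a"] X by simp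
  have r4: "dat (dat (f ?q) Y) b \<odot> dat (dat (zeroth_cofaces D K r p) Y) b
      = dat (dat (zeroth_cofaces D L r p) Y) b \<odot> dat (dat (f r) Y) b"
    using arg_cong[OF zeroth_cofaces_nat[OF K L f, of r p], of "\<lambda>u. dat (dat u Y) b"] X by (simp add: add.commute[of r p])
  have 4: "TA MA (dat (dat (f ?q) X) a) (dat (dat (f ?q) Y) b) \<odot> ?kc
      = ?lc \<odot> TA MA (dat (dat (f p) X) a) (dat (dat (f r) Y) b)"
    using kp lp fa[OF X(1)] fa[OF X(2)] by (simp add: A.tensor_comp_arr l4 r4)
  have kc: "?kc \<in> Arr A" "Cod A ?kc = TO MA (cob (FO ?K X) a) (cob (FO ?K Y) b)"
    and lc: "?lc \<in> Arr A" "Cod A ?lc = TO MA (cob (FO ?L X) a) (cob (FO ?L Y) b)"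
     "Dom A ?lc = TO MA (cob (FO (cso L p) X) a) (cob (FO (cso L r) Y) b)"
    using kp lp by simp_all
  have tf: "TA MA (dat (dat (f ?q) X) a) (dat (dat (f ?q) Y) b) \<in> Arr A"
    "Dom A (TA MA (dat (dat (f ?q) X) a) (dat (dat (f ?q) Y) b)) = TO MA (cob (FO ?K X) a) (cob (FO ?K Y) b)"
    "Cod A (TA MA (dat (dat (f ?q) X) a) (dat (dat (f ?q) Y) b)) = TO MA (cob (FO ?L X) a) (cob (FO ?L Y) b)"
    using fa[OF X(1)] fa[OF X(2)] by simp_all
  have "?F \<odot> aw K X Y n p r a b = (saw_in A L ?XY n ?q \<odot> dat (dat (f ?q) ?XY) (a + b)) \<odot> dat (FK ?K X Y) (a + b) \<odot> ?ki \<odot> ?kc"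
    unfolding aw_def by (rule A.comp_reduce[OF 1]) (use kk ti kc si Fs in simp_all)
  also have "\<dots> = saw_in A L ?XY n ?q \<odot> dat (dat (f ?q) ?XY) (a + b) \<odot> dat (FK ?K X Y) (a + b) \<odot> ?ki \<odot> ?kc"
    by (rule A.comp_assoc_arr) (use kk ti kc si fa[OF XY] in simp_all)
  also have "dat (dat (f ?q) ?XY) (a + b) \<odot> dat (FK ?K X Y) (a + b) \<odot> ?ki \<odot> ?kc =
      (dat (FK ?L X Y) (a + b) \<odot> dat (TA N (dat (f ?q) X) (dat (f ?q) Y)) (a + b)) \<odot> ?ki \<odot> ?kc"
    by (rule A.comp_reduce[OF 2]) (use kk ti kc fa[OF XY] in simp_all)
  also have "\<dots> = dat (FK ?L X Y) (a + b) \<odot> dat (TA N (dat (f ?q) X) (dat (f ?q) Y)) (a + b) \<odot> ?ki \<odot> ?kc"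
    by (rule A.comp_assoc_arr) (use ll ti kc ta in simp_all)
  also have "dat (TA N (dat (f ?q) X) (dat (f ?q) Y)) (a + b) \<odot> ?ki \<odot> ?kc
     = (?li \<odot> TA MA (dat (dat (f ?q) X) a) (dat (dat (f ?q) Y) b)) \<odot> ?kc"
    by (rule A.comp_reduce[OF 3]) (use ti kc ta in simp_all)
  also have "\<dots> = ?li \<odot> TA MA (dat (dat (f ?q) X) a) (dat (dat (f ?q) Y) b) \<odot> ?kc"
    by (rule A.comp_assoc_arr) (use ti kc tf in simp_all)
  also have "\<dots> = ?li \<odot> ?lc \<odot> TA MA (dat (dat (f p) X) a) (dat (dat (f r) Y) b)"
    unfolding 4 ..
  finally have "?F \<odot> aw K X Y n p r a b = saw_in A L ?XY n ?q \<odot> dat (FK ?L X Y) (a + b) \<odot> ?li \<odot> ?lc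
     \<odot> TA MA (dat (dat (f p) X) a) (dat (dat (f r) Y) b)" .
  then show ?thesis
    using aw_comp[OF L X n, of "TA MA (dat (dat (f p) X) a) (dat (dat (f r) Y) b)"]
      fa[OF X(1), of p] fa[OF X(2), of r] by simp
qed

text \<open>Horizontally, composition with a component of \<open>f\<close> is additive and can be
  moved inside the alternating sum of cofaces, whose terms agree because \<open>f\<close> commutes
  with each coface. Vertically, each component is a chain map.\<close>

lemma levelwise_dcx_map:
  assumes K: "admissible K" and L: "admissible L" and f: "is_cosimp_map D K L f" and X: "X \<in> Obj C"
  shows "dcx_map A (sdc K X) (sdc L X) (levelwise A (\<lambda>n. dat (f n) X))"
  unfolding dcx_map_def
proof (intro conjI allI)
  let ?f = "levelwise A (\<lambda>n. dat (f n) X)"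
  note fs = cosimp_map_simps[OF f]
  have fa: "dat (f n) X \<in> Arr Ch" "Dom Ch (dat (f n) X) = FO (cso K n) X" "Cod Ch (dat (f n) X) = FO (cso L n) X" for n
    using fs X by simp_all
  show h: "dcx_hom A (sdc K X) (sdc L X) ?f"
    by (rule levelwise_hom[OF K L X X]) (simp_all add: fa)
  note hs = A.dcx_hom_simps[OF h]
  have P: "pre_dcx A (sdc K X)" "pre_dcx A (sdc L X)" using K L X by simp_all
  fix p q
  show "dhor (sdc L X) p q \<odot> ?f p q = ?f (p + 1) q \<odot> dhor (sdc K X) p q"
  proof (cases "p < 0")
    case True
    then show ?thesis using P hs[of p q] hs[of "p + 1" q]
      by (simp add: saw_dcx_simps(2))
  next
    case False
    define n where "n = nat p"
    have p: "nat p = n" "nat (p + 1) = Suc n" "\<not> p < 0" "\<not> p + 1 < 0" using False by (auto simp: n_def)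
    let ?O = "\<lambda>K n. cob (FO (cso K n) X) q"
    have o: "?O K n \<in> Obj A" "?O L n \<in> Obj A" for n using K L X by simp_all
    let ?S = "{..n + 1}"
    let ?t = "\<lambda>K i. sgn_arr A (int i) (dat (dat (cface K n i) X) q)"
    have ds: "dob (sdc K X) p q = ?O K n" "dob (sdc L X) p q = ?O L n"
      "dob (sdc K X) (p + 1) q = ?O K (Suc n)" "dob (sdc L X) (p + 1) q = ?O L (Suc n)"
      using p by (simp_all add: saw_dcx_simps(1))
    have dK: "dhor (sdc K X) p q = finprod (hom_group A (?O K n) (?O K (Suc n))) (?t K) ?S"
      and dL: "dhor (sdc L X) p q = finprod (hom_group A (?O L n) (?O L (Suc n))) (?t L) ?S"
      unfolding saw_dcx_simps(2) ds p(1) if_not_P[OF p(3)] by (rule refl)+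
    have fp: "?f p q = dat (dat (f n) X) q" "?f (p + 1) q = dat (dat (f (Suc n)) X) q"
      using p by (simp_all add: levelwise_def)
    have tK: "?t K i \<in> Hom A (?O K n) (?O K (Suc n))" and tL: "?t L i \<in> Hom A (?O L n) (?O L (Suc n))"
      if "i \<in> ?S" for i
      using that K L X by (simp_all add: mem_Hom)
    have d1: "dat (dat (f n) X) q \<in> Arr A" "Dom A (dat (dat (f n) X) q) = ?O K n"
      "Cod A (dat (dat (f n) X) q) = ?O L n" for n
      using fa by simp_all
    have "dhor (sdc L X) p q \<odot> ?f p q = finprod (hom_group A (?O K n) (?O L (Suc n))) (\<lambda>i. ?t L i \<odot> dat (dat (f n) X) q) ?S"
      unfolding dL fp
      by (rule A.additive_finprod[where h = "\<lambda>u. u \<odot> dat (dat (f n) X) q"])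
        (use o d1[of n] tL in \<open>simp_all add: mem_Hom\<close>)
    also have "\<dots> = finprod (hom_group A (?O K n) (?O L (Suc n))) (\<lambda>i. dat (dat (f (Suc n)) X) q \<odot> ?t K i) ?S"
    proof (rule comm_monoid.finprod_cong'[OF A.hg_monoid[OF o]])
      show "(\<lambda>i. dat (dat (f (Suc n)) X) q \<odot> ?t K i) \<in> ?S \<rightarrow> carrier (hom_group A (?O K n) (?O L (Suc n)))"
        using tK d1[of "Suc n"] by (auto simp: mem_Hom)
      fix i assume i: "i \<in> ?S"
      have "dat (dat (f (Suc n)) X) q \<odot> dat (dat (cface K n i) X) q = dat (dat (cface L n i) X) q \<odot> dat (dat (f n) X) q"
        using arg_cong[OF cosimp_map_face[OF f, of i n], of "\<lambda>u. dat (dat u X) q"] i X by simp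
      then show "?t L i \<odot> dat (dat (f n) X) q = dat (dat (f (Suc n)) X) q \<odot> ?t K i"
        using K L X i d1[of n] d1[of "Suc n"] by simp
    qed simp
    also have "\<dots> = ?f (p + 1) q \<odot> dhor (sdc K X) p q"
      unfolding dK fp
      by (rule A.additive_finprod[where h = "\<lambda>u. dat (dat (f (Suc n)) X) q \<odot> u", symmetric])
        (use o d1[of "Suc n"] tK in \<open>simp_all add: mem_Hom\<close>)
    finally show ?thesis .
  qed
  show "dver (sdc L X) p q \<odot> ?f p q = ?f p (q + 1) \<odot> dver (sdc K X) p q"
  proof (cases "p < 0")
    case True
    then show ?thesis using P hs[of p q] hs[of p "q + 1"]
      by (simp add: saw_dcx_simps(3))
  next
    case False
    then show ?thesis using A.ch_arr(4)[OF fa(1), of "nat p" q] by (simp add: saw_dcx_simps(3) levelwise_def fa)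
  qed
qed

section \<open>The simple functor on morphisms\<close>

lemma saw_map_ch:
  assumes K: "admissible K" and L: "admissible L" and f: "is_cosimp_map D K L f" and X: "X \<in> Obj C"
  shows "tot_map A (sdc K X) (sdc L X) (levelwise A (\<lambda>n. dat (f n) X)) \<in> Hom Ch (tot A (sdc K X)) (tot A (sdc L X))"
proof (rule A.ch_homI)
  note d = levelwise_dcx_map[OF assms]
  then have h: "dcx_hom A (sdc K X) (sdc L X) (levelwise A (\<lambda>n. dat (f n) X))" by (simp add: dcx_map_def)
  note P = pre_dcx_saw[OF K X] pre_dcx_saw[OF L X]
  fix n
  show "dat (tot_map A (sdc K X) (sdc L X) (levelwise A (\<lambda>n. dat (f n) X))) n \<in> Hom A (cob (tot A (sdc K X)) n) (cob (tot A (sdc L X)) n)"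
    using A.tot_map_simps(1-3)[OF P h] by (simp add: mem_Hom)
  show "cdf (tot A (sdc L X)) n \<odot> dat (tot_map A (sdc K X) (sdc L X) (levelwise A (\<lambda>n. dat (f n) X))) n =
         dat (tot_map A (sdc K X) (sdc L X) (levelwise A (\<lambda>n. dat (f n) X))) (n + 1) \<odot> cdf (tot A (sdc K X)) n"
    by (rule A.tot_map_chain[OF P d])
qed (use K L X in simp_all)

text \<open>The Koszul sign in the Kuenneth morphism depends only on degrees, which a cosimplicial
  map preserves. Restricted to a summand, monoidality therefore reduces to \<open>aw_nat\<close>,
  and \<open>saw_kunneth_ext\<close> assembles the summands.\<close>

lemma saw_map_arr:
  assumes K: "admissible K" and L: "admissible L" and f: "is_cosimp_map D K L f"
  shows "saw_map C MC A MA K L f \<in> Arr D" "Dom D (saw_map C MC A MA K L f) = saw K"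
    "Cod D (saw_map C MC A MA K L f) = saw L"
proof -
  let ?s = "saw_map C MC A MA K L f"
  let ?F = "\<lambda>X. tot_map A (sdc K X) (sdc L X) (levelwise A (\<lambda>n. dat (f n) X))"
  note fs = cosimp_map_simps[OF f]
  have o: "saw K \<in> Obj D" "saw L \<in> Obj D" using K L by (simp_all add: admissible_def)
  have h: "dat ?s X \<in> Hom Ch (FO (saw K) X) (FO (saw L) X)" if "X \<in> Obj C" for X
    using saw_map_ch[OF assms that] that by (simp add: saw_map_simps saw_simps)
  have fh: "dcx_hom A (sdc K X) (sdc L X) (levelwise A (\<lambda>n. dat (f n) X))" if "X \<in> Obj C" for X
    using levelwise_dcx_map[OF assms that] by (simp add: dcx_map_def)
  have n: "dat ?s (Dom C g) \<cdot>\<^bsub>Ch\<^esub> FM (saw K) g = FM (saw L) g \<cdot>\<^bsub>Ch\<^esub> dat ?s (Cod C g)" if g: "g \<in> Arr C" for g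
  proof -
    let ?U = "Cod C g" and ?V = "Dom C g"
    have UV: "?U \<in> Obj C" "?V \<in> Obj C" using g by simp_all
    have gh: "dcx_hom A (sdc K ?U) (sdc K ?V) (levelwise A (\<lambda>n. FM (cso K n) g))"
      "dcx_hom A (sdc L ?U) (sdc L ?V) (levelwise A (\<lambda>n. FM (cso L n) g))"
      by (rule levelwise_hom; use K L g in simp)+
    \<comment> \<open>Both composites are shown to be the total map of this diagonal family;
      naturality of each \<open>f n\<close>, in the form of the fact \<open>e\<close>, identifies
      the two.\<close>
    let ?c = "levelwise A (\<lambda>n. dat (f n) ?V \<cdot>\<^bsub>Ch\<^esub> FM (cso K n) g)"
    have e: "dat (f n) ?V \<cdot>\<^bsub>Ch\<^esub> FM (cso K n) g = FM (cso L n) g \<cdot>\<^bsub>Ch\<^esub> dat (f n) ?U" for n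
      using D_arr_nat[OF fs(1) g, of n] by (simp add: fs)
    have "dat (?F ?V) n \<odot> dat (FM (saw K) g) n = dat (tot_map A (sdc K ?U) (sdc L ?V) ?c) n" for n
      unfolding saw_simps(2)[OF g]
      by (rule A.tot_map_comp) (use K L UV gh fh[OF UV(2)] in \<open>simp_all add: levelwise_comp\<close>)
    moreover have "dat (FM (saw L) g) n \<odot> dat (?F ?U) n = dat (tot_map A (sdc K ?U) (sdc L ?V) ?c) n" for n
      unfolding saw_simps(2)[OF g]
      by (rule A.tot_map_comp) (use K L UV gh fh[OF UV(1)] in \<open>simp_all add: levelwise_comp e\<close>)
    ultimately show ?thesis using g UV by (simp add: saw_map_simps saw_simps ch_comp)
  qed
  have m: "dat ?s (TO MC X Y) \<cdot>\<^bsub>Ch\<^esub> FK (saw K) X Y = FK (saw L) X Y \<cdot>\<^bsub>Ch\<^esub> TA N (dat ?s X) (dat ?s Y)"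
    if X: "X \<in> Obj C" "Y \<in> Obj C" for X Y
  proof (rule A.ch_ext)
    let ?XY = "TO MC X Y"
    have XY: "?XY \<in> Obj C" using X by simp
    note hX = h[OF X(1), unfolded mem_Hom] and hY = h[OF X(2), unfolded mem_Hom] and hXY = h[OF XY, unfolded mem_Hom]
    show "dat ?s (TO MC X Y) \<cdot>\<^bsub>Ch\<^esub> FK (saw K) X Y \<in> Arr Ch" "FK (saw L) X Y \<cdot>\<^bsub>Ch\<^esub> TA N (dat ?s X) (dat ?s Y) \<in> Arr Ch"
      "Dom Ch (dat ?s (TO MC X Y) \<cdot>\<^bsub>Ch\<^esub> FK (saw K) X Y) = Dom Ch (FK (saw L) X Y \<cdot>\<^bsub>Ch\<^esub> TA N (dat ?s X) (dat ?s Y))"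
      "Cod Ch (dat ?s (TO MC X Y) \<cdot>\<^bsub>Ch\<^esub> FK (saw K) X Y) = Cod Ch (FK (saw L) X Y \<cdot>\<^bsub>Ch\<^esub> TA N (dat ?s X) (dat ?s Y))"
      using o X hX hY hXY by simp_all
    fix n
    let ?kK = "dat (saw_kunneth C MC A MA K X Y) n" and ?kL = "dat (saw_kunneth C MC A MA L X Y) n"
    let ?T = "dat (TA N (?F X) (?F Y)) n"
    let ?ti = "\<lambda>K m. tens_in A MA (tot A (sdc K X)) (tot A (sdc K Y)) n m"
    note kK = kunneth_arr[OF K X, of n] and kL = kunneth_arr[OF L X, of n]
    have FX: "?F X \<in> Arr Ch" "Dom Ch (?F X) = tot A (sdc K X)" "Cod Ch (?F X) = tot A (sdc L X)"
      and FY: "?F Y \<in> Arr Ch" "Dom Ch (?F Y) = tot A (sdc K Y)" "Cod Ch (?F Y) = tot A (sdc L Y)"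
      and FXY: "?F ?XY \<in> Arr Ch" "Dom Ch (?F ?XY) = tot A (sdc K ?XY)" "Cod Ch (?F ?XY) = tot A (sdc L ?XY)"
      using saw_map_ch[OF assms X(1)] saw_map_ch[OF assms X(2)] saw_map_ch[OF assms XY] by (simp_all add: mem_Hom)
    note T = A.TA_ch_simps[OF FX(1) FY(1), unfolded FX(2,3) FY(2,3)]
    have oo: "tot A (sdc K X) \<in> Obj Ch" "tot A (sdc K Y) \<in> Obj Ch" "tot A (sdc L X) \<in> Obj Ch" "tot A (sdc L Y) \<in> Obj Ch"
      using K L X by simp_all
    have Fn: "dat (?F U) k \<in> Arr A" "Dom A (dat (?F U) k) = bob (tsum A (sdc K U) k)" "Cod A (dat (?F U) k) = bob (tsum A (sdc L U) k)"
      if "U \<in> Obj C" for U k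
      using A.tot_map_simps(1-3)[OF pre_dcx_saw[OF K that] pre_dcx_saw[OF L that] fh[OF that]] by simp_all
    have "dat (?F ?XY) n \<odot> ?kK = ?kL \<odot> ?T"
    proof (rule saw_kunneth_ext[OF K X])
      fix m p r
      let ?a = "m - int p" and ?b = "n - m - int r"
      let ?in = "\<lambda>K. TA MA (saw_in A K X m p) (saw_in A K Y (n - m) r)"
      let ?ff = "TA MA (dat (dat (f p) X) ?a) (dat (dat (f r) Y) ?b)"
      have nn: "n - int (p + r) = ?a + ?b" by simp
      have inK: "?in K \<in> Arr A" "Cod A (?in K) = TO MA (bob (tsum A (sdc K X) m)) (bob (tsum A (sdc K Y) (n - m)))"
        and inL: "?in L \<in> Arr A" "Cod A (?in L) = TO MA (bob (tsum A (sdc L X) m)) (bob (tsum A (sdc L Y) (n - m)))"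
         "Dom A (?in L) = TO MA (cob (FO (cso L p) X) ?a) (cob (FO (cso L r) Y) ?b)"
        using K L X by simp_all
      have ff: "?ff \<in> Arr A" "Cod A ?ff = TO MA (cob (FO (cso L p) X) ?a) (cob (FO (cso L r) Y) ?b)"
        "Dom A ?ff = TO MA (cob (FO (cso K p) X) ?a) (cob (FO (cso K r) Y) ?b)"
        using fs X by simp_all
      note tiK = A.tens_in_simps(1-3)[OF oo(1,2), of n m] and tiL = A.tens_in_simps(1-3)[OF oo(3,4), of n m]
      note awK = aw_arr[OF K X nn] and awL = aw_arr[OF L X nn]
      have 1: "(dat (?F ?XY) n \<odot> ?kK) \<odot> ?ti K m \<odot> ?in K = sgn_arr A (?a * int r) (aw L X Y n p r ?a ?b \<odot> ?ff)"
      proof -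
        have "(dat (?F ?XY) n \<odot> ?kK) \<odot> ?ti K m \<odot> ?in K = dat (?F ?XY) n \<odot> ?kK \<odot> ?ti K m \<odot> ?in K"
          by (rule A.comp_assoc_arr) (use kK(1-3) tiK inK Fn[OF XY] in simp_all)
        also have "\<dots> = sgn_arr A (?a * int r) (dat (?F ?XY) n \<odot> aw K X Y n p r ?a ?b)"
          unfolding kK(4) by (rule A.comp_sgn(1)) (use awK Fn[OF XY] in simp_all)
        finally show ?thesis unfolding aw_nat[OF K L f X nn] .
      qed
      have FFin: "TA MA (dat (?F X) m) (dat (?F Y) (n - m)) \<odot> ?in K = ?in L \<odot> ?ff"
        using tot_map_saw_in[OF K L X(1,1) fh[OF X(1)], of m p] tot_map_saw_in[OF K L X(2,2) fh[OF X(2)], of "n - m" r]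
          Fn[OF X(1), of m] Fn[OF X(2), of "n - m"] K L X fs by (simp add: A.tensor_comp_arr)
      have FF: "TA MA (dat (?F X) m) (dat (?F Y) (n - m)) \<in> Arr A"
        "Dom A (TA MA (dat (?F X) m) (dat (?F Y) (n - m))) = TO MA (bob (tsum A (sdc K X) m)) (bob (tsum A (sdc K Y) (n - m)))"
        "Cod A (TA MA (dat (?F X) m) (dat (?F Y) (n - m))) = TO MA (bob (tsum A (sdc L X) m)) (bob (tsum A (sdc L Y) (n - m)))"
        using Fn[OF X(1), of m] Fn[OF X(2), of "n - m"] by simp_all
      have "(?kL \<odot> ?T) \<odot> ?ti K m \<odot> ?in K = ?kL \<odot> ?T \<odot> ?ti K m \<odot> ?in K"
        by (rule A.comp_assoc_arr) (use kL(1-3) tiK inK T(1-3)[of n] in simp_all)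
      also have "?T \<odot> ?ti K m \<odot> ?in K = (?ti L m \<odot> TA MA (dat (?F X) m) (dat (?F Y) (n - m))) \<odot> ?in K"
        by (rule A.comp_reduce[OF T(4)]) (use tiK inK T(1-3)[of n] in simp_all)
      also have "\<dots> = ?ti L m \<odot> ?in L \<odot> ?ff"
        unfolding FFin[symmetric] by (rule A.comp_assoc_arr) (use tiL inK FF in simp_all)
      also have "?kL \<odot> ?ti L m \<odot> ?in L \<odot> ?ff = (?kL \<odot> ?ti L m \<odot> ?in L) \<odot> ?ff"
        using kL(1-3) tiL inL ff by simp
      also have "\<dots> = sgn_arr A (?a * int r) (aw L X Y n p r ?a ?b \<odot> ?ff)"
        unfolding kL(4) by (rule A.comp_sgn(2)) (use awL ff in simp_all)
      finally show "(dat (?F ?XY) n \<odot> ?kK) \<odot> ?ti K m \<odot> ?in K = (?kL \<odot> ?T) \<odot> ?ti K m \<odot> ?in K"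
        unfolding 1 by (rule sym)
    qed (use kK(1-3) kL(1-3) Fn[OF XY] T(1-3)[of n] in simp_all)
    then show "dat (dat ?s (TO MC X Y) \<cdot>\<^bsub>Ch\<^esub> FK (saw K) X Y) n = dat (FK (saw L) X Y \<cdot>\<^bsub>Ch\<^esub> TA N (dat ?s X) (dat ?s Y)) n"
      using X by (simp add: saw_map_simps saw_simps)
  qed
  have u: "dat ?s (TU MC) \<cdot>\<^bsub>Ch\<^esub> FU (saw K) = FU (saw L)"
  proof (rule A.ch_ext)
    note hU = h[OF C.unit_obj, unfolded mem_Hom]
    show "dat ?s (TU MC) \<cdot>\<^bsub>Ch\<^esub> FU (saw K) \<in> Arr Ch" "FU (saw L) \<in> Arr Ch"
      "Dom Ch (dat ?s (TU MC) \<cdot>\<^bsub>Ch\<^esub> FU (saw K)) = Dom Ch (FU (saw L))"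
      "Cod Ch (dat ?s (TU MC) \<cdot>\<^bsub>Ch\<^esub> FU (saw K)) = Cod Ch (FU (saw L))"
      using o hU by simp_all
    fix n
    let ?U = "TU MC"
    have U: "?U \<in> Obj C" by simp
    note Fs = A.tot_map_simps(1-3)[OF pre_dcx_saw[OF K U] pre_dcx_saw[OF L U] fh[OF U], of n]
    have fu: "dat (dat (f 0) ?U) n \<odot> dat (FU (cso K 0)) n = dat (FU (cso L 0)) n"
      using arg_cong[OF D_arr_unit[OF fs(1), of 0], of "\<lambda>u. dat u n"] by (simp add: fs)
    have "dat (?F ?U) n \<odot> saw_in A K ?U n 0 \<odot> dat (FU (cso K 0)) n
      = (saw_in A L ?U n 0 \<odot> dat (dat (f 0) ?U) n) \<odot> dat (FU (cso K 0)) n"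
      using tot_map_saw_in[OF K L U U fh[OF U], of n 0]
      by (intro A.comp_reduce) (use K Fs in simp_all)
    also have "\<dots> = saw_in A L ?U n 0 \<odot> dat (dat (f 0) ?U) n \<odot> dat (FU (cso K 0)) n"
      by (rule A.comp_assoc_arr) (use K L fs in simp_all)
    finally show "dat (dat ?s (TU MC) \<cdot>\<^bsub>Ch\<^esub> FU (saw K)) n = dat (FU (saw L)) n"
      unfolding fu by (simp add: saw_map_simps saw_simps saw_coaug_def)
  qed
  show "?s \<in> Arr D" "Dom D ?s = saw K" "Cod D ?s = saw L"
    by (rule D_arrI[OF o saw_map_simps(1-3) h n m u]; assumption)+
qed

lemma saw_map_comp:
  assumes K: "admissible K" and L: "admissible L" and M: "admissible M" and f: "is_cosimp_map D K L f" and g: "is_cosimp_map D L M g"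
    and h: "is_cosimp_map D K M h" "\<And>n. h n = g n \<cdot>\<^bsub>D\<^esub> f n"
  shows "saw_map C MC A MA L M g \<cdot>\<^bsub>D\<^esub> saw_map C MC A MA K L f = saw_map C MC A MA K M h"
proof (rule D_ext)
  note s = saw_map_arr[OF K L f] saw_map_arr[OF L M g] saw_map_arr[OF K M h(1)]
  show "saw_map C MC A MA L M g \<cdot>\<^bsub>D\<^esub> saw_map C MC A MA K L f \<in> Arr D" "saw_map C MC A MA K M h \<in> Arr D"
    "Dom D (saw_map C MC A MA L M g \<cdot>\<^bsub>D\<^esub> saw_map C MC A MA K L f) = Dom D (saw_map C MC A MA K M h)"
    "Cod D (saw_map C MC A MA L M g \<cdot>\<^bsub>D\<^esub> saw_map C MC A MA K L f) = Cod D (saw_map C MC A MA K M h)"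
    using s by simp_all
  fix X assume X: "X \<in> Obj C"
  have hh: "dcx_hom A (sdc K X) (sdc L X) (levelwise A (\<lambda>n. dat (f n) X))" "dcx_hom A (sdc L X) (sdc M X) (levelwise A (\<lambda>n. dat (g n) X))"
    using levelwise_dcx_map[OF K L f X] levelwise_dcx_map[OF L M g X] by (simp_all add: dcx_map_def)
  have e: "dat (h n) X = dat (g n) X \<cdot>\<^bsub>Ch\<^esub> dat (f n) X" for n using X by (simp add: h(2))
  have "dat (tot_map A (sdc L X) (sdc M X) (levelwise A (\<lambda>n. dat (g n) X))) n \<odot> dat (tot_map A (sdc K X) (sdc L X) (levelwise A (\<lambda>n. dat (f n) X))) n
     = dat (tot_map A (sdc K X) (sdc M X) (levelwise A (\<lambda>n. dat (h n) X))) n" for n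
    by (rule A.tot_map_comp[OF pre_dcx_saw[OF K X] pre_dcx_saw[OF L X] pre_dcx_saw[OF M X] hh]) (simp add: levelwise_def e)
  then show "dat (saw_map C MC A MA L M g \<cdot>\<^bsub>D\<^esub> saw_map C MC A MA K L f) X = dat (saw_map C MC A MA K M h) X"
    using X by (simp add: saw_map_simps ch_comp prod_eq_iff fun_eq_iff)
qed

lemma saw_map_id:
  assumes K: "admissible K" and f: "is_cosimp_map D K K f" "\<And>n. f n = Id D (cso K n)"
  shows "saw_map C MC A MA K K f = Id D (saw K)"
proof (rule D_ext)
  note s = saw_map_arr[OF K K f(1)]
  have o: "saw K \<in> Obj D" using K by (simp add: admissible_def)
  show "saw_map C MC A MA K K f \<in> Arr D" "Id D (saw K) \<in> Arr D"
    "Dom D (saw_map C MC A MA K K f) = Dom D (Id D (saw K))"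
    "Cod D (saw_map C MC A MA K K f) = Cod D (Id D (saw K))"
    using s o by simp_all
  fix X assume X: "X \<in> Obj C"
  \<comment> \<open>In negative cosimplicial degree \<open>levelwise\<close> supplies a zero arrow,
    which must be recognised as the identity of the zero object.\<close>
  have z: "Id A (zero_obj A) = Zer A (zero_obj A) (zero_obj A)"
    using A.zero_obj_iff[of "zero_obj A"] by simp
  have "dat (tot_map A (sdc K X) (sdc K X) (levelwise A (\<lambda>n. dat (f n) X))) n = Id A (bob (tsum A (sdc K X) n))" for n
    by (rule A.tot_map_id[OF pre_dcx_saw[OF K X]]) (use X in \<open>simp add: levelwise_def f(2) saw_dcx_simps(1) z\<close>)
  then show "dat (saw_map C MC A MA K K f) X = dat (Id D (saw K)) X"
    using X by (simp add: saw_map_simps saw_simps ch_id prod_eq_iff fun_eq_iff)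
qed

end

context abelian_category
begin

section \<open>Zeroth cohomology\<close>

lemma kernel_mono:
  assumes "is_kernel A f k" "u \<in> Arr A" "v \<in> Arr A" "Cod A u = Dom A k" "Cod A v = Dom A k" "Dom A u = Dom A v"
    "k \<odot> u = k \<odot> v"
  shows "u = v"
proof -
  have k: "f \<in> Arr A" "k \<in> Arr A" "Cod A k = Dom A f" "f \<odot> k = Zer A (Dom A k) (Cod A f)"
    and ex: "\<And>h. \<lbrakk>h \<in> Arr A; Cod A h = Dom A f; f \<odot> h = Zer A (Dom A h) (Cod A f)\<rbrakk>
        \<Longrightarrow> \<exists>!u. u \<in> Hom A (Dom A h) (Dom A k) \<and> k \<odot> u = h"
    using assms(1) by (auto simp: is_kernel_def)
  have "f \<odot> (k \<odot> u) = Zer A (Dom A k) (Cod A f) \<odot> u"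
    by (rule comp_reduce[OF k(4)]) (use k assms in simp_all)
  then have "\<exists>!w. w \<in> Hom A (Dom A u) (Dom A k) \<and> k \<odot> w = k \<odot> u"
    using ex[of "k \<odot> u"] k assms(2,4) by simp
  moreover have "u \<in> Hom A (Dom A u) (Dom A k)" "v \<in> Hom A (Dom A u) (Dom A k)"
    using assms by (simp_all add: mem_Hom)
  ultimately show ?thesis using assms(7) by metis
qed

text \<open>\<open>cohomology\<close> is a choice, so its defining property needs a witness: since
  consecutive differentials compose to zero, the incoming one lifts to the kernel, and a cokernel of
  the lift completes the pair.\<close>

lemma cohomology_exists:
  assumes "X \<in> Obj Ch"
  shows "is_cohomology A X 0 (cohomology A X 0)"
proof -
  note x = ch_obj[OF assms]
  obtain k where k: "is_kernel A (cdf X 0) k" using ex_kernel x by blast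
  have dd: "cdf X 0 \<odot> cdf X (- 1) = Zer A (cob X (- 1)) (cob X 1)"
    using x(5)[of "- 1"] by simp
  have "\<exists>!u. u \<in> Hom A (Dom A (cdf X (- 1))) (Dom A k) \<and> k \<odot> u = cdf X (- 1)"
  proof -
    have "\<forall>h \<in> Arr A. Cod A h = Dom A (cdf X 0) \<and> cdf X 0 \<odot> h = Zer A (Dom A h) (Cod A (cdf X 0))
        \<longrightarrow> (\<exists>!u. u \<in> Hom A (Dom A h) (Dom A k) \<and> k \<odot> u = h)"
      using k by (simp add: is_kernel_def)
    from this[rule_format, OF x(2)[of "- 1"]] show ?thesis
      using x(3,4)[of "- 1"] x(3,4)[of 0] dd by simp
  qed
  then obtain b where b: "b \<in> Hom A (cob X (- 1)) (Dom A k)" "k \<odot> b = cdf X (- 1)"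
    using x by auto
  obtain q where "is_cokernel A b q" using ex_cokernel b(1) by (auto simp: mem_Hom)
  then have "is_cohomology A X 0 (k, q)" using k b by (auto simp: is_cohomology_def)
  then show ?thesis unfolding cohomology_def by (rule someI)
qed

text \<open>There is nothing in degree -1, so \<open>q\<close> is a cokernel of a zero arrow and
  hence invertible, with inverse \<open>u\<close>. The inclusion is then \<open>z \<odot> u\<close>,
  again a kernel of the differential in degree 0, and the last two claims are the two halves of that
  property.\<close>

lemma h0_incl_props:
  assumes X: "X \<in> Obj Ch" and v: "vanishes_below A 0 X"
  defines "j \<equiv> dat (h0_incl A X) 0"
  shows "coh_obj A X 0 \<in> Obj A" "j \<in> Arr A" "Dom A j = coh_obj A X 0" "Cod A j = cob X 0"
    "cdf X 0 \<odot> j = Zer A (coh_obj A X 0) (cob X 1)"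
    "\<And>u w. \<lbrakk>u \<in> Arr A; w \<in> Arr A; Cod A u = coh_obj A X 0; Cod A w = coh_obj A X 0; Dom A u = Dom A w;
      j \<odot> u = j \<odot> w\<rbrakk> \<Longrightarrow> u = w"
    "\<And>h. \<lbrakk>h \<in> Arr A; Cod A h = cob X 0; cdf X 0 \<odot> h = Zer A (Dom A h) (cob X 1)\<rbrakk> \<Longrightarrow>
      \<exists>g. g \<in> Hom A (Dom A h) (coh_obj A X 0) \<and> j \<odot> g = h"
proof -
  note x = ch_obj[OF X]
  let ?H = "coh_obj A X 0"
  define z where "z = fst (cohomology A X 0)"
  define q where "q = snd (cohomology A X 0)"
  have "is_cohomology A X 0 (z, q)" using cohomology_exists[OF X] by (simp add: z_def q_def)
  then obtain b where z: "is_kernel A (cdf X 0) z" and b: "b \<in> Hom A (cob X (- 1)) (Dom A z)"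
    and q: "is_cokernel A b q" by (auto simp: is_cohomology_def)
  have H: "?H = Cod A q" by (simp add: coh_obj_def q_def)
  have zs: "z \<in> Arr A" "Cod A z = cob X 0" "cdf X 0 \<odot> z = Zer A (Dom A z) (cob X 1)"
    using z x by (auto simp: is_kernel_def)
  have qs: "q \<in> Arr A" "Dom A q = Dom A z" using q b by (auto simp: is_cokernel_def mem_Hom)
  have b0: "b = Zer A (cob X (- 1)) (Dom A z)"
    using from_zero_obj[of b] v b by (simp add: vanishes_below_def mem_Hom)
  have cok: "\<exists>!u. u \<in> Hom A (Cod A q) (Cod A h) \<and> u \<odot> q = h" if "h \<in> Arr A" "Dom A h = Dom A z" for h
    using q that b b0 x zs by (auto simp: is_cokernel_def mem_Hom)
  obtain u where u: "u \<in> Arr A" "Dom A u = Cod A q" "Cod A u = Dom A z" "u \<odot> q = Id A (Dom A z)"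
    using cok[of "Id A (Dom A z)"] zs by (auto simp: mem_Hom)
  \<comment> \<open>Both sides agree after precomposition with \<open>q\<close>, and factorizations
    through a cokernel are unique.\<close>
  have qu: "q \<odot> u = Id A (Cod A q)"
  proof -
    have "(q \<odot> u) \<odot> q = q" "Id A (Cod A q) \<odot> q = q"
      using u qs zs by simp_all
    moreover have "q \<odot> u \<in> Hom A (Cod A q) (Cod A q)" "Id A (Cod A q) \<in> Hom A (Cod A q) (Cod A q)"
      using u qs by (simp_all add: mem_Hom)
    ultimately show ?thesis using cok[OF qs] by blast
  qed
  have "j = (THE j. j \<in> Hom A ?H (cob X 0) \<and> j \<odot> q = z)"
    by (simp add: j_def h0_incl_def z_def q_def)
  also have "\<dots> = z \<odot> u"
  proof (rule the_equality)
    show "z \<odot> u \<in> Hom A ?H (cob X 0) \<and> (z \<odot> u) \<odot> q = z"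
      using zs u qs by (simp add: H mem_Hom)
    fix y assume y: "y \<in> Hom A ?H (cob X 0) \<and> y \<odot> q = z"
    have "y = y \<odot> q \<odot> u" using y qu by (simp add: mem_Hom H)
    also have "\<dots> = (y \<odot> q) \<odot> u"
      by (rule comp_assoc_arr[symmetric]) (use y u qs in \<open>simp_all add: mem_Hom H\<close>)
    finally show "y = z \<odot> u" using y by simp
  qed
  finally have j: "j = z \<odot> u" .
  show "?H \<in> Obj A" "j \<in> Arr A" "Dom A j = ?H" "Cod A j = cob X 0"
    using zs u qs by (simp_all add: j H)
  have "cdf X 0 \<odot> (z \<odot> u) = Zer A (Dom A z) (cob X 1) \<odot> u"
    by (rule comp_reduce[OF zs(3)]) (use zs u x in simp_all)
  then show "cdf X 0 \<odot> j = Zer A ?H (cob X 1)" using u x by (simp add: j H)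
  show "s = w" if sw: "s \<in> Arr A" "w \<in> Arr A" "Cod A s = ?H" "Cod A w = ?H" "Dom A s = Dom A w" "j \<odot> s = j \<odot> w" for s w
  proof -
    have "u \<odot> s = u \<odot> w"
      by (rule kernel_mono[OF z]) (use sw u zs in \<open>simp_all add: H j\<close>)
    then have "q \<odot> (u \<odot> s) = q \<odot> (u \<odot> w)" by simp
    then show "s = w"
      using comp_reduce[OF qu, of s] comp_reduce[OF qu, of w] sw u qs by (simp add: H)
  qed
  show "\<exists>g. g \<in> Hom A (Dom A h) ?H \<and> j \<odot> g = h"
    if h: "h \<in> Arr A" "Cod A h = cob X 0" "cdf X 0 \<odot> h = Zer A (Dom A h) (cob X 1)" for h
  proof -
    have "\<exists>!v. v \<in> Hom A (Dom A h) (Dom A z) \<and> z \<odot> v = h"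
      using z h x(3,4)[of 0] by (simp add: is_kernel_def)
    then obtain v where v: "v \<in> Arr A" "Dom A v = Dom A h" "Cod A v = Dom A z" "z \<odot> v = h"
      by (auto simp: mem_Hom)
    have "j \<odot> (q \<odot> v) = h"
      using comp_reduce[OF u(4), of v] v u qs zs by (simp add: j)
    then show ?thesis using v qs by (intro exI[of _ "q \<odot> v"]) (simp add: mem_Hom H)
  qed
qed

lemma conc_simps: "cob (conc A Z) n = (if n = 0 then Z else zero_obj A)"
  "cdf (conc A Z) n = Zer A (cob (conc A Z) n) (cob (conc A Z) (n + 1))"
  by (simp_all add: conc_def Let_def)

lemma conc_obj: "Z \<in> Obj A \<Longrightarrow> conc A Z \<in> Obj Ch"
  by (auto simp: ch_cat_simps(1) is_complex_def conc_simps vanishes_below_def mem_Hom intro!: exI[of _ 0])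

lemma conc_zero: "n \<noteq> 0 \<Longrightarrow> is_zero_obj A (cob (conc A Z) n)"
  by (simp add: conc_simps)

lemma zero_parallel:
  assumes "f \<in> Arr A" "g \<in> Arr A" "Dom A f = Dom A g" "Cod A f = Cod A g"
    "is_zero_obj A (Dom A g) \<or> is_zero_obj A (Cod A g)"
  shows "f = g"
  using assms from_zero_obj[of f] from_zero_obj[of g] into_zero_obj[of f] into_zero_obj[of g] by metis

lemma h0_incl_hom:
  assumes X: "X \<in> Obj Ch" and v: "vanishes_below A 0 X"
  shows "h0 A X \<in> Obj Ch" "h0_incl A X \<in> Hom Ch (h0 A X) X"
proof -
  note x = ch_obj[OF X] and j = h0_incl_props[OF X v]
  show o: "h0 A X \<in> Obj Ch" using conc_obj[OF j(1)] by (simp add: h0_def)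
  note h = ch_obj[OF o]
  have hz: "is_zero_obj A (cob (h0 A X) n)" if "n \<noteq> 0" for n
    using conc_zero[OF that] by (simp add: h0_def)
  have ar: "dat (h0_incl A X) n \<in> Arr A \<and> Dom A (dat (h0_incl A X) n) = cob (h0 A X) n \<and> Cod A (dat (h0_incl A X) n) = cob X n" for n
  proof (cases "n = 0")
    case True
    then show ?thesis using j(2-4) by (simp add: h0_def conc_simps)
  next
    case False
    then show ?thesis using x h by (simp add: h0_incl_def)
  qed
  have "cdf X n \<odot> dat (h0_incl A X) n = dat (h0_incl A X) (n + 1) \<odot> cdf (h0 A X) n" for n
  proof (cases "n = 0")
    case True
    have "dat (h0_incl A X) 1 = Zer A (cob (h0 A X) 1) (cob X 1)" by (simp add: h0_incl_def)
    then show ?thesis using True j(5) x(1)[of 1] h(1-4)[of 0] h(1)[of 1] by (simp add: h0_def conc_simps)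
  next
    case False
    show ?thesis by (rule zero_parallel) (use ar x h hz[OF False] in simp_all)
  qed
  then show "h0_incl A X \<in> Hom Ch (h0 A X) X"
    by (intro ch_homI) (use o X ar in \<open>simp_all add: h0_incl_def mem_Hom\<close>)
qed

text \<open>Justifies each definite description in \<open>H0\<close>, with \<open>P\<close> in turn
  the degree 0 cohomology of a value, a tensor product of two of these, and the unit complex. As
  \<open>P\<close> lives in degree 0, its differential vanishes, so a chain map out of it lands in
  the kernel of the differential of \<open>X\<close>.\<close>

lemma h0_factor:
  assumes X: "X \<in> Obj Ch" and v: "vanishes_below A 0 X"
    and P: "\<And>n. n \<noteq> 0 \<Longrightarrow> is_zero_obj A (cob P n)" and f: "f \<in> Hom Ch P X"
  shows "\<exists>!g. g \<in> Hom Ch P (h0 A X) \<and> h0_incl A X \<cdot>\<^bsub>Ch\<^esub> g = f"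
proof -
  note x = ch_obj[OF X] and j = h0_incl_props[OF X v] and i = h0_incl_hom[OF X v]
  note h = ch_obj[OF i(1)]
  have f1: "f \<in> Arr Ch" "Dom Ch f = P" "Cod Ch f = X" using f by (simp_all add: mem_Hom)
  note fs = ch_arr[OF f1(1), unfolded f1(2,3)]
  have Po: "P \<in> Obj Ch" using f1 by (simp add: ch_cat_simps(2-4))
  note p = ch_obj[OF Po]
  have i1: "h0_incl A X \<in> Arr Ch" "Dom Ch (h0_incl A X) = h0 A X" "Cod Ch (h0_incl A X) = X"
    using i(2) by (simp_all add: mem_Hom)
  note iis = ch_arr[OF i1(1), unfolded i1(2,3)]
  have hz: "is_zero_obj A (cob (h0 A X) n)" if "n \<noteq> 0" for n
    using conc_zero[OF that] by (simp add: h0_def)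
  have h00: "cob (h0 A X) 0 = coh_obj A X 0" by (simp add: h0_def conc_simps)
  have "cdf P 0 = Zer A (cob P 0) (cob P 1)"
    by (rule zero_parallel) (use p(1-4)[of 0] p(1)[of 1] P[of 1] in simp_all)
  then have "cdf X 0 \<odot> dat f 0 = Zer A (Dom A (dat f 0)) (cob X 1)"
    using fs(4)[of 0] fs(1-3)[of 0] fs(1-3)[of 1] p(1)[of 0] by simp
  then obtain g0 where g0: "g0 \<in> Arr A" "Dom A g0 = cob P 0" "Cod A g0 = coh_obj A X 0" "dat (h0_incl A X) 0 \<odot> g0 = dat f 0"
    using j(7)[of "dat f 0"] fs(1-3)[of 0] by (auto simp: mem_Hom)
  define g where "g = (P, h0 A X, \<lambda>n. if n = 0 then g0 else Zer A (cob P n) (cob (h0 A X) n))"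
  have ga: "dat g n \<in> Arr A" "Dom A (dat g n) = cob P n" "Cod A (dat g n) = cob (h0 A X) n" for n
    using g0 p h by (auto simp: g_def h00)
  have gh: "g \<in> Hom Ch P (h0 A X)"
  proof (rule ch_homI)
    fix n
    show "cdf (h0 A X) n \<odot> dat g n = dat g (n + 1) \<odot> cdf P n"
    proof (rule zero_parallel)
      show "is_zero_obj A (Dom A (dat g (n + 1) \<odot> cdf P n)) \<or> is_zero_obj A (Cod A (dat g (n + 1) \<odot> cdf P n))"
        using ga p hz[of "n + 1"] P[of n] by (cases "n = 0") simp_all
    qed (use ga p h in simp_all)
    show "dat g n \<in> Hom A (cob P n) (cob (h0 A X) n)" using ga by (simp add: mem_Hom)
  qed (use Po i in \<open>simp_all add: g_def\<close>)
  interpret Ch: category Ch by (rule category_ch)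
  have "h0_incl A X \<cdot>\<^bsub>Ch\<^esub> g = f"
  proof (rule ch_ext)
    fix n
    show "dat (h0_incl A X \<cdot>\<^bsub>Ch\<^esub> g) n = dat f n"
    proof (cases "n = 0")
      case True
      then show ?thesis using g0 by (simp add: g_def)
    next
      case False
      show ?thesis by (rule zero_parallel) (use fs iis ga P[OF False] in simp_all)
    qed
  qed (use gh i1 f1 in \<open>simp_all add: mem_Hom\<close>)
  moreover have "g' = g" if g': "g' \<in> Hom Ch P (h0 A X)" "h0_incl A X \<cdot>\<^bsub>Ch\<^esub> g' = f" for g'
  proof (rule ch_ext)
    have g1: "g' \<in> Arr Ch" "Dom Ch g' = P" "Cod Ch g' = h0 A X" using g' by (simp_all add: mem_Hom)
    note gs = ch_arr[OF g1(1), unfolded g1(2,3)]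
    fix n
    show "dat g' n = dat g n"
    proof (cases "n = 0")
      case True
      have "dat (h0_incl A X) 0 \<odot> dat g' 0 = dat f 0" unfolding g'(2)[symmetric] by simp
      then have "dat g' 0 = g0" using j(6)[of "dat g' 0" g0] gs(1-3)[of 0] g0 by (simp add: h00)
      then show ?thesis using True by (simp add: g_def)
    next
      case False
      show ?thesis by (rule zero_parallel) (use gs ga P[OF False] in simp_all)
    qed
  qed (use gh g' in \<open>simp_all add: mem_Hom\<close>)
  ultimately show ?thesis using gh by blast
qed

end

context abelian_monoidal_category
begin

text \<open>If p + q = n is nonzero then p or q is nonzero, so each summand has a zero object as one
  of its factors.\<close>

lemma tens_conc_zero:
  assumes X: "X \<in> Obj Ch" "\<And>n. n \<noteq> 0 \<Longrightarrow> is_zero_obj A (cob X n)"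
    and Y: "Y \<in> Obj Ch" "\<And>n. n \<noteq> 0 \<Longrightarrow> is_zero_obj A (cob Y n)" and n: "n \<noteq> 0"
  shows "is_zero_obj A (bob (tsum A (tens_dcx A M X Y) n))"
proof -
  let ?S = "bob (tsum A (tens_dcx A M X Y) n)"
  note P = pre_dcx_tens[OF X(1) Y(1)]
  have S: "?S \<in> Obj A" using P by simp
  have "Id A ?S = Zer A ?S ?S"
  proof (rule tsum_ext[OF P])
    fix p
    have "is_zero_obj A (cob X p) \<or> is_zero_obj A (cob Y (n - p))"
      using X(2)[of p] Y(2)[of "n - p"] n by (cases "p = 0") simp_all
    then have "is_zero_obj A (TO M (cob X p) (cob Y (n - p)))"
      using tensor_zero_obj ch_obj(1)[OF X(1)] ch_obj(1)[OF Y(1)] by blast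
    then show "Id A ?S \<odot> bin (tsum A (tens_dcx A M X Y) n) p = Zer A ?S ?S \<odot> bin (tsum A (tens_dcx A M X Y) n) p"
      by (intro zero_parallel) (use P ch_obj(1)[OF X(1)] ch_obj(1)[OF Y(1)] in simp_all)
  qed (use S in simp_all)
  then show ?thesis using S by (simp add: zero_obj_iff)
qed

end

context mon_setting
begin

text \<open>That \<open>H0\<close> yields an object is a hypothesis; it is available as soon as a
  transformation \<alpha> between such functors is given. The properties that define the arrows of
  \<open>H0\<close> are then literally the naturality and monoidality equations of the
  inclusion.\<close>

lemma H0_incl_arr:
  assumes K: "K \<in> Obj D" and v: "vanishes_below_on C A 0 K" and H: "H0 C MC A MA K \<in> Obj D"
  shows "H0_incl C MC A MA K \<in> Arr D" "Dom D (H0_incl C MC A MA K) = H0 C MC A MA K"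
    "Cod D (H0_incl C MC A MA K) = K"
proof -
  let ?H = "H0 C MC A MA K" and ?i = "\<lambda>X. h0_incl A (FO K X)"
  have o: "FO K X \<in> Obj Ch" "vanishes_below A 0 (FO K X)" if "X \<in> Obj C" for X
    using K v that by (simp_all add: vanishes_below_on_def)
  have ii: "?i X \<in> Arr Ch" "Dom Ch (?i X) = h0 A (FO K X)" "Cod Ch (?i X) = FO K X" if "X \<in> Obj C" for X
    using A.h0_incl_hom(2)[OF o[OF that]] by (simp_all add: mem_Hom)
  have ho: "h0 A (FO K X) \<in> Obj Ch" if "X \<in> Obj C" for X
    using A.h0_incl_hom(1)[OF o[OF that]] .
  have hz: "is_zero_obj A (cob (h0 A (FO K X)) n)" if "n \<noteq> 0" for n X
    using A.conc_zero[OF that] by (simp add: h0_def)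
  have hFO: "FO ?H X = h0 A (FO K X)" if "X \<in> Obj C" for X using that by (simp add: H0_def Let_def)
  have s: "src (H0_incl C MC A MA K) = ?H" "tgt (H0_incl C MC A MA K) = K"
    "dat (H0_incl C MC A MA K) \<in> extensional (Obj C)" by (simp_all add: H0_incl_def)
  have d: "dat (H0_incl C MC A MA K) X = ?i X" if "X \<in> Obj C" for X using that by (simp add: H0_incl_def)
  have h: "dat (H0_incl C MC A MA K) X \<in> Hom Ch (FO ?H X) (FO K X)" if "X \<in> Obj C" for X
    using ii[OF that] that by (simp add: d hFO mem_Hom)
  have n: "dat (H0_incl C MC A MA K) (Dom C f) \<cdot>\<^bsub>Ch\<^esub> FM ?H f = FM K f \<cdot>\<^bsub>Ch\<^esub> dat (H0_incl C MC A MA K) (Cod C f)"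
    if f: "f \<in> Arr C" for f
  proof -
    have "FM ?H f = (THE g. g \<in> Hom Ch (h0 A (FO K (Cod C f))) (h0 A (FO K (Dom C f))) \<and>
        ?i (Dom C f) \<cdot>\<^bsub>Ch\<^esub> g = FM K f \<cdot>\<^bsub>Ch\<^esub> ?i (Cod C f))"
      using f by (simp add: H0_def Let_def)
    moreover have "FM K f \<cdot>\<^bsub>Ch\<^esub> ?i (Cod C f) \<in> Hom Ch (h0 A (FO K (Cod C f))) (FO K (Dom C f))"
      using f K ii by (simp add: mem_Hom)
    ultimately have "?i (Dom C f) \<cdot>\<^bsub>Ch\<^esub> FM ?H f = FM K f \<cdot>\<^bsub>Ch\<^esub> ?i (Cod C f)"
      using theI'[OF A.h0_factor[OF o hz]] f by simp
    then show ?thesis using f by (simp add: d)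
  qed
  have m: "dat (H0_incl C MC A MA K) (TO MC X Y) \<cdot>\<^bsub>Ch\<^esub> FK ?H X Y
      = FK K X Y \<cdot>\<^bsub>Ch\<^esub> TA N (dat (H0_incl C MC A MA K) X) (dat (H0_incl C MC A MA K) Y)"
    if X: "X \<in> Obj C" "Y \<in> Obj C" for X Y
  proof -
    let ?P = "TO N (h0 A (FO K X)) (h0 A (FO K Y))"
    have P: "?P \<in> Obj Ch" using D_obj(9)[OF H X] X by (simp add: hFO)
    have "FK ?H X Y = (THE g. g \<in> Hom Ch ?P (h0 A (FO K (TO MC X Y))) \<and>
             ?i (TO MC X Y) \<cdot>\<^bsub>Ch\<^esub> g = FK K X Y \<cdot>\<^bsub>Ch\<^esub> TA N (?i X) (?i Y))"
      using X by (simp add: H0_def Let_def)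
    moreover have "FK K X Y \<cdot>\<^bsub>Ch\<^esub> TA N (?i X) (?i Y) \<in> Hom Ch ?P (FO K (TO MC X Y))"
      using X K ii P by (simp add: mem_Hom)
    moreover have "is_zero_obj A (cob ?P n)" if "n \<noteq> 0" for n
      using A.tens_conc_zero[OF ho[OF X(1)] hz ho[OF X(2)] hz that] by simp
    ultimately have "?i (TO MC X Y) \<cdot>\<^bsub>Ch\<^esub> FK ?H X Y = FK K X Y \<cdot>\<^bsub>Ch\<^esub> TA N (?i X) (?i Y)"
      using theI'[OF A.h0_factor[OF o, of "TO MC X Y" ?P]] X by simp
    then show ?thesis using X by (simp add: d)
  qed
  have u: "dat (H0_incl C MC A MA K) (TU MC) \<cdot>\<^bsub>Ch\<^esub> FU ?H = FU K"
  proof -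
    have "FU ?H = (THE g. g \<in> Hom Ch (TU N) (h0 A (FO K (TU MC))) \<and> ?i (TU MC) \<cdot>\<^bsub>Ch\<^esub> g = FU K)"
      by (simp add: H0_def Let_def)
    moreover have "FU K \<in> Hom Ch (TU N) (FO K (TU MC))" using K by (simp add: mem_Hom)
    moreover have "is_zero_obj A (cob (TU N) n)" if "n \<noteq> 0" for n
      using A.conc_zero[OF that] by (simp add: ch_tensor_def Let_def)
    ultimately have "?i (TU MC) \<cdot>\<^bsub>Ch\<^esub> FU ?H = FU K"
      using theI'[OF A.h0_factor[OF o, of "TU MC" "TU N"]] by simp
    then show ?thesis by (simp add: d)
  qed
  show "H0_incl C MC A MA K \<in> Arr D" "Dom D (H0_incl C MC A MA K) = ?H" "Cod D (H0_incl C MC A MA K) = K"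
    by (rule D_arrI[OF H K s h n m u]; assumption)+
qed

section \<open>Coaugmentations\<close>

text \<open>\<open>std_coaug\<close> freed from the standard construction: an arbitrary arrow
  \<open>e\<close> into the term of cosimplicial degree 0 takes the place of the unit.\<close>

definition coaug where
  "coaug B K e = (K, saw B, \<lambda>X \<in> Obj C. saw_coaug A B X (dat e X))"

text \<open>The equation for the first two cofaces is what makes the coaugmentation a chain map.
  Monoidality involves only cosimplicial degree 0, where the Alexander-Whitney map is trivial, and
  so reduces to monoidality of \<open>e\<close>.\<close>

lemma coaug_arr:
  assumes B: "admissible B" and e: "e \<in> Arr D" "Dom D e = K" "Cod D e = cso B 0"
    and eq: "cface B 0 0 \<cdot>\<^bsub>D\<^esub> e = cface B 0 1 \<cdot>\<^bsub>D\<^esub> e"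
  shows "coaug B K e \<in> Arr D" "Dom D (coaug B K e) = K" "Cod D (coaug B K e) = saw B"
proof -
  let ?j = "coaug B K e"
  let ?J = "\<lambda>X. saw_coaug A B X (dat e X)"
  have K: "K \<in> Obj D" using e by auto
  have o: "saw B \<in> Obj D" using B by (simp add: admissible_def)
  have s: "src ?j = K" "tgt ?j = saw B" "dat ?j \<in> extensional (Obj C)" by (simp_all add: coaug_def)
  have d: "dat ?j X = ?J X" if "X \<in> Obj C" for X using that by (simp add: coaug_def)
  have es: "dat e X \<in> Arr Ch" "Dom Ch (dat e X) = FO K X" "Cod Ch (dat e X) = FO (cso B 0) X" if "X \<in> Obj C" for X
    using that e by simp_all
  have Jd: "dat (?J X) n = saw_in A B X n 0 \<odot> dat (dat e X) n" for X n by (simp add: saw_coaug_def)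
  have Ja: "dat (?J X) n \<in> Arr A" "Dom A (dat (?J X) n) = cob (FO K X) n" "Cod A (dat (?J X) n) = bob (tsum A (sdc B X) n)"
    if "X \<in> Obj C" for X n
    using that es[OF that] B by (simp_all add: Jd)
  have Jh: "?J X \<in> Hom Ch (FO K X) (tot A (sdc B X))" if X: "X \<in> Obj C" for X
  proof (rule A.ch_homI)
    fix n
    note P = pre_dcx_saw[OF B X] and t = A.cdf_tot[OF pre_dcx_saw[OF B X]]
    show "dat (?J X) n \<in> Hom A (cob (FO K X) n) (cob (tot A (sdc B X)) n)"
      using Ja[OF X] by (simp add: mem_Hom)
    let ?E = "dat (dat e X)"
    let ?f = "\<lambda>i. dat (dat (cface B 0 i) X) n"
    have E: "?E n \<in> Arr A" "Dom A (?E n) = cob (FO K X) n" "Cod A (?E n) = cob (FO (cso B 0) X) n" for n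
      using es[OF X] by simp_all
    have fa: "?f i \<in> Arr A" "Dom A (?f i) = cob (FO (cso B 0) X) n" "Cod A (?f i) = cob (FO (cso B 1) X) n" if "i \<le> 1" for i
      using B X that by simp_all
    have ob: "cob (FO (cso B 0) X) n \<in> Obj A" "cob (FO (cso B 1) X) n \<in> Obj A" using B X by simp_all
    have dn: "dob (sdc B X) 0 n = cob (FO (cso B 0) X) n" "dob (sdc B X) 1 n = cob (FO (cso B 1) X) n"
      by (simp_all add: saw_dcx_simps(1))
    have dh: "dhor (sdc B X) 0 n = Add A (?f 0) (neg A (?f 1))"
    proof -
      interpret G: comm_monoid "hom_group A (cob (FO (cso B 0) X) n) (cob (FO (cso B 1) X) n)"
        using ob by (rule A.hg_monoid)
      have S: "{..nat 0 + 1} = {0, 1::nat}" by auto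
      have "dhor (sdc B X) 0 n = finprod (hom_group A (cob (FO (cso B 0) X) n) (cob (FO (cso B 1) X) n)) (\<lambda>i. sgn_arr A (int i) (?f i)) {0, 1}"
        using saw_dcx_simps(2)[of A B X 0 n] unfolding S by (simp add: dn)
      also have "\<dots> = Add A (?f 0) (neg A (?f 1))"
        using ob fa[of 0] fa[of 1] G.finprod_insert[of "{1}" 0 "\<lambda>i. sgn_arr A (int i) (?f i)"]
          G.finprod_insert[of "{}" 1 "\<lambda>i. sgn_arr A (int i) (?f i)"] by (simp add: mem_Hom sgn_arr_def comm_monoid.finprod_empty[OF A.hg_monoid])
      finally show ?thesis .
    qed
    have fe: "?f 0 \<odot> ?E n = ?f 1 \<odot> ?E n"
      using arg_cong[OF eq, of "\<lambda>u. dat (dat u X) n"] X by simp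
    \<comment> \<open>The horizontal differential out of degree 0 is the difference of the two
      cofaces, which \<open>e\<close> equalizes. Only the vertical part of the total differential
      survives.\<close>
    have 0: "dhor (sdc B X) 0 n \<odot> ?E n = Zer A (cob (FO K X) n) (cob (FO (cso B 1) X) n)"
      using fa[of 0] fa[of 1] E[of n] by (simp add: dh fe)
    have dv: "dver (sdc B X) 0 n = cdf (FO (cso B 0) X) n" by (simp add: saw_dcx_simps(3))
    have ec: "cdf (FO (cso B 0) X) n \<odot> ?E n = ?E (n + 1) \<odot> cdf (FO K X) n"
      using A.ch_arr(4)[OF es(1)[OF X], of n] es[OF X] by simp
    note bo = A.ch_obj(1-4)[OF D_obj(1)[OF cosimp_simps(1)[OF B, of 0] X]] A.ch_obj(1-4)[OF D_obj(1)[OF K X]]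
    have b1: "bin (tsum A (sdc B X) (n + 1)) 1 \<in> Arr A" "Dom A (bin (tsum A (sdc B X) (n + 1)) 1) = cob (FO (cso B 1) X) n"
      "bin (tsum A (sdc B X) (n + 1)) 0 \<in> Arr A" "Dom A (bin (tsum A (sdc B X) (n + 1)) 0) = cob (FO (cso B 0) X) (n + 1)"
      "Cod A (bin (tsum A (sdc B X) (n + 1)) 1) = bob (tsum A (sdc B X) (n + 1))"
      "Cod A (bin (tsum A (sdc B X) (n + 1)) 0) = bob (tsum A (sdc B X) (n + 1))"
      using P by (simp_all add: saw_dcx_simps(1))
    have dha: "dhor (sdc B X) 0 n \<in> Arr A" "Dom A (dhor (sdc B X) 0 n) = cob (FO (cso B 0) X) n"
      "Cod A (dhor (sdc B X) 0 n) = cob (FO (cso B 1) X) n"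
      using P by (simp_all add: dn)
    have "cdf (tot A (sdc B X)) n \<odot> dat (?J X) n =
      Add A (bin (tsum A (sdc B X) (n + 1)) 1 \<odot> dhor (sdc B X) 0 n)
          (sgn_arr A 0 (bin (tsum A (sdc B X) (n + 1)) 0 \<odot> cdf (FO (cso B 0) X) n)) \<odot> ?E n"
      unfolding Jd saw_in_def
      by (rule A.comp_reduce) (use t(1-3)[of n] t(4)[of n 0] P E[of n] in \<open>simp_all add: dv dn\<close>)
    also have "\<dots> = bin (tsum A (sdc B X) (n + 1)) 0 \<odot> cdf (FO (cso B 0) X) n \<odot> ?E n"
      using b1 dha E[of n] bo ob 0 by (simp add: sgn_arr_def)
    also have "\<dots> = dat (?J X) (n + 1) \<odot> cdf (FO K X) n"
      unfolding ec Jd saw_in_def using b1 E[of "n + 1"] bo by simp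
    finally show "cdf (tot A (sdc B X)) n \<odot> dat (?J X) n = dat (?J X) (n + 1) \<odot> cdf (FO K X) n" .
  next
    show "src (?J X) = FO K X" using es[OF X] by (simp add: saw_coaug_def ch_cat_simps(3))
  qed (use K B X in \<open>simp_all add: saw_coaug_def\<close>)
  have h: "dat ?j X \<in> Hom Ch (FO K X) (FO (saw B) X)" if "X \<in> Obj C" for X
    using Jh[OF that] that by (simp add: d saw_simps)
  have n: "dat ?j (Dom C f) \<cdot>\<^bsub>Ch\<^esub> FM K f = FM (saw B) f \<cdot>\<^bsub>Ch\<^esub> dat ?j (Cod C f)" if f: "f \<in> Arr C" for f
  proof (rule A.ch_ext)
    let ?U = "Cod C f" and ?V = "Dom C f"
    have UV: "?U \<in> Obj C" "?V \<in> Obj C" using f by simp_all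
    note hU = h[OF UV(1), unfolded mem_Hom] and hV = h[OF UV(2), unfolded mem_Hom]
    show "dat ?j ?V \<cdot>\<^bsub>Ch\<^esub> FM K f \<in> Arr Ch" "FM (saw B) f \<cdot>\<^bsub>Ch\<^esub> dat ?j ?U \<in> Arr Ch"
      "Dom Ch (dat ?j ?V \<cdot>\<^bsub>Ch\<^esub> FM K f) = Dom Ch (FM (saw B) f \<cdot>\<^bsub>Ch\<^esub> dat ?j ?U)"
      "Cod Ch (dat ?j ?V \<cdot>\<^bsub>Ch\<^esub> FM K f) = Cod Ch (FM (saw B) f \<cdot>\<^bsub>Ch\<^esub> dat ?j ?U)"
      using hU hV o K f by simp_all
    fix n
    have gh: "dcx_hom A (sdc B ?U) (sdc B ?V) (levelwise A (\<lambda>n. FM (cso B n) f))"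
      by (rule levelwise_hom) (use B f in simp_all)
    have ef: "dat (dat e ?V) n \<odot> dat (FM K f) n = dat (FM (cso B 0) f) n \<odot> dat (dat e ?U) n"
      using arg_cong[OF D_arr_nat[OF e(1) f], of "\<lambda>u. dat u n"] e by simp
    have "dat (FM (saw B) f) n \<odot> saw_in A B ?U n 0 = saw_in A B ?V n 0 \<odot> dat (FM (cso B 0) f) n"
      unfolding saw_simps(2)[OF f] using tot_map_saw_in[OF B B UV gh, of n 0] by simp
    from A.comp_reduce[OF this, of "dat (dat e ?U) n"]
    have "dat (FM (saw B) f) n \<odot> dat (?J ?U) n = saw_in A B ?V n 0 \<odot> dat (FM (cso B 0) f) n \<odot> dat (dat e ?U) n"
      using f B es[OF UV(1)] o UV by (simp add: Jd saw_simps(1))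
    moreover have "dat (?J ?V) n \<odot> dat (FM K f) n = saw_in A B ?V n 0 \<odot> dat (dat e ?V) n \<odot> dat (FM K f) n"
      using f K B es[OF UV(2)] UV by (simp add: Jd)
    ultimately show "dat (dat ?j ?V \<cdot>\<^bsub>Ch\<^esub> FM K f) n = dat (FM (saw B) f \<cdot>\<^bsub>Ch\<^esub> dat ?j ?U) n"
      using UV by (simp add: d ef)
  qed
  have m: "dat ?j (TO MC X Y) \<cdot>\<^bsub>Ch\<^esub> FK K X Y = FK (saw B) X Y \<cdot>\<^bsub>Ch\<^esub> TA N (dat ?j X) (dat ?j Y)"
    if X: "X \<in> Obj C" "Y \<in> Obj C" for X Y
  proof (rule A.ch_ext)
    let ?XY = "TO MC X Y"
    have XY: "?XY \<in> Obj C" using X by simp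
    note hX = h[OF X(1), unfolded mem_Hom] and hY = h[OF X(2), unfolded mem_Hom] and hXY = h[OF XY, unfolded mem_Hom]
    show "dat ?j ?XY \<cdot>\<^bsub>Ch\<^esub> FK K X Y \<in> Arr Ch" "FK (saw B) X Y \<cdot>\<^bsub>Ch\<^esub> TA N (dat ?j X) (dat ?j Y) \<in> Arr Ch"
      "Dom Ch (dat ?j ?XY \<cdot>\<^bsub>Ch\<^esub> FK K X Y) = Dom Ch (FK (saw B) X Y \<cdot>\<^bsub>Ch\<^esub> TA N (dat ?j X) (dat ?j Y))"
      "Cod Ch (dat ?j ?XY \<cdot>\<^bsub>Ch\<^esub> FK K X Y) = Cod Ch (FK (saw B) X Y \<cdot>\<^bsub>Ch\<^esub> TA N (dat ?j X) (dat ?j Y))"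
      using o K X hX hY hXY by simp_all
    fix n
    let ?K0 = "cso B 0"
    let ?k = "dat (saw_kunneth C MC A MA B X Y) n"
    let ?T = "dat (TA N (?J X) (?J Y)) n"
    let ?tK = "\<lambda>m. tens_in A MA (FO K X) (FO K Y) n m" and ?t0 = "\<lambda>m. tens_in A MA (FO ?K0 X) (FO ?K0 Y) n m"
    let ?tB = "\<lambda>m. tens_in A MA (tot A (sdc B X)) (tot A (sdc B Y)) n m"
    have JX: "?J X \<in> Arr Ch" "Dom Ch (?J X) = FO K X" "Cod Ch (?J X) = tot A (sdc B X)"
      and JY: "?J Y \<in> Arr Ch" "Dom Ch (?J Y) = FO K Y" "Cod Ch (?J Y) = tot A (sdc B Y)"
      using Jh[OF X(1)] Jh[OF X(2)] by (simp_all add: mem_Hom)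
    note T = A.TA_ch_simps[OF JX(1) JY(1), unfolded JX(2,3) JY(2,3), of n]
    note Te = A.TA_ch_simps[OF es(1)[OF X(1)] es(1)[OF X(2)], unfolded es(2,3)[OF X(1)] es(2,3)[OF X(2)], of n]
    note kk = kunneth_arr[OF B X, of n]
    have oo: "FO K X \<in> Obj Ch" "FO K Y \<in> Obj Ch" "FO ?K0 X \<in> Obj Ch" "FO ?K0 Y \<in> Obj Ch"
      "tot A (sdc B X) \<in> Obj Ch" "tot A (sdc B Y) \<in> Obj Ch" using K B X by simp_all
    have fk: "dat (FK K X Y) n \<in> Arr A" "Dom A (dat (FK K X Y) n) = bob (tsum A (tens_dcx A MA (FO K X) (FO K Y)) n)"
      "Cod A (dat (FK K X Y) n) = cob (FO K ?XY) n"
      and f0: "dat (FK ?K0 X Y) n \<in> Arr A" "Dom A (dat (FK ?K0 X Y) n) = bob (tsum A (tens_dcx A MA (FO ?K0 X) (FO ?K0 Y)) n)"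
      "Cod A (dat (FK ?K0 X Y) n) = cob (FO ?K0 ?XY) n"
      using K B X by simp_all
    have si: "saw_in A B U k 0 \<in> Arr A" "Dom A (saw_in A B U k 0) = cob (FO ?K0 U) k" "Cod A (saw_in A B U k 0) = bob (tsum A (sdc B U) k)"
      if "U \<in> Obj C" for U k
      using B that by simp_all
    have E: "dat (dat e U) k \<in> Arr A" "Dom A (dat (dat e U) k) = cob (FO K U) k" "Cod A (dat (dat e U) k) = cob (FO ?K0 U) k"
      if "U \<in> Obj C" for U k using es[OF that] by simp_all
    have em: "dat (dat e ?XY) n \<odot> dat (FK K X Y) n = dat (FK ?K0 X Y) n \<odot> dat (TA N (dat e X) (dat e Y)) n"
      using arg_cong[OF D_arr_mon[OF e(1) X], of "\<lambda>u. dat u n"] e by simp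
    have "dat (?J ?XY) n \<odot> dat (FK K X Y) n = ?k \<odot> ?T"
    proof (rule A.tens_ext[OF oo(1,2)])
      fix m
      let ?ee = "TA MA (dat (dat e X) m) (dat (dat e Y) (n - m))"
      let ?in = "TA MA (saw_in A B X m 0) (saw_in A B Y (n - m) 0)"
      have ee: "?ee \<in> Arr A" "Cod A ?ee = TO MA (cob (FO ?K0 X) m) (cob (FO ?K0 Y) (n - m))"
        using E[OF X(1)] E[OF X(2)] by simp_all
      have inn: "?in \<in> Arr A" "Dom A ?in = TO MA (cob (FO ?K0 X) m) (cob (FO ?K0 Y) (n - m))"
        "Cod A ?in = TO MA (bob (tsum A (sdc B X) m)) (bob (tsum A (sdc B Y) (n - m)))"
        using si[OF X(1)] si[OF X(2)] by simp_all
      note ti = A.tens_in_simps(1-3)[OF oo(1,2), of n m] A.tens_in_simps(1-3)[OF oo(3,4), of n m] A.tens_in_simps(1-3)[OF oo(5,6), of n m]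
      \<comment> \<open>The coaugmentation lands in cosimplicial degree 0, so only p = r = 0 occurs:
        the sign is trivial and the iterated cofaces are identities.\<close>
      have nn: "n - int (0 + 0) = m + (n - m)" by simp
      have idt: "TA MA (dat (dat (Id D ?K0) X) m) (dat (dat (Id D ?K0) Y) (n - m)) = Id A (TO MA (cob (FO ?K0 X) m) (cob (FO ?K0 Y) (n - m)))"
        using X oo by (simp add: A.tensor_id)
      have aw0: "aw B X Y n 0 0 m (n - m) = saw_in A B ?XY n 0 \<odot> dat (FK ?K0 X Y) n \<odot> ?t0 m"
        unfolding aw_def last_cofaces.simps zeroth_cofaces.simps using idt ti by simp
      have "(dat (?J ?XY) n \<odot> dat (FK K X Y) n) \<odot> ?tK m = saw_in A B ?XY n 0 \<odot> (dat (dat e ?XY) n \<odot> dat (FK K X Y) n) \<odot> ?tK m"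
        using si[OF XY] E[OF XY] fk ti by (simp add: Jd)
      also have "\<dots> = saw_in A B ?XY n 0 \<odot> dat (FK ?K0 X Y) n \<odot> dat (TA N (dat e X) (dat e Y)) n \<odot> ?tK m"
        unfolding em using f0 Te(1-3) ti by simp
      also have "\<dots> = (saw_in A B ?XY n 0 \<odot> dat (FK ?K0 X Y) n \<odot> ?t0 m) \<odot> ?ee"
        unfolding Te(4) using si[OF XY] f0 ti ee by simp
      finally have 1: "(dat (?J ?XY) n \<odot> dat (FK K X Y) n) \<odot> ?tK m = aw B X Y n 0 0 m (n - m) \<odot> ?ee"
        unfolding aw0 .
      have JJ: "TA MA (dat (?J X) m) (dat (?J Y) (n - m)) = ?in \<odot> ?ee"
        unfolding Jd using si[OF X(1)] si[OF X(2)] E[OF X(1)] E[OF X(2)] by (simp add: A.tensor_comp_arr)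
      have "(?k \<odot> ?T) \<odot> ?tK m = ?k \<odot> ?T \<odot> ?tK m"
        by (rule A.comp_assoc_arr) (use kk(1-3) T(1-3) ti in simp_all)
      also have "\<dots> = (?k \<odot> ?tB m \<odot> ?in) \<odot> ?ee"
        unfolding T(4) JJ using kk(1-3) ti inn ee by simp
      also have "\<dots> = aw B X Y n 0 0 m (n - m) \<odot> ?ee"
        unfolding kk(4) by (simp add: sgn_arr_def)
      finally show "(dat (?J ?XY) n \<odot> dat (FK K X Y) n) \<odot> ?tK m = (?k \<odot> ?T) \<odot> ?tK m"
        unfolding 1 by (rule sym)
    qed (use Ja[OF XY] fk kk(1-3) T(1-3) in simp_all)
    then show "dat (dat ?j ?XY \<cdot>\<^bsub>Ch\<^esub> FK K X Y) n = dat (FK (saw B) X Y \<cdot>\<^bsub>Ch\<^esub> TA N (dat ?j X) (dat ?j Y)) n"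
      using X by (simp add: d saw_simps)
  qed
  have u: "dat ?j (TU MC) \<cdot>\<^bsub>Ch\<^esub> FU K = FU (saw B)"
  proof (rule A.ch_ext)
    note hU = h[OF C.unit_obj, unfolded mem_Hom]
    show "dat ?j (TU MC) \<cdot>\<^bsub>Ch\<^esub> FU K \<in> Arr Ch" "FU (saw B) \<in> Arr Ch"
      "Dom Ch (dat ?j (TU MC) \<cdot>\<^bsub>Ch\<^esub> FU K) = Dom Ch (FU (saw B))"
      "Cod Ch (dat ?j (TU MC) \<cdot>\<^bsub>Ch\<^esub> FU K) = Cod Ch (FU (saw B))"
      using o K hU by simp_all
    fix n
    have eu: "dat (dat e (TU MC)) n \<odot> dat (FU K) n = dat (FU (cso B 0)) n"
      using arg_cong[OF D_arr_unit[OF e(1)], of "\<lambda>u. dat u n"] e by simp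
    have "dat (?J (TU MC)) n \<odot> dat (FU K) n = saw_in A B (TU MC) n 0 \<odot> dat (dat e (TU MC)) n \<odot> dat (FU K) n"
      unfolding Jd by (rule A.comp_assoc_arr) (use K B es[OF C.unit_obj] in simp_all)
    then show "dat (dat ?j (TU MC) \<cdot>\<^bsub>Ch\<^esub> FU K) n = dat (FU (saw B)) n"
      by (simp add: d eu saw_simps(4) saw_coaug_def)
  qed
  show "?j \<in> Arr D" "Dom D ?j = K" "Cod D ?j = saw B"
    by (rule D_arrI[OF K o s h n m u]; assumption)+
qed

text \<open>A coaugmentation factors through the summand of cosimplicial degree 0, so the comparison
  sees only the component \<open>f 0\<close>.\<close>

lemma coaug_nat:
  assumes B: "admissible B" and e: "e \<in> Arr D" "Dom D e = K" "Cod D e = cso B 0"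
    and eq: "cface B 0 0 \<cdot>\<^bsub>D\<^esub> e = cface B 0 1 \<cdot>\<^bsub>D\<^esub> e"
    and B': "admissible B'" and e': "e' \<in> Arr D" "Dom D e' = K'" "Cod D e' = cso B' 0"
    and eq': "cface B' 0 0 \<cdot>\<^bsub>D\<^esub> e' = cface B' 0 1 \<cdot>\<^bsub>D\<^esub> e'"
    and f: "is_cosimp_map D B B' f" and a: "a \<in> Arr D" "Dom D a = K" "Cod D a = K'"
    and fa: "f 0 \<cdot>\<^bsub>D\<^esub> e = e' \<cdot>\<^bsub>D\<^esub> a"
  shows "saw_map C MC A MA B B' f \<cdot>\<^bsub>D\<^esub> coaug B K e = coaug B' K' e' \<cdot>\<^bsub>D\<^esub> a"
proof (rule D_ext)
  let ?s = "saw_map C MC A MA B B' f"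
  note s = saw_map_arr[OF B B' f] and c = coaug_arr[OF B e eq] and c' = coaug_arr[OF B' e' eq']
  note fs = cosimp_map_simps[OF f]
  show sc: "?s \<cdot>\<^bsub>D\<^esub> coaug B K e \<in> Arr D" "coaug B' K' e' \<cdot>\<^bsub>D\<^esub> a \<in> Arr D"
    "Dom D (?s \<cdot>\<^bsub>D\<^esub> coaug B K e) = Dom D (coaug B' K' e' \<cdot>\<^bsub>D\<^esub> a)"
    "Cod D (?s \<cdot>\<^bsub>D\<^esub> coaug B K e) = Cod D (coaug B' K' e' \<cdot>\<^bsub>D\<^esub> a)"
    using s c c' a by simp_all
  fix X assume X: "X \<in> Obj C"
  show "dat (?s \<cdot>\<^bsub>D\<^esub> coaug B K e) X = dat (coaug B' K' e' \<cdot>\<^bsub>D\<^esub> a) X"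
  proof (rule A.ch_ext)
    show "dat (?s \<cdot>\<^bsub>D\<^esub> coaug B K e) X \<in> Arr Ch" "dat (coaug B' K' e' \<cdot>\<^bsub>D\<^esub> a) X \<in> Arr Ch"
      "Dom Ch (dat (?s \<cdot>\<^bsub>D\<^esub> coaug B K e) X) = Dom Ch (dat (coaug B' K' e' \<cdot>\<^bsub>D\<^esub> a) X)"
      "Cod Ch (dat (?s \<cdot>\<^bsub>D\<^esub> coaug B K e) X) = Cod Ch (dat (coaug B' K' e' \<cdot>\<^bsub>D\<^esub> a) X)"
      using D_arr(3-5)[OF sc(1) X] D_arr(3-5)[OF sc(2) X] sc(3,4) by simp_all
    fix n
    let ?F = "dat (tot_map A (sdc B X) (sdc B' X) (levelwise A (\<lambda>n. dat (f n) X))) n"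
    have fh: "dcx_hom A (sdc B X) (sdc B' X) (levelwise A (\<lambda>n. dat (f n) X))"
      using levelwise_dcx_map[OF B B' f X] by (simp add: dcx_map_def)
    note Fs = A.tot_map_simps(1-3)[OF pre_dcx_saw[OF B X] pre_dcx_saw[OF B' X] fh, of n]
    have fe: "dat (dat (f 0) X) n \<odot> dat (dat e X) n = dat (dat e' X) n \<odot> dat (dat a X) n"
      using arg_cong[OF fa, of "\<lambda>u. dat (dat u X) n"] X by simp
    have "?F \<odot> saw_in A B X n 0 = saw_in A B' X n 0 \<odot> dat (dat (f 0) X) n"
      using tot_map_saw_in[OF B B' X X fh, of n 0] by simp
    from A.comp_reduce[OF this, of "dat (dat e X) n"]
    have "?F \<odot> saw_in A B X n 0 \<odot> dat (dat e X) n = saw_in A B' X n 0 \<odot> dat (dat (f 0) X) n \<odot> dat (dat e X) n"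
      using Fs B B' X e fs by simp
    then show "dat (dat (?s \<cdot>\<^bsub>D\<^esub> coaug B K e) X) n = dat (dat (coaug B' K' e' \<cdot>\<^bsub>D\<^esub> a) X) n"
      using X B' e' a by (simp add: saw_map_simps coaug_def saw_coaug_def fe)
  qed
qed

end

section \<open>Homotopy equivalences\<close>

lemma fun_cat_simps:
  "Obj (fun_cat C A) = {F. is_functor C A F}"
  "a \<in> Arr (fun_cat C A) \<longleftrightarrow> is_functor C A (src a) \<and> is_functor C A (tgt a) \<and> is_nat C A (src a) (tgt a) (dat a)"
  "Dom (fun_cat C A) a = src a" "Cod (fun_cat C A) a = tgt a"
  "Id (fun_cat C A) F = (F, F, \<lambda>X \<in> Obj C. Id A (FO F X))"
  "b \<cdot>\<^bsub>fun_cat C A\<^esub> a = (src a, tgt b, \<lambda>X \<in> Obj C. dat b X \<cdot>\<^bsub>A\<^esub> dat a X)"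
  "Zer (fun_cat C A) F G = (F, G, \<lambda>X \<in> Obj C. Zer A (FO F X) (FO G X))"
  "Add (fun_cat C A) a b = (src a, tgt a, \<lambda>X \<in> Obj C. Add A (dat a X) (dat b X))"
  by (auto simp: fun_cat_def split: prod.splits)

context mon_setting
begin

abbreviation "Fn \<equiv> fun_cat (op_cat C) A"

lemma und_cpx_simps:
  "X \<in> Obj C \<Longrightarrow> FO (cob (und_cpx C K) n) X = cob (FO K X) n"
  "f \<in> Arr C \<Longrightarrow> FM (cob (und_cpx C K) n) f = dat (FM K f) n"
  "cdf (und_cpx C K) n = (cob (und_cpx C K) n, cob (und_cpx C K) (n + 1), \<lambda>X \<in> Obj C. cdf (FO K X) n)"
  by (simp_all add: und_cpx_def Let_def)

lemma und_functor:
  assumes K: "K \<in> Obj D"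
  shows "is_functor (op_cat C) A (cob (und_cpx C K) n)"
proof -
  have "FO (cob (und_cpx C K) n) \<in> extensional (Obj C)" "FM (cob (und_cpx C K) n) \<in> extensional (Arr C)"
    by (simp_all add: und_cpx_def Let_def)
  then show ?thesis
    using K by (simp add: is_functor_def und_cpx_simps mem_Hom D_obj_comp)
qed

text \<open>The functor category is not treated as an instance of \<open>abelian_category\<close>.
  That a functor with zero values is a zero object is therefore checked from the universal property,
  with the transformation made of zero arrows as the unique one.\<close>

lemma und_cpx_obj:
  assumes K: "K \<in> Obj D"
  shows "und_cpx C K \<in> Obj (ch_cat Fn)"
proof -
  have o: "FO K X \<in> Obj Ch" if "X \<in> Obj C" for X using K that by simp
  have d: "is_nat (op_cat C) A (cob (und_cpx C K) n) (cob (und_cpx C K) (n + 1)) (\<lambda>X \<in> Obj C. cdf (FO K X) n)" for n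
  proof -
    have "cdf (FO K (Dom C f)) n \<odot> dat (FM K f) n = dat (FM K f) (n + 1) \<odot> cdf (FO K (Cod C f)) n"
      if "f \<in> Arr C" for f
      using A.ch_arr(4)[OF D_obj(2)[OF K that], of n] K that by simp
    then show ?thesis using A.ch_obj(1-4)[OF o] by (simp add: is_nat_def und_cpx_simps mem_Hom)
  qed
  have "is_complex Fn (und_cpx C K)"
    unfolding is_complex_def
  proof (intro allI conjI)
    fix n
    show "cob (und_cpx C K) n \<in> Obj Fn" using und_functor[OF K] by (simp add: fun_cat_simps)
    show "cdf (und_cpx C K) n \<in> Hom Fn (cob (und_cpx C K) n) (cob (und_cpx C K) (n + 1))"
      using und_functor[OF K] d by (simp add: mem_Hom fun_cat_simps und_cpx_simps)
    show "cdf (und_cpx C K) (n + 1) \<cdot>\<^bsub>Fn\<^esub> cdf (und_cpx C K) n = Zer Fn (cob (und_cpx C K) n) (cob (und_cpx C K) (n + 1 + 1))"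
      using A.ch_obj(5)[OF o] by (simp add: fun_cat_simps und_cpx_simps cong: restrict_cong)
  qed
  moreover have "\<exists>b. vanishes_below Fn b (und_cpx C K)"
  proof -
    obtain b where b: "vanishes_below_on C A b K" using K by (auto simp: mon_ch_simps(1))
    have "is_zero_obj Fn (cob (und_cpx C K) n)" if "n < b" for n
    proof -
      let ?Z = "cob (und_cpx C K) n"
      have z: "is_zero_obj A (FO ?Z X)" if "X \<in> Obj C" for X
        using b that \<open>n < b\<close> by (simp add: vanishes_below_on_def vanishes_below_def und_cpx_simps)
      have Z: "is_functor (op_cat C) A ?Z" by (rule und_functor[OF K])
      have F: "X \<in> Obj C \<Longrightarrow> FO F X \<in> Obj A" "f \<in> Arr C \<Longrightarrow> FM F f \<in> Arr A"
        "f \<in> Arr C \<Longrightarrow> Dom A (FM F f) = FO F (Cod C f)" "f \<in> Arr C \<Longrightarrow> Cod A (FM F f) = FO F (Dom C f)"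
        if "is_functor (op_cat C) A F" for F X f
        using that by (simp_all add: is_functor_def mem_Hom)
      note zo = F[OF Z]
      have "\<exists>!f. f \<in> Hom Fn F ?Z" if F': "is_functor (op_cat C) A F" for F
      proof (rule ex1I)
        show "(F, ?Z, \<lambda>X \<in> Obj C. Zer A (FO F X) (FO ?Z X)) \<in> Hom Fn F ?Z"
          using F[OF F'] F' zo Z C.ends_obj by (auto simp: mem_Hom fun_cat_simps is_nat_def)
        fix f assume f: "f \<in> Hom Fn F ?Z"
        then have n: "is_nat (op_cat C) A F ?Z (dat f)" and fs: "src f = F" "tgt f = ?Z" by (auto simp: mem_Hom fun_cat_simps)
        have "dat f = (\<lambda>X \<in> Obj C. Zer A (FO F X) (FO ?Z X))"
        proof (rule extensionalityI)
          show "dat f X = (\<lambda>X \<in> Obj C. Zer A (FO F X) (FO ?Z X)) X" if X: "X \<in> Obj C" for X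
            using n X A.into_zero_obj[of "dat f X"] z[OF X] by (simp add: is_nat_def mem_Hom)
        qed (use n in \<open>simp_all add: is_nat_def\<close>)
        then show "f = (F, ?Z, \<lambda>X \<in> Obj C. Zer A (FO F X) (FO ?Z X))" using fs by (simp add: prod_eq_iff)
      qed
      moreover have "\<exists>!f. f \<in> Hom Fn ?Z F" if F': "is_functor (op_cat C) A F" for F
      proof (rule ex1I)
        show "(?Z, F, \<lambda>X \<in> Obj C. Zer A (FO ?Z X) (FO F X)) \<in> Hom Fn ?Z F"
          using F[OF F'] F' zo Z C.ends_obj by (auto simp: mem_Hom fun_cat_simps is_nat_def)
        fix f assume f: "f \<in> Hom Fn ?Z F"
        then have n: "is_nat (op_cat C) A ?Z F (dat f)" and fs: "src f = ?Z" "tgt f = F" by (auto simp: mem_Hom fun_cat_simps)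
        have "dat f = (\<lambda>X \<in> Obj C. Zer A (FO ?Z X) (FO F X))"
        proof (rule extensionalityI)
          show "dat f X = (\<lambda>X \<in> Obj C. Zer A (FO ?Z X) (FO F X)) X" if X: "X \<in> Obj C" for X
            using n X A.from_zero_obj[of "dat f X"] z[OF X] by (simp add: is_nat_def mem_Hom)
        qed (use n in \<open>simp_all add: is_nat_def\<close>)
        then show "f = (?Z, F, \<lambda>X \<in> Obj C. Zer A (FO ?Z X) (FO F X))" using fs by (simp add: prod_eq_iff)
      qed
      ultimately show ?thesis using Z unfolding is_zero_obj_def fun_cat_simps(1) by blast
    qed
    then show ?thesis unfolding vanishes_below_def by blast
  qed
  ultimately show ?thesis by (simp add: ch_cat_simps(1))
qed

lemma und_map_arr:
  assumes a: "a \<in> Arr D"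
  shows "und_map C a \<in> Hom (ch_cat Fn) (und_cpx C (Dom D a)) (und_cpx C (Cod D a))"
proof -
  have K: "Dom D a \<in> Obj D" "Cod D a \<in> Obj D" using a by simp_all
  have aa: "dat a X \<in> Arr Ch" "Dom Ch (dat a X) = FO (Dom D a) X" "Cod Ch (dat a X) = FO (Cod D a) X" if "X \<in> Obj C" for X
    using a that by simp_all
  have nat: "dat (dat a (Dom C f)) n \<odot> dat (FM (Dom D a) f) n = dat (FM (Cod D a) f) n \<odot> dat (dat a (Cod C f)) n"
    if "f \<in> Arr C" for f n
    using arg_cong[OF D_arr_nat[OF a that], of "\<lambda>u. dat u n"] by simp
  have n: "is_nat (op_cat C) A (cob (und_cpx C (Dom D a)) n) (cob (und_cpx C (Cod D a)) n) (\<lambda>X \<in> Obj C. dat (dat a X) n)" for n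
    using aa nat by (simp add: is_nat_def und_cpx_simps mem_Hom)
  have ch: "cdf (FO (Cod D a) X) n \<odot> dat (dat a X) n = dat (dat a X) (n + 1) \<odot> cdf (FO (Dom D a) X) n" if "X \<in> Obj C" for X n
    using A.ch_arr(4)[OF aa(1)[OF that], of n] aa[OF that] by simp
  show ?thesis
    unfolding mem_Hom ch_cat_simps(2-4) is_chain_map_def
    using und_cpx_obj[OF K(1)] und_cpx_obj[OF K(2)] und_functor[OF K(1)] und_functor[OF K(2)] n ch
    by (simp add: und_map_def fun_cat_simps und_cpx_simps mon_ch_simps(3,4) mem_Hom cong: restrict_cong)
qed

lemma und_map_comp:
  "und_map C b \<cdot>\<^bsub>ch_cat Fn\<^esub> und_map C a = und_map C (b \<cdot>\<^bsub>D\<^esub> a)"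
  by (simp add: und_map_def ch_comp fun_cat_simps mon_ch_comp cong: restrict_cong)

lemma und_map_id:
  "und_map C (Id D K) = Id (ch_cat Fn) (und_cpx C K)"
  by (simp add: und_map_def ch_id fun_cat_simps mon_ch_id und_cpx_simps cong: restrict_cong)

text \<open>By the zero homotopy. As \<open>homotopic\<close> refers to the functor category, this
  is a natural family of zero arrows, and the sum is evaluated objectwise.\<close>

lemma homotopic_refl:
  assumes a: "a \<in> Arr D"
  shows "homotopic Fn (und_map C a) (und_map C a)"
proof -
  let ?K = "und_cpx C (Dom D a)" and ?L = "und_cpx C (Cod D a)"
  have K: "Dom D a \<in> Obj D" "Cod D a \<in> Obj D" using a by simp_all
  note f = und_functor[OF K(1)] und_functor[OF K(2)]
  let ?h = "\<lambda>n. Zer Fn (cob ?K n) (cob ?L (n - 1))"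
  have o: "FO (Dom D a) X \<in> Obj Ch" "FO (Cod D a) X \<in> Obj Ch" if "X \<in> Obj C" for X using K that by simp_all
  note oo = A.ch_obj(1-4)[OF o(1)] A.ch_obj(1-4)[OF o(2)]
  have aa: "dat a X \<in> Arr Ch" "Dom Ch (dat a X) = FO (Dom D a) X" "Cod Ch (dat a X) = FO (Cod D a) X" if "X \<in> Obj C" for X
    using a that by simp_all
  have nz: "is_nat (op_cat C) A (cob ?K n) (cob ?L m) (\<lambda>X \<in> Obj C. Zer A (cob (FO (Dom D a) X) n) (cob (FO (Cod D a) X) m))" for n m
    using oo K by (simp add: is_nat_def und_cpx_simps mem_Hom)
  have hh: "?h n \<in> Hom Fn (cob ?K n) (cob ?L (n - 1))" for n
    using f nz by (simp add: mem_Hom fun_cat_simps und_cpx_simps cong: restrict_cong)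
  have e: "dat (und_map C a) n = Add Fn (dat (und_map C a) n)
          (Add Fn (cdf ?L (n - 1) \<cdot>\<^bsub>Fn\<^esub> ?h n) (?h (n + 1) \<cdot>\<^bsub>Fn\<^esub> cdf ?K n))" for n
  proof -
    have "cdf (FO (Cod D a) X) (n - 1) \<odot> Zer A (cob (FO (Dom D a) X) n) (cob (FO (Cod D a) X) (n - 1))
       = Zer A (cob (FO (Dom D a) X) n) (cob (FO (Cod D a) X) n)" if "X \<in> Obj C" for X
      using oo[OF that] by simp
    moreover have "Zer A (cob (FO (Dom D a) X) (n + 1)) (cob (FO (Cod D a) X) n) \<odot> cdf (FO (Dom D a) X) n
       = Zer A (cob (FO (Dom D a) X) n) (cob (FO (Cod D a) X) n)" if "X \<in> Obj C" for X
      using oo[OF that] by simp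
    ultimately show ?thesis
      using aa oo by (simp add: und_map_def fun_cat_simps und_cpx_simps mon_ch_simps(3,4) cong: restrict_cong)
  qed
  have s: "src (und_map C a) = ?K" "tgt (und_map C a) = ?L"
    by (simp_all add: und_map_def mon_ch_simps(3,4))
  show ?thesis unfolding homotopic_def s
    by (intro conjI refl exI[of _ ?h] allI hh) (use e in simp)
qed

text \<open>An inverse is a homotopy inverse with zero homotopies. This is how isomorphisms, and in
  particular identities, come to lie in \<open>W\<close>.\<close>

lemma iso_homotopy_equivalence:
  assumes ab: "inverse_arrows D a b"
  shows "a \<in> homotopy_equivalences C MC A MA"
proof -
  have a: "a \<in> Arr D" and b: "b \<in> Arr D" "Dom D b = Cod D a" "Cod D b = Dom D a"
    and ba: "b \<cdot>\<^bsub>D\<^esub> a = Id D (Dom D a)" and ab': "a \<cdot>\<^bsub>D\<^esub> b = Id D (Cod D a)"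
    using ab by (auto simp: inverse_arrows_def mem_Hom)
  have s: "src (und_map C a) = und_cpx C (Dom D a)" "tgt (und_map C a) = und_cpx C (Cod D a)"
    by (simp_all add: und_map_def mon_ch_simps(3,4))
  have "homotopic Fn (und_map C b \<cdot>\<^bsub>ch_cat Fn\<^esub> und_map C a) (Id (ch_cat Fn) (und_cpx C (Dom D a)))"
    using homotopic_refl[of "Id D (Dom D a)"] a by (simp add: und_map_comp ba und_map_id)
  moreover have "homotopic Fn (und_map C a \<cdot>\<^bsub>ch_cat Fn\<^esub> und_map C b) (Id (ch_cat Fn) (und_cpx C (Cod D a)))"
    using homotopic_refl[of "Id D (Cod D a)"] a by (simp add: und_map_comp ab' und_map_id)
  moreover have "und_map C b \<in> Hom (ch_cat Fn) (und_cpx C (Cod D a)) (und_cpx C (Dom D a))"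
    using und_map_arr[OF b(1)] b by simp
  moreover have "und_map C a \<in> Arr (ch_cat Fn)" using und_map_arr[OF a] by (simp add: mem_Hom)
  ultimately show ?thesis
    using a by (auto simp: homotopy_equivalences_def is_homotopy_equiv_def s)
qed

end

section \<open>Words in the localization\<close>

text \<open>\<open>equivclp\<close> is reflexive on all lists, including ill-formed words. Demanding
  that \<open>u\<close> is a word confines the relation to words from \<open>X\<close> to
  \<open>Y\<close>, since steps are only taken between such words.\<close>

definition word_equiv where
  "word_equiv D W X Y u v \<longleftrightarrow> is_word D W X u Y \<and>
     equivclp (\<lambda>u v. is_word D W X u Y \<and> is_word D W X v Y \<and> word_step D W u v) u v"

lemma is_word_append:
  "is_word D W X (u @ v) Z \<longleftrightarrow> (\<exists>Y. is_word D W X u Y \<and> is_word D W Y v Z)" if "\<And>Y w. is_word D W Y w Z \<Longrightarrow> Y \<in> Obj D"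
proof (induction u arbitrary: X)
  case Nil
  then show ?case using that by auto
next
  case (Cons a u)
  then show ?case by (cases a) auto
qed

locale localizable = category D
  for D :: "('x, 'y, 'z) cat_scheme" +
  fixes W :: "'y set"
  assumes W_sub: "W \<subseteq> Arr D"
begin

lemma W_arr [simp]: "s \<in> W \<Longrightarrow> s \<in> Arr D"
  using W_sub by blast

lemma word_obj: "is_word D W X w Y \<Longrightarrow> X \<in> Obj D \<and> Y \<in> Obj D"
proof (induction w arbitrary: X)
  case (Cons a w)
  then show ?case by (cases a) auto
qed auto

lemma word_append: "is_word D W X (u @ v) Z \<longleftrightarrow> (\<exists>Y. is_word D W X u Y \<and> is_word D W Y v Z)"
  by (rule is_word_append) (use word_obj in blast)

lemma word_appendI: "is_word D W X u Y \<Longrightarrow> is_word D W Y v Z \<Longrightarrow> is_word D W X (u @ v) Z"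
  using word_append by blast

lemma word_single [simp]:
  "is_word D W X [Fw f] Y \<longleftrightarrow> f \<in> Arr D \<and> Dom D f = X \<and> Cod D f = Y"
  "is_word D W X [Bw s] Y \<longleftrightarrow> s \<in> W \<and> Cod D s = X \<and> Dom D s = Y"
  by auto

lemma word_equiv_word:
  assumes "word_equiv D W X Y u v"
  shows "is_word D W X u Y" "is_word D W X v Y"
proof -
  have e: "equivclp (\<lambda>u v. is_word D W X u Y \<and> is_word D W X v Y \<and> word_step D W u v) u v"
    and u: "is_word D W X u Y" using assms by (simp_all add: word_equiv_def)
  show "is_word D W X u Y" by (rule u)
  show "is_word D W X v Y" using e by (induction rule: equivclp_induct) (use u in auto)
qed

lemma word_equiv_refl: "is_word D W X u Y \<Longrightarrow> word_equiv D W X Y u u"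
  by (simp add: word_equiv_def)

lemma word_equiv_sym: "word_equiv D W X Y u v \<Longrightarrow> word_equiv D W X Y v u"
  using word_equiv_word(2)[of X Y u v] unfolding word_equiv_def by (auto intro: equivclp_sym)

lemma word_equiv_trans [trans]: "word_equiv D W X Y u v \<Longrightarrow> word_equiv D W X Y v w \<Longrightarrow> word_equiv D W X Y u w"
  unfolding word_equiv_def by (auto elim: equivclp_trans)

lemma word_equiv_step: "is_word D W X u Y \<Longrightarrow> is_word D W X v Y \<Longrightarrow> word_step D W u v \<Longrightarrow> word_equiv D W X Y u v"
  unfolding word_equiv_def by (simp add: r_into_equivclp)

lemma word_step_context:
  assumes "word_step D W u v"
  shows "word_step D W (a @ u @ b) (a @ v @ b)"
  using assms
proof cases
  case (ws_id X u' v')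
  then show ?thesis using word_step.ws_id[of X D W "a @ u'" "v' @ b"] by simp
next
  case (ws_comp f g u' v')
  then show ?thesis using word_step.ws_comp[of f D g W "a @ u'" "v' @ b"] by simp
next
  case (ws_inv1 s u' v')
  then show ?thesis using word_step.ws_inv1[of s W D "a @ u'" "v' @ b"] by simp
next
  case (ws_inv2 s u' v')
  then show ?thesis using word_step.ws_inv2[of s W D "a @ u'" "v' @ b"] by simp
qed

text \<open>The one induction over the equivalence closure that is needed to transport it:
  \<open>F\<close> is prefixing or suffixing a word, or applying an endofunctor to each
  letter.\<close>

lemma word_equiv_map:
  assumes e: "word_equiv D W X Y u v"
    and F: "\<And>w. is_word D W X w Y \<Longrightarrow> is_word D W X' (F w) Y'"
    and S: "\<And>a b. \<lbrakk>is_word D W X a Y; is_word D W X b Y; word_step D W a b\<rbrakk> \<Longrightarrow> word_step D W (F a) (F b)"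
  shows "word_equiv D W X' Y' (F u) (F v)"
proof -
  have e': "equivclp (\<lambda>u v. is_word D W X u Y \<and> is_word D W X v Y \<and> word_step D W u v) u v"
    and u: "is_word D W X u Y" using e by (simp_all add: word_equiv_def)
  from e' show ?thesis
  proof (induction rule: equivclp_induct)
    case base
    show ?case using F u by (simp add: word_equiv_refl)
  next
    case (step y z)
    have "word_equiv D W X' Y' (F y) (F z)"
      using step.hyps(2)
    proof
      assume "is_word D W X y Y \<and> is_word D W X z Y \<and> word_step D W y z"
      then show ?thesis using F S by (intro word_equiv_step) auto
    next
      assume "is_word D W X z Y \<and> is_word D W X y Y \<and> word_step D W z y"
      then show ?thesis using F S by (intro word_equiv_sym[OF word_equiv_step]) auto
    qed
    then show ?case by (rule word_equiv_trans[OF step.IH])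
  qed
qed

lemma word_equiv_append:
  assumes u: "word_equiv D W X Y u u'" and v: "word_equiv D W Y Z v v'"
  shows "word_equiv D W X Z (u @ v) (u' @ v')"
proof -
  have "word_equiv D W X Z (u @ v) (u' @ v)"
    by (rule word_equiv_map[OF u]) (use word_appendI word_equiv_word[OF v] word_step_context[of _ _ "[]" v] in auto)
  also have "word_equiv D W X Z (u' @ v) (u' @ v')"
    by (rule word_equiv_map[OF v]) (use word_appendI word_equiv_word[OF u] word_step_context[of _ _ u' "[]"] in auto)
  finally show ?thesis .
qed

lemma word_equiv_context:
  assumes "word_equiv D W X' Y' u u'" "is_word D W X a X'" "is_word D W Y' b Y"
  shows "word_equiv D W X Y (a @ u @ b) (a @ u' @ b)"
  by (rule word_equiv_append[OF word_equiv_refl[OF assms(2)] word_equiv_append[OF assms(1) word_equiv_refl[OF assms(3)]]])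

lemma word_equiv_comp:
  assumes "f \<in> Arr D" "g \<in> Arr D" "Dom D g = Cod D f"
  shows "word_equiv D W (Dom D f) (Cod D g) [Fw f, Fw g] [Fw (g \<cdot>\<^bsub>D\<^esub> f)]"
  by (rule word_equiv_step) (use assms word_step.ws_comp[of f D g W "[]" "[]"] in simp_all)

lemma word_equiv_inv:
  assumes "s \<in> W"
  shows "word_equiv D W (Dom D s) (Dom D s) [Fw s, Bw s] []" "word_equiv D W (Cod D s) (Cod D s) [Bw s, Fw s] []"
  by (rule word_equiv_step; use assms word_step.ws_inv1[of s W D "[]" "[]"] word_step.ws_inv2[of s W D "[]" "[]"] in simp)+

lemma word_equiv_cancel_left:
  assumes s: "s \<in> W" and e: "word_equiv D W (Dom D s) Y ([Fw s] @ u) ([Fw s] @ v)"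
  shows "word_equiv D W (Cod D s) Y u v"
proof -
  have uv: "is_word D W (Cod D s) u Y" "is_word D W (Cod D s) v Y"
    using word_equiv_word[OF e] by simp_all
  have "word_equiv D W (Cod D s) Y ([Bw s, Fw s] @ u) ([] @ u)" "word_equiv D W (Cod D s) Y ([Bw s, Fw s] @ v) ([] @ v)"
    by (rule word_equiv_append[OF word_equiv_inv(2)[OF s] word_equiv_refl]; rule uv)+
  moreover have "word_equiv D W (Cod D s) Y ([Bw s] @ [Fw s] @ u) ([Bw s] @ [Fw s] @ v)"
    by (intro word_equiv_append[OF word_equiv_refl e]) (use s in simp)
  ultimately show ?thesis
    by (simp only: append.simps append_assoc append_Nil2) (blast intro: word_equiv_sym word_equiv_trans)
qed

lemma word_equiv_cancel_right:
  assumes s: "s \<in> W" and e: "word_equiv D W X (Cod D s) (u @ [Fw s]) (v @ [Fw s])"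
    and uv: "is_word D W X u (Dom D s)" "is_word D W X v (Dom D s)"
  shows "word_equiv D W X (Dom D s) u v"
proof -
  have "word_equiv D W X (Dom D s) (u @ [Fw s, Bw s]) (u @ [])" "word_equiv D W X (Dom D s) (v @ [Fw s, Bw s]) (v @ [])"
    by (rule word_equiv_append[OF word_equiv_refl word_equiv_inv(1)[OF s]]; rule uv)+
  moreover have "word_equiv D W X (Dom D s) ((u @ [Fw s]) @ [Bw s]) ((v @ [Fw s]) @ [Bw s])"
    by (intro word_equiv_append[OF e word_equiv_refl]) (use s in simp)
  ultimately show ?thesis
    by (simp only: append.simps append_assoc append_Nil2) (blast intro: word_equiv_sym word_equiv_trans)
qed

section \<open>Arrows of the localization and their representatives\<close>

lemma word_class_word_equiv: "is_word D W X u Y \<Longrightarrow> word_class D W X Y u = {v. word_equiv D W X Y u v}"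
  by (simp add: word_class_def word_equiv_def)

lemma word_class_eq:
  assumes "is_word D W X u Y" "is_word D W X v Y"
  shows "word_class D W X Y u = word_class D W X Y v \<longleftrightarrow> word_equiv D W X Y u v"
  unfolding word_class_word_equiv[OF assms(1)] word_class_word_equiv[OF assms(2)]
  using word_equiv_sym word_equiv_trans word_equiv_refl assms by blast

lemma loc_hom:
  "\<phi> \<in> Hom (localization D W) X Y \<longleftrightarrow> (\<exists>w. is_word D W X w Y \<and> \<phi> = (X, Y, word_class D W X Y w))"
  by (auto simp: localization_def Hom_def)

text \<open>Composition in \<open>localization\<close> is a union over all pairs of representatives.
  Concatenation respects equivalence, so every member of this union is the same class, and the union
  is not empty.\<close>

lemma loc_comp:
  assumes u: "is_word D W X u Y" and v: "is_word D W Y v Z"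
  shows "(Y, Z, word_class D W Y Z v) \<cdot>\<^bsub>localization D W\<^esub> (X, Y, word_class D W X Y u)
    = (X, Z, word_class D W X Z (u @ v))"
proof -
  have "(\<Union>u' \<in> word_class D W X Y u. \<Union>v' \<in> word_class D W Y Z v. word_class D W X Z (u' @ v'))
    = word_class D W X Z (u @ v)" (is "?L = ?R")
  proof -
    have "word_class D W X Z (u' @ v') = ?R" if "u' \<in> word_class D W X Y u" "v' \<in> word_class D W Y Z v" for u' v'
    proof -
      have e: "word_equiv D W X Y u u'" "word_equiv D W Y Z v v'"
        using that by (simp_all add: word_class_word_equiv u v)
      then show ?thesis
        using word_class_eq[of X "u' @ v'" Z "u @ v"] word_equiv_append[OF e] word_equiv_sym word_equiv_word word_appendI u v by blast
    qed
    moreover have "u \<in> word_class D W X Y u" "v \<in> word_class D W Y Z v"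
      using u v by (simp_all add: word_class_word_equiv word_equiv_refl)
    ultimately show ?thesis by blast
  qed
  then show ?thesis by (simp add: localization_def)
qed

end

text \<open>An endofunctor \<open>B\<close> preserving \<open>W\<close> acts on words, and a natural transformation \<open>j : id \<rightarrow> B\<close>
  remains natural with respect to the formal inverses.\<close>

locale resolution = localizable D W
  for D :: "('x, 'y, 'z) cat_scheme" and W +
  fixes B :: "'x \<Rightarrow> 'x" and Bm :: "'y \<Rightarrow> 'y" and j :: "'x \<Rightarrow> 'y"
  assumes B_obj [simp]: "K \<in> Obj D \<Longrightarrow> B K \<in> Obj D"
    and B_arr [simp]: "f \<in> Arr D \<Longrightarrow> Bm f \<in> Arr D" "f \<in> Arr D \<Longrightarrow> Dom D (Bm f) = B (Dom D f)"
      "f \<in> Arr D \<Longrightarrow> Cod D (Bm f) = B (Cod D f)"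
    and B_id: "K \<in> Obj D \<Longrightarrow> Bm (Id D K) = Id D (B K)"
    and B_comp: "\<lbrakk>f \<in> Arr D; g \<in> Arr D; Dom D g = Cod D f\<rbrakk> \<Longrightarrow> Bm (g \<cdot>\<^bsub>D\<^esub> f) = Bm g \<cdot>\<^bsub>D\<^esub> Bm f"
    and B_W [simp]: "s \<in> W \<Longrightarrow> Bm s \<in> W"
    and j_arr [simp]: "K \<in> Obj D \<Longrightarrow> j K \<in> Arr D" "K \<in> Obj D \<Longrightarrow> Dom D (j K) = K"
      "K \<in> Obj D \<Longrightarrow> Cod D (j K) = B K"
    and j_nat: "f \<in> Arr D \<Longrightarrow> Bm f \<cdot>\<^bsub>D\<^esub> j (Dom D f) = j (Cod D f) \<cdot>\<^bsub>D\<^esub> f"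
begin

abbreviation "Bword \<equiv> map (map_zz Bm)"

lemma Bword_word: "is_word D W X w Y \<Longrightarrow> is_word D W (B X) (Bword w) (B Y)"
proof (induction w arbitrary: X)
  case (Cons a w)
  then show ?case by (cases a) auto
qed simp

lemma Bword_step:
  assumes "word_step D W u v"
  shows "word_step D W (Bword u) (Bword v)"
  using assms
proof cases
  case (ws_id X u' v')
  then show ?thesis using word_step.ws_id[of "B X" D W "Bword u'" "Bword v'"] by (simp add: B_id)
next
  case (ws_comp f g u' v')
  then show ?thesis using word_step.ws_comp[of "Bm f" D "Bm g" W "Bword u'" "Bword v'"] by (simp add: B_comp)
next
  case (ws_inv1 s u' v')
  then show ?thesis using word_step.ws_inv1[of "Bm s" W D "Bword u'" "Bword v'"] by simp
next
  case (ws_inv2 s u' v')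
  then show ?thesis using word_step.ws_inv2[of "Bm s" W D "Bword u'" "Bword v'"] by simp
qed

lemma Bword_word_equiv: "word_equiv D W X Y u v \<Longrightarrow> word_equiv D W (B X) (B Y) (Bword u) (Bword v)"
  by (rule word_equiv_map) (use Bword_word Bword_step in auto)

lemma j_square:
  assumes f: "f \<in> Arr D"
  shows "word_equiv D W (Dom D f) (B (Cod D f)) [Fw f, Fw (j (Cod D f))] [Fw (j (Dom D f)), Fw (Bm f)]"
proof -
  have "word_equiv D W (Dom D f) (B (Cod D f)) [Fw f, Fw (j (Cod D f))] [Fw (j (Cod D f) \<cdot>\<^bsub>D\<^esub> f)]"
    using word_equiv_comp[of f "j (Cod D f)"] f by simp
  also have "word_equiv D W (Dom D f) (B (Cod D f)) [Fw (j (Cod D f) \<cdot>\<^bsub>D\<^esub> f)] [Fw (j (Dom D f)), Fw (Bm f)]"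
    using word_equiv_sym[OF word_equiv_comp[of "j (Dom D f)" "Bm f"]] f by (simp add: j_nat)
  finally show ?thesis .
qed

lemma j_word:
  "is_word D W X w Y \<Longrightarrow> word_equiv D W X (B Y) (w @ [Fw (j Y)]) ([Fw (j X)] @ Bword w)"
proof (induction w arbitrary: X)
  case Nil
  then show ?case by (auto intro!: word_equiv_refl)
next
  case (Cons a w)
  show ?case
  proof (cases a)
    case (Fw f)
    have f: "f \<in> Arr D" "Dom D f = X" and w: "is_word D W (Cod D f) w Y" using Cons Fw by simp_all
    have "word_equiv D W X (B Y) ([Fw f] @ (w @ [Fw (j Y)])) ([Fw f] @ ([Fw (j (Cod D f))] @ Bword w))"
      by (rule word_equiv_append[OF word_equiv_refl Cons.IH[OF w]]) (use f in simp)
    also have "[Fw f] @ ([Fw (j (Cod D f))] @ Bword w) = [Fw f, Fw (j (Cod D f))] @ Bword w" by simp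
    also have "word_equiv D W X (B Y) \<dots> ([Fw (j X), Fw (Bm f)] @ Bword w)"
      by (rule word_equiv_append[OF _ word_equiv_refl[OF Bword_word[OF w]]]) (use j_square[OF f(1)] f in simp)
    finally show ?thesis by (simp add: Fw)
  next
    case (Bw s)
    have s: "s \<in> W" "Cod D s = X" and w: "is_word D W (Dom D s) w Y" using Cons Bw by simp_all
    \<comment> \<open>The square for \<open>j\<close> is available for forward letters only.
      Inserting this cancelling pair provides a forward \<open>Bm s\<close>, which the square
      exchanges for \<open>s\<close>; that \<open>s\<close> then cancels against the given
      \<open>Bw s\<close>.\<close>
    let ?t = "[Fw (Bm s), Bw (Bm s)]"
    have "word_equiv D W X (B Y) ([Bw s] @ (w @ [Fw (j Y)])) ([Bw s] @ ([Fw (j (Dom D s))] @ Bword w))"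
      by (rule word_equiv_append[OF word_equiv_refl Cons.IH[OF w]]) (use s in simp)
    also have "[Bw s] @ ([Fw (j (Dom D s))] @ Bword w) = [Bw s, Fw (j (Dom D s))] @ [] @ Bword w" by simp
    also have "word_equiv D W X (B Y) \<dots> ([Bw s, Fw (j (Dom D s))] @ ?t @ Bword w)"
      by (rule word_equiv_context[OF _ _ Bword_word[OF w]]) (use word_equiv_sym[OF word_equiv_inv(1)[OF B_W[OF s(1)]]] s in simp_all)
    also have "[Bw s, Fw (j (Dom D s))] @ ?t @ Bword w = [Bw s] @ [Fw (j (Dom D s)), Fw (Bm s)] @ (Bw (Bm s) # Bword w)" by simp
    also have "word_equiv D W X (B Y) \<dots> ([Bw s] @ [Fw s, Fw (j (Cod D s))] @ (Bw (Bm s) # Bword w))"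
      by (rule word_equiv_context[OF word_equiv_sym[OF j_square[OF W_arr[OF s(1)]]]]) (use s Bword_word[OF w] in simp_all)
    also have "[Bw s] @ [Fw s, Fw (j (Cod D s))] @ (Bw (Bm s) # Bword w) = [] @ [Bw s, Fw s] @ (Fw (j X) # Bw (Bm s) # Bword w)"
      using s by simp
    also have "word_equiv D W X (B Y) \<dots> ([] @ [] @ (Fw (j X) # Bw (Bm s) # Bword w))"
      by (rule word_equiv_context[OF word_equiv_inv(2)[OF s(1)]]) (use s Bword_word[OF w] cod_obj[of s] in auto)
    finally show ?thesis by (simp add: Bw)
  qed
qed

text \<open>The arrows \<open>i\<close> and \<open>i'\<close> are not assumed to be in
  \<open>W\<close>, only their images under \<open>Bm\<close> are. Cancellation of \<open>i\<close>
  therefore happens after \<open>Bm\<close> is applied, and \<open>j\<close>, being in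
  \<open>W\<close> at both targets, carries the result back through \<open>j_word\<close>.\<close>

lemma unique_lift:
  assumes i: "i \<in> Arr D" "Bm i \<in> W" and i': "i' \<in> Arr D" "Bm i' \<in> W"
    and j: "j (Cod D i) \<in> W" "j (Cod D i') \<in> W"
    and \<alpha>: "\<alpha> \<in> Hom D (Dom D i) (Dom D i')"
  shows "\<exists>!\<phi>. \<phi> \<in> Hom (localization D W) (Cod D i) (Cod D i') \<and>
    \<phi> \<cdot>\<^bsub>localization D W\<^esub> loc_arr D W i = loc_arr D W i' \<cdot>\<^bsub>localization D W\<^esub> loc_arr D W \<alpha>"
proof -
  let ?H = "Dom D i" and ?H' = "Dom D i'" and ?K = "Cod D i" and ?L = "Cod D i'"
  have a: "\<alpha> \<in> Arr D" "Dom D \<alpha> = ?H" "Cod D \<alpha> = ?H'" using \<alpha> by (simp_all add: mem_Hom)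
  have lift: "\<phi> \<cdot>\<^bsub>localization D W\<^esub> loc_arr D W i = loc_arr D W i' \<cdot>\<^bsub>localization D W\<^esub> loc_arr D W \<alpha>
      \<longleftrightarrow> word_equiv D W ?H ?L ([Fw i] @ w) [Fw \<alpha>, Fw i']"
    if w: "is_word D W ?K w ?L" "\<phi> = (?K, ?L, word_class D W ?K ?L w)" for \<phi> w
  proof -
    have "\<phi> \<cdot>\<^bsub>localization D W\<^esub> loc_arr D W i = (?H, ?L, word_class D W ?H ?L ([Fw i] @ w))"
      unfolding w(2) loc_arr_def by (rule loc_comp) (use i w in simp_all)
    moreover have "loc_arr D W i' \<cdot>\<^bsub>localization D W\<^esub> loc_arr D W \<alpha> = (?H, ?L, word_class D W ?H ?L ([Fw \<alpha>] @ [Fw i']))"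
      unfolding loc_arr_def a(2,3) by (rule loc_comp) (use i' a in simp_all)
    ultimately show ?thesis
      using word_class_eq[of ?H "[Fw i] @ w" ?L "[Fw \<alpha>] @ [Fw i']"] w i i' a by simp
  qed
  \<comment> \<open>Words list the path, hence the letters stand in the reverse of composition
    order. In the check below, \<open>i\<close> is carried across the word by the squares for
    \<open>j\<close>, and each formal inverse meets its partner in turn.\<close>
  let ?w = "[Fw (j ?K), Bw (Bm i), Fw (Bm \<alpha>), Fw (Bm i'), Bw (j ?L)]"
  have w: "is_word D W ?K ?w ?L" using i i' j a by simp
  have ew: "word_equiv D W ?H ?L ([Fw i] @ ?w) [Fw \<alpha>, Fw i']"
  proof -
    let ?z = "[Fw (Bm \<alpha>), Fw (Bm i'), Bw (j ?L)]"
    have z: "is_word D W (B ?H) ?z ?L" using i' j a by simp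
    have "[Fw i] @ ?w = [] @ [Fw i, Fw (j ?K)] @ (Bw (Bm i) # ?z)" by simp
    also have "word_equiv D W ?H ?L \<dots> ([] @ [Fw (j ?H), Fw (Bm i)] @ (Bw (Bm i) # ?z))"
      by (rule word_equiv_context[OF j_square]) (use i i' z in simp_all)
    also have "[] @ [Fw (j ?H), Fw (Bm i)] @ (Bw (Bm i) # ?z) = [Fw (j ?H)] @ [Fw (Bm i), Bw (Bm i)] @ ?z" by simp
    also have "word_equiv D W ?H ?L \<dots> ([Fw (j ?H)] @ [] @ ?z)"
      by (rule word_equiv_context[OF word_equiv_inv(1)[OF i(2)]]) (use i i' z in simp_all)
    also have "[Fw (j ?H)] @ [] @ ?z = [] @ [Fw (j ?H), Fw (Bm \<alpha>)] @ [Fw (Bm i'), Bw (j ?L)]" by simp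
    also have "word_equiv D W ?H ?L \<dots> ([] @ [Fw \<alpha>, Fw (j ?H')] @ [Fw (Bm i'), Bw (j ?L)])"
      by (rule word_equiv_context[OF word_equiv_sym]) (use j_square[OF a(1)] a i i' j in simp_all)
    also have "[] @ [Fw \<alpha>, Fw (j ?H')] @ [Fw (Bm i'), Bw (j ?L)] = [Fw \<alpha>] @ [Fw (j ?H'), Fw (Bm i')] @ [Bw (j ?L)]" by simp
    also have "word_equiv D W ?H ?L \<dots> ([Fw \<alpha>] @ [Fw i', Fw (j ?L)] @ [Bw (j ?L)])"
      by (rule word_equiv_context[OF word_equiv_sym[OF j_square[OF i'(1)]]]) (use a i' j in simp_all)
    also have "[Fw \<alpha>] @ [Fw i', Fw (j ?L)] @ [Bw (j ?L)] = [Fw \<alpha>, Fw i'] @ [Fw (j ?L), Bw (j ?L)] @ []" by simp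
    also have "word_equiv D W ?H ?L \<dots> ([Fw \<alpha>, Fw i'] @ [] @ [])"
      by (rule word_equiv_context[OF word_equiv_inv(1)[OF j(2)]]) (use a i' in simp_all)
    finally show ?thesis by simp
  qed
  then have ex: "(?K, ?L, word_class D W ?K ?L ?w) \<in> Hom (localization D W) ?K ?L \<and>
      (?K, ?L, word_class D W ?K ?L ?w) \<cdot>\<^bsub>localization D W\<^esub> loc_arr D W i = loc_arr D W i' \<cdot>\<^bsub>localization D W\<^esub> loc_arr D W \<alpha>"
    using lift[OF w refl] w loc_hom by blast
  have uniq: "word_equiv D W ?K ?L u v"
    if u: "is_word D W ?K u ?L" "word_equiv D W ?H ?L ([Fw i] @ u) [Fw \<alpha>, Fw i']"
      and v: "is_word D W ?K v ?L" "word_equiv D W ?H ?L ([Fw i] @ v) [Fw \<alpha>, Fw i']" for u v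
  proof -
    have "word_equiv D W ?H ?L ([Fw i] @ u) ([Fw i] @ v)" using u v word_equiv_sym word_equiv_trans by blast
    from Bword_word_equiv[OF this] have "word_equiv D W (B ?H) (B ?L) ([Fw (Bm i)] @ Bword u) ([Fw (Bm i)] @ Bword v)" by simp
    then have uv: "word_equiv D W (B ?K) (B ?L) (Bword u) (Bword v)"
      using word_equiv_cancel_left[OF i(2), of "B ?L"] i by simp
    have B: "word_equiv D W ?K (B ?L) ([Fw (j ?K)] @ Bword u) ([Fw (j ?K)] @ Bword v)"
      by (rule word_equiv_append[OF word_equiv_refl uv]) (use i in simp)
    have "word_equiv D W ?K (B ?L) (u @ [Fw (j ?L)]) (v @ [Fw (j ?L)])"
      using word_equiv_trans[OF word_equiv_trans[OF j_word[OF u(1)] B] word_equiv_sym[OF j_word[OF v(1)]]] .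
    then show ?thesis using word_equiv_cancel_right[OF j(2), of ?K u v] u(1) v(1) i' by simp
  qed
  show ?thesis
  proof (rule ex1I, rule ex)
    fix \<psi> assume p: "\<psi> \<in> Hom (localization D W) ?K ?L \<and>
      \<psi> \<cdot>\<^bsub>localization D W\<^esub> loc_arr D W i = loc_arr D W i' \<cdot>\<^bsub>localization D W\<^esub> loc_arr D W \<alpha>"
    then obtain v where v: "is_word D W ?K v ?L" "\<psi> = (?K, ?L, word_class D W ?K ?L v)"
      using loc_hom by blast
    have "word_equiv D W ?K ?L v ?w"
      by (rule uniq[OF v(1) iffD1[OF lift[OF v] conjunct2[OF p]] w ew])
    then show "\<psi> = (?K, ?L, word_class D W ?K ?L ?w)"
      using v w word_class_eq by blast
  qed
qed

end

section \<open>Acyclic models\<close>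

locale main_setting = triple_setting C MC A MA G \<epsilon> \<delta> W
  for C :: "('o, 'm, 'y) cat_scheme" and MC :: "('o, 'm) tensor"
    and A :: "('p, 'n, 'z) acat_scheme" and MA :: "('p, 'n) tensor"
    and G :: "('o, 'm, 'o, 'm) mfctr" and \<epsilon> \<delta> :: "'o \<Rightarrow> 'm" and W :: "('o, 'm, 'p, 'n) chm_arr set" +
  assumes iso_W: "inverse_arrows (mon_ch C MC A MA) a b \<Longrightarrow> a \<in> W"
    and saw_W: "saw_compatible C MC A MA W"
begin

text \<open>Compatibility of \<open>W\<close> with the Alexander--Whitney simple functor, applied to identities, makes
  \<open>saw B\<close> a monoidal functor without any computation.\<close>

lemma admissible_std:
  assumes K: "K \<in> Obj D"
  shows "admissible (std K)"
proof -
  let ?B = "std K"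
  have cs: "is_cosimplicial D ?B" using K by (rule std_cosimplicial)
  have m: "is_cosimp_map D ?B ?B (\<lambda>n. (Tm ^^ (n + 1)) (Id D K))" using std_map[of "Id D K"] K by simp
  have "(Tm ^^ (n + 1)) (Id D K) \<in> W" for n using W_id[OF K] by (rule Tpow_W)
  then have "saw_map C MC A MA ?B ?B (\<lambda>n. (Tm ^^ (n + 1)) (Id D K)) \<in> W"
    using saw_W m std_bounded[OF K] unfolding saw_compatible_def by blast
  then have "saw_map C MC A MA ?B ?B (\<lambda>n. (Tm ^^ (n + 1)) (Id D K)) \<in> Arr D" using W_arr by blast
  then have "saw ?B \<in> Obj D" by (simp add: mon_ch_simps(2) saw_map_simps)
  then show ?thesis using cs std_bounded[OF K] by (simp add: admissible_def)
qed

section \<open>The standard construction as an endofunctor preserving weak equivalences\<close>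

definition "Bo K = saw (std K)"
definition "Bm f = saw_map C MC A MA (std (Dom D f)) (std (Cod D f)) (\<lambda>n. (Tm ^^ (n + 1)) f)"
definition "j K = std_coaug C MC A MA G \<epsilon> \<delta> K"

text \<open>The two cofaces out of \<open>T K\<close> are \<eta> at \<open>T K\<close> and
  \<open>T\<close> applied to \<eta>; they agree after \<eta> by naturality of \<eta> at \<eta>
  itself.\<close>

lemma std_coaug_facts:
  assumes K: "K \<in> Obj D"
  shows "\<eta> K \<in> Arr D" "Dom D (\<eta> K) = K" "Cod D (\<eta> K) = cso (std K) 0"
    "cface (std K) 0 0 \<cdot>\<^bsub>D\<^esub> \<eta> K = cface (std K) 0 1 \<cdot>\<^bsub>D\<^esub> \<eta> K"
  using K unit_nat[of "\<eta> K"] by (simp_all add: std_def)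

lemma j_coaug: "j K = coaug (std K) K (\<eta> K)"
  by (simp add: j_def std_coaug_def coaug_def std_constr_std Let_def)

sublocale resolution D W Bo Bm j
proof
  show "W \<subseteq> Arr D" by (rule W_arr)
  show "Bo K \<in> Obj D" if "K \<in> Obj D" for K
    using admissible_std[OF that] by (simp add: Bo_def admissible_def)
  show "Bm f \<in> Arr D" "Dom D (Bm f) = Bo (Dom D f)" "Cod D (Bm f) = Bo (Cod D f)" if "f \<in> Arr D" for f
    using saw_map_arr[OF admissible_std admissible_std std_map[OF that]] that by (simp_all add: Bm_def Bo_def)
  show "Bm (Id D K) = Id D (Bo K)" if K: "K \<in> Obj D" for K
  proof -
    have "is_cosimp_map D (std K) (std K) (\<lambda>n. (Tm ^^ (n + 1)) (Id D K))" using std_map[of "Id D K"] K by simp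
    moreover have "(Tm ^^ (n + 1)) (Id D K) = Id D (cso (std K) n)" for n
      using Tmpow_id[OF K, of "n + 1"] by (simp add: std_def)
    ultimately show ?thesis using saw_map_id[OF admissible_std[OF K]] K by (simp add: Bm_def Bo_def del: funpow.simps)
  qed
  show "Bm (g \<cdot>\<^bsub>D\<^esub> f) = Bm g \<cdot>\<^bsub>D\<^esub> Bm f" if fg: "f \<in> Arr D" "g \<in> Arr D" "Dom D g = Cod D f" for f g
  proof -
    let ?K = "Dom D f" and ?L = "Cod D f" and ?M = "Cod D g"
    have o: "?K \<in> Obj D" "?L \<in> Obj D" "?M \<in> Obj D" using fg by simp_all
    have f: "is_cosimp_map D (std ?K) (std ?L) (\<lambda>n. (Tm ^^ (n + 1)) f)" by (rule std_map[OF fg(1)])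
    have g: "is_cosimp_map D (std ?L) (std ?M) (\<lambda>n. (Tm ^^ (n + 1)) g)" using std_map[OF fg(2)] fg(3) by simp
    have h: "is_cosimp_map D (std ?K) (std ?M) (\<lambda>n. (Tm ^^ (n + 1)) (g \<cdot>\<^bsub>D\<^esub> f))"
      using std_map[of "g \<cdot>\<^bsub>D\<^esub> f"] fg by (simp del: funpow.simps)
    have "saw_map C MC A MA (std ?L) (std ?M) (\<lambda>n. (Tm ^^ (n + 1)) g) \<cdot>\<^bsub>D\<^esub> saw_map C MC A MA (std ?K) (std ?L) (\<lambda>n. (Tm ^^ (n + 1)) f)
      = saw_map C MC A MA (std ?K) (std ?M) (\<lambda>n. (Tm ^^ (n + 1)) (g \<cdot>\<^bsub>D\<^esub> f))"
      by (rule saw_map_comp[OF admissible_std[OF o(1)] admissible_std[OF o(2)] admissible_std[OF o(3)] f g h])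
        (rule Tmpow_comp[OF fg])
    then show ?thesis using fg by (simp add: Bm_def del: funpow.simps)
  qed
  show "Bm s \<in> W" if s: "s \<in> W" for s
  proof -
    have "s \<in> Arr D" using s W_arr by blast
    then show ?thesis
      using saw_W std_map std_bounded Tpow_W[OF s] D_arr(1,2) unfolding saw_compatible_def Bm_def by blast
  qed
  show "j K \<in> Arr D" "Dom D (j K) = K" "Cod D (j K) = Bo K" if K: "K \<in> Obj D" for K
    using coaug_arr[OF admissible_std[OF K] std_coaug_facts[OF K]] by (simp_all add: j_coaug Bo_def)
  show "Bm f \<cdot>\<^bsub>D\<^esub> j (Dom D f) = j (Cod D f) \<cdot>\<^bsub>D\<^esub> f" if f: "f \<in> Arr D" for f
  proof -
    have o: "Dom D f \<in> Obj D" "Cod D f \<in> Obj D" using f by simp_all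
    show ?thesis unfolding Bm_def j_coaug
      by (rule coaug_nat[OF admissible_std[OF o(1)] std_coaug_facts[OF o(1)] admissible_std[OF o(2)] std_coaug_facts[OF o(2)] std_map[OF f] f refl refl])
        (use unit_nat[OF f] in simp)
  qed
qed

text \<open>The standard construction begins with the first power of \<open>T\<close>, so every
  level of the cosimplicial map is an iterate of \<open>Tm f\<close>. This is the point where
  acyclicity turns the inclusion of \<open>H0\<close> into a weak equivalence.\<close>

lemma Bm_acyclic:
  assumes "f \<in> Arr D" "Tm f \<in> W"
  shows "Bm f \<in> W"
proof -
  have "(Tm ^^ (n + 1)) f \<in> W" for n
    using Tpow_W[OF assms(2), of n] by (simp add: funpow_swap1)
  then show ?thesis
    using saw_W std_map[OF assms(1)] std_bounded D_arr(1,2)[OF assms(1)] unfolding saw_compatible_def Bm_def by blast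
qed

theorem acyclic_models:
  assumes K: "K \<in> Obj D" "vanishes_below_on C A 0 K" and L: "L \<in> Obj D" "vanishes_below_on C A 0 L"
    and aK: "T_acyclic C MC A MA G W K" and pK: "T_presentable C MC A MA G \<epsilon> \<delta> W K"
    and aL: "T_acyclic C MC A MA G W L" and pL: "T_presentable C MC A MA G \<epsilon> \<delta> W L"
    and \<alpha>: "\<alpha> \<in> Hom D (H0 C MC A MA K) (H0 C MC A MA L)"
  shows "\<exists>!\<phi>. \<phi> \<in> Hom (localization D W) K L \<and> lifts C MC A MA W \<phi> K L \<alpha>"
    "is_iso D \<alpha> \<Longrightarrow> weakly_equivalent D W K L"
proof -
  let ?i = "H0_incl C MC A MA K" and ?i' = "H0_incl C MC A MA L"
  have a: "\<alpha> \<in> Arr D" "Dom D \<alpha> = H0 C MC A MA K" "Cod D \<alpha> = H0 C MC A MA L" using \<alpha> by (simp_all add: mem_Hom)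
  \<comment> \<open>Read off from \<alpha>, whose source and target are objects because it is an
    arrow.\<close>
  have H: "H0 C MC A MA K \<in> Obj D" "H0 C MC A MA L \<in> Obj D" using a D_arr(1,2)[OF a(1)] by simp_all
  note iK = H0_incl_arr[OF K H(1)] and iL = H0_incl_arr[OF L H(2)]
  have BK: "Bm ?i \<in> W" and BL: "Bm ?i' \<in> W"
    using Bm_acyclic iK iL aK aL by (simp_all add: T_acyclic_def)
  have jK: "j K \<in> W" and jL: "j L \<in> W" using pK pL by (simp_all add: T_presentable_def j_def)
  show "\<exists>!\<phi>. \<phi> \<in> Hom (localization D W) K L \<and> lifts C MC A MA W \<phi> K L \<alpha>"
    using unique_lift[of ?i ?i' \<alpha>] iK iL BK BL jK jL \<alpha> by (simp add: lifts_def Let_def)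
  assume "is_iso D \<alpha>"
  then have "\<alpha> \<in> W" using iso_W unfolding is_iso_def by blast
  then have Ba: "Bm \<alpha> \<in> W" by simp
  let ?r = "\<lambda>U V. \<exists>s \<in> W. s \<in> Hom D U V"
  \<comment> \<open>Once \<open>Bm \<alpha>\<close> is in \<open>W\<close>, every letter of the word
    that represents the lift is an arrow of \<open>W\<close> or the inverse of one: K -> B K <- B H0
    K -> B H0 L -> B L <- L. This word is the zigzag.\<close>
  have 1: "?r K (Bo K)" using jK K by (intro bexI[of _ "j K"]) (simp_all add: mem_Hom)
  have 2: "?r (Bo (H0 C MC A MA K)) (Bo K)" using BK iK by (intro bexI[of _ "Bm ?i"]) (simp_all add: mem_Hom)
  have 3: "?r (Bo (H0 C MC A MA K)) (Bo (H0 C MC A MA L))" using Ba a by (intro bexI[of _ "Bm \<alpha>"]) (simp_all add: mem_Hom)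
  have 4: "?r (Bo (H0 C MC A MA L)) (Bo L)" using BL iL by (intro bexI[of _ "Bm ?i'"]) (simp_all add: mem_Hom)
  have 5: "?r L (Bo L)" using jL L by (intro bexI[of _ "j L"]) (simp_all add: mem_Hom)
  note fwd = r_into_equivclp[of ?r] and bwd = equivclp_sym[OF r_into_equivclp[of ?r]]
  note tr = equivclp_trans[of ?r]
  have "equivclp ?r K L"
    by (rule tr[OF fwd[OF 1] tr[OF bwd[OF 2] tr[OF fwd[OF 3] tr[OF fwd[OF 4] bwd[OF 5]]]]])
  then show "weakly_equivalent D W K L" using K L by (simp add: weakly_equivalent_def)
qed

end

theorem theorem8p2p1:
  fixes C :: "('o, 'm, 'y) cat_scheme" and MC :: "('o, 'm) tensor"
    and A :: "('p, 'n, 'z) acat_scheme" and MA :: "('p, 'n) tensor"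
    and G :: "('o, 'm, 'o, 'm) mfctr" and \<epsilon> \<delta> :: "'o \<Rightarrow> 'm"
    and K L :: "('o, 'm, 'p, 'n) chm"
  assumes "monoidal_category C MC"
    and "abelian_monoidal_category A MA"
    and "is_acyclic_class (fun_cat (op_cat C) A) \<Gamma>"
    and "W = weak_equivalences C MC A MA \<Gamma>"
    and "homotopy_equivalences C MC A MA \<subseteq> W"
    and "saw_compatible C MC A MA W"
    and "monoidal_cotriple C MC G \<epsilon> \<delta>"
    and "T_map C A G ` W \<subseteq> W"
    and "K \<in> Obj (mon_ch C MC A MA)" and "vanishes_below_on C A 0 K"
    and "L \<in> Obj (mon_ch C MC A MA)" and "vanishes_below_on C A 0 L"
    and "T_acyclic C MC A MA G W K" and "T_presentable C MC A MA G \<epsilon> \<delta> W K"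
    and "T_acyclic C MC A MA G W L" and "T_presentable C MC A MA G \<epsilon> \<delta> W L"
  shows "(\<forall>\<alpha> \<in> Hom (mon_ch C MC A MA) (H0 C MC A MA K) (H0 C MC A MA L).
            \<exists>!\<phi>. \<phi> \<in> Hom (localization (mon_ch C MC A MA) W) K L \<and> lifts C MC A MA W \<phi> K L \<alpha>) \<and>
         (isomorphic (mon_ch C MC A MA) (H0 C MC A MA K) (H0 C MC A MA L)
            \<longrightarrow> weakly_equivalent (mon_ch C MC A MA) W K L)"
proof -
  interpret mon_setting C MC A MA
    using assms(1,2) by (simp add: mon_setting_def)
  have iso: "a \<in> W" if "inverse_arrows D a b" for a b
    using iso_homotopy_equivalence[OF that] assms(5) by blast
  have idW: "Id D K \<in> W" if "K \<in> Obj D" for K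
    by (rule iso[of _ "Id D K"]) (use that in \<open>simp add: inverse_arrows_def mem_Hom\<close>)
  interpret main_setting C MC A MA G \<epsilon> \<delta> W
  proof
    show "W \<subseteq> Arr D" using assms(4) by (auto simp: weak_equivalences_def)
  qed (use assms iso idW in blast)+
  show ?thesis
    using acyclic_models[OF assms(9-16)] unfolding isomorphic_def by blast
qed

end
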